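(* Suppose execution correctness is i.i.d. Bernoulli as described in the context, and $\mathcal G$ is a finite implicitly represented workflow-type class with $c_g\le c_{\max}$. Suppose $\psi_k(r)=h(r/k)$ for a common increasing concave function $h:[0,1]\to[0,1]$ with $h(0)=0$, $h(1)=1$, and let $\mathcal K\subseteq\{1,\dots,K_{\max}\}$ have coverage ratio $\varrho\ge1$ (for every $k\le K_{\max}$ there is $b\in\mathcal K$ with $b\le k\le\varrho b$). Retain a baseline $\boldsymbol m^0$ with $\Pi^{\mathrm{stoch}}_{\psi,\gamma}(\boldsymbol m^0)\ge\underline V>0$. Run the IID Stochastic Dual-Guided Workflow Optimization algorithm (described in the context) with sample sizes $L_1,L_2$, confidence levels $\delta_1,\delta_2\in(0,1)$, ellipsoid tolerance $\varepsilon_{\mathrm{ell}}>0$, and pricing-batch size $m$. Suppose every primitive pricing call at a query $(k,q,\mu)$ returns, with probability at least $p_{\mathrm{orc}}>0$ conditional on the query history, a workflow $\widetilde g$ with $$\widehat{\mathcal S}^{(1)}_{kq}(\widetilde g;\mu)\ge\max_{g\in\mathcal G}\widehat{\mathcal S}^{(1)}_{kq}(g;\mu)-\tau_k,$$ and let $N^{\mathrm{stoch}}_{\mathrm{price}}(\varepsilon_{\mathrm{ell}})$ bound the total number of pricing batches. Define $\varepsilon_{\mathrm{rnd}}=\max_{k\in\mathcal K}c_{\psi,k}/e$. Then, with probability at least $$1-\delta_1-\delta_2-N^{\mathrm{stoch}}_{\mathrm{price}}(\varepsilon_{\mathrm{ell}})\,e^{-p_{\mathrm{orc}}m},$$ the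 returned execution-count vector $\widehat{\boldsymbol m}$ satisfies $$\Pi^{\mathrm{stoch}}_{\psi,\gamma}(\widehat{\boldsymbol m})\ge\max\Big\{\underline V,\ \frac1\varrho\mathrm{OPT}^{\mathrm{stoch}}_{\psi,\gamma}(\mathcal G)-\varepsilon_{\mathrm{ell}}-\varepsilon_{\mathrm{rnd}}-2\varepsilon_{\mathrm{est}}(L_1,\delta_1)-2\varepsilon_{\mathrm{samp}}(L_2,\delta_2)\Big\}.$$ Consequently, $$\Pi^{\mathrm{stoch}}_{\psi,\gamma}(\widehat{\boldsymbol m})\ge\frac1\varrho\,\frac{\underline V}{\underline V+\varepsilon_{\mathrm{ell}}+\varepsilon_{\mathrm{rnd}}+2\varepsilon_{\mathrm{est}}(L_1,\delta_1)+2\varepsilon_{\mathrm{samp}}(L_2,\delta_2)}\,\mathrm{OPT}^{\mathrm{stoch}}_{\psi,\gamma}(\mathcal G).$$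
   Context: Setting. There are $n\ge1$ tasks $i$, workflow types $g\in\mathcal G$, success probabilities $a_{ig}\in[0,1]$, costs $c_g\ge0$, cost price $\gamma\ge0$, integer $K_{\max}\ge1$. Each execution of $g$ on task $i$ has a correctness indicator distributed as $\mathrm{Bernoulli}(a_{ig})$; indicators are mutually independent across tasks, workflow types, execution copies and sampling stages. Recovery curves $\psi_k:\{0,\dots,k\}\to[0,1]$ satisfy $\psi_k(0)=0$, $\psi_k(k)=1$; $d_{\ell,k}=\psi_k(\ell)-\psi_k(\ell-1)$, $c_{\psi,k}=1-d_{k,k}/d_{1,k}$, $\widetilde\psi_k(r)=d_{k,k}r+\sum_{t=1}^{k-1}(d_{t,k}-d_{t+1,k})\min\{r,t\}$ for $r\ge0$. For $\boldsymbol m\in\mathbb Z_+^{\mathcal G}$: $k(\boldsymbol m)=\sum_gm_g$, $C(\boldsymbol m)=\sum_gc_gm_g$; $R_i(\boldsymbol m)=\sum_g\sum_{q=1}^{m_g}Z_{igq}$ with $Z_{igq}\sim\mathrm{Bernoulli}(a_{ig})$ independent. $\Pi^{\mathrm{stoch}}_{\psi,\gamma}(\boldsymbol m)=\mathbb E[\frac1n\sum_i\psi_{k(\boldsymbol m)}(R_i(\boldsymbol m))]-\gamma C(\boldsymbol m)$, with value $0$ at $\boldsymbol 0$; $\mathrm{OPT}^{\mathrm{stoch}}_{\psi,\gamma}(\mathcal G)$ is its maximum over $\boldsymbol m\in\mathbb Z_+^{\mathcal G}$ with $k(\boldsymbol m)\le K_{\max}$. Stage 1 estimates. For every pair $(i,g)$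 there is a potential panel $Z^{(1,1)}_{ig},\dots,Z^{(1,L_1)}_{ig}$ of i.i.d. $\mathrm{Bernoulli}(a_{ig})$ draws (all panels independent; a panel is revealed only when $g$ is first evaluated), and $\widehat a^{(1)}_{ig}=\frac1{L_1}\sum_\ell Z^{(1,\ell)}_{ig}$. Set $\varepsilon_a(L_1,\delta_1)=\sqrt{\log(2n|\mathcal G|/\delta_1)/(2L_1)}$ and $\varepsilon_{\mathrm{est}}(L_1,\delta_1)=\min\{1,K_{\max}\varepsilon_a(L_1,\delta_1)\}$. Plug-in dual for size $k$. Let $\Omega_k=\{1,\dots,L_1\}^{n\times k}$, $p_\omega=L_1^{-nk}$, $U_{iq}(\omega)$ the $(i,q)$ coordinate of $\omega$, and $\widehat A^{(1)}_{igq}(\omega)=\mathbf 1\{U_{iq}(\omega)\le L_1\widehat a^{(1)}_{ig}\}$. Let $\mathcal X_k(\mathcal G)=\{x\ge0:\sum_{g\in\mathcal G}x_{gq}=1,\ q=1,\dots,k\}$, and for $x\in\mathcal X_k(\mathcal G)$ let $\widehat{\mathcal F}^{(1)}_k(x)=\sum_\omega p_\omega\frac1n\sum_i\widetilde\psi_k\big(\sum_{q,g}\widehat A^{(1)}_{igq}(\omega)x_{gq}\big)-\gamma\sum_{q,g}c_gx_{gq}$, and $\widehat{\mathcal L}^{(1)}_k(\mathcal G)=\max_{x\in\mathcal X_k(\mathcal G)}\widehat{\mathcal F}^{(1)}_k(x)$. The plug-in epigraph dual is: minimize $\sum_\omega p_\omega\sum_i\xi_{i\omega}+\sum_{q=1}^k\theta_q$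 subject to the explicit constraints $\xi_{i\omega}+r\mu_{i\omega}\ge\psi_k(r)/n$ ($r=0,\dots,k$), $0\le\mu_{i\omega}\le d_{1,k}/n$, $0\le\xi_{i\omega}\le1/n$, $-\gamma c_{\max}\le\theta_q\le d_{1,k}$, and the workflow constraints $\widehat{\mathcal S}^{(1)}_{kq}(g;\mu)\le\theta_q$ for all $g\in\mathcal G$, $q=1,\dots,k$, where $\widehat{\mathcal S}^{(1)}_{kq}(g;\mu)=\sum_\omega p_\omega\sum_i\mu_{i\omega}\widehat A^{(1)}_{igq}(\omega)-\gamma c_g$. Algorithm (IID Stochastic Dual-Guided Workflow Optimization). Input: initial pool $\mathcal M_0\subseteq\mathcal G$, the grid and parameters, and a baseline $\boldsymbol m^0$ supported on $\mathcal M_0$ with known lower bound $\underline V$ on its value. Evaluate all $g\in\mathcal M_0$ (reveal Stage-1 panels) and set $\mathcal M_{\mathrm{rec}}=\mathcal M_0$. For each $k\in\mathcal K$: set $\tau_k=\varepsilon_{\mathrm{ell}}/(2k)$ and run the ellipsoid method on the plug-in epigraph dual with optimization tolerance $\varepsilon_{\mathrm{ell}}/2$. At each iterate $(\mu^t,\xi^t,\theta^t)$ separate violated explicit constraints directly; if none is violated, for each $q=1,\dots,k$ make a batch of $m$ primitive pricing calls at $(k,q,\mu^t)$ with tolerance $\tau_k$ (each newly proposed workflow is evaluated with its own $L_1$-panel and added to $\mathcal M_{\mathrm{rec}}$ before being scored), retain the proposed workflow $g^{tq}$ with the largest score; if $\widehat{\mathcal S}^{(1)}_{kq}(g^{tq};\mu^t)>\theta^t_q$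 add its violated workflow constraint, otherwise use the weak-separation certificate $\max_g\widehat{\mathcal S}^{(1)}_{kq}(g;\mu^t)\le\theta_q^t+\tau_k$. After termination, by primal recovery construct $x^k\in\mathcal X_k(\mathcal G)$ supported on $\mathcal M_{\mathrm{rec}}$ with $\widehat{\mathcal F}^{(1)}_k(x^k)\ge\widehat{\mathcal L}^{(1)}_k(\mathcal G)-\varepsilon_{\mathrm{ell}}$. After all $k\in\mathcal K$, freeze $\mathcal M_T=\mathcal M_{\mathrm{rec}}$. Stage 2. Draw mutually independent $Z^{(2,\ell)}_{igq}\sim\mathrm{Bernoulli}(a_{ig})$ for $\ell=1,\dots,L_2$, $i=1,\dots,n$, $g\in\mathcal M_T$, $q=1,\dots,K_{\max}$, independent of the generation history. Let $R_i^{(2,\ell)}(\boldsymbol m)=\sum_{g\in\mathcal M_T}\sum_{q=1}^{m_g}Z^{(2,\ell)}_{igq}$ and $\widehat\Pi^{\mathrm{final}}_{L_2}(\boldsymbol m)=\frac1{L_2}\sum_\ell\frac1n\sum_i\psi_{k(\boldsymbol m)}(R_i^{(2,\ell)}(\boldsymbol m))-\gamma C(\boldsymbol m)$ (value $0$ at $\boldsymbol 0$). Let $\mathcal C_{\mathcal K}(\mathcal M_T)=\{\boldsymbol 0\}\cup\{\boldsymbol m\in\mathbb Z_+^{\mathcal M_T}:k(\boldsymbol m)\in\mathcal K\}$, of cardinality $N_T=1+\sum_{k\in\mathcal K}\binom{|\mathcal M_T|+k-1}{k}$; the baseline satisfies $\boldsymbol m^0\in\mathcal C_{\mathcal K}(\mathcal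 M_T)$. Set $\varepsilon_{\mathrm{samp}}(L_2,\delta_2)=\sqrt{\log(2N_T/\delta_2)/(2nL_2)}$. Let $\widetilde{\boldsymbol m}$ maximize $\widehat\Pi^{\mathrm{final}}_{L_2}$ over $\mathcal C_{\mathcal K}(\mathcal M_T)$. Return $\widehat{\boldsymbol m}=\widetilde{\boldsymbol m}$ if $\widehat\Pi^{\mathrm{final}}_{L_2}(\widetilde{\boldsymbol m})-\varepsilon_{\mathrm{samp}}(L_2,\delta_2)\ge\underline V$, and $\widehat{\boldsymbol m}=\boldsymbol m^0$ otherwise. *)

theory Defs
  imports "HOL-Probability.Probability" "HOL-Probability.Product_PMF"
begin

section \<open>Stochastic workflow portfolios\<close>

text \<open>Tasks, execution copies and panel positions are numbered from 1.\<close>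

record 'g problem =
  tasks :: nat
  workflows :: "'g set"
  acc :: "nat \<Rightarrow> 'g \<Rightarrow> real"
  cost :: "'g \<Rightarrow> real"
  price :: real
  curve :: "nat \<Rightarrow> nat \<Rightarrow> real"
  Kmax :: nat

text \<open>Elements of \<open>\<int>\<^sub>+\<^sup>S\<close> are functions on the whole type that vanish outside \<open>S\<close>.\<close>

definition counts_on :: "'g set \<Rightarrow> ('g \<Rightarrow> nat) set" where
  "counts_on S = {m. \<forall>g. g \<notin> S \<longrightarrow> m g = 0}"

definition size_of :: "'g problem \<Rightarrow> ('g \<Rightarrow> nat) \<Rightarrow> nat" where
  "size_of P m = (\<Sum>g\<in>workflows P. m g)"

definition cost_of :: "'g problem \<Rightarrow> ('g \<Rightarrow> nat) \<Rightarrow> real" where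
  "cost_of P m = (\<Sum>g\<in>workflows P. cost P g * real (m g))"

definition increment :: "'g problem \<Rightarrow> nat \<Rightarrow> nat \<Rightarrow> real" where
  "increment P k l = curve P k l - curve P k (l - 1)"

definition curvature :: "'g problem \<Rightarrow> nat \<Rightarrow> real" where
  "curvature P k = 1 - increment P k k / increment P k 1"

definition exec_pmf :: "'g problem \<Rightarrow> ('g \<Rightarrow> nat) \<Rightarrow> (nat \<times> 'g \<times> nat \<Rightarrow> bool) pmf" where
  "exec_pmf P m =
     Pi_pmf ({1..tasks P} \<times> (SIGMA g:workflows P. {1..m g})) False
       (\<lambda>(i, g, q). bernoulli_pmf (acc P i g))"

definition stoch_value :: "'g problem \<Rightarrow> ('g \<Rightarrow> nat) \<Rightarrow> real" where
  "stoch_value P m =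
     (if m = (\<lambda>_. 0) then 0 else
        measure_pmf.expectation (exec_pmf P m)
          (\<lambda>Z. (\<Sum>i=1..tasks P.
                  curve P (size_of P m) (\<Sum>g\<in>workflows P. \<Sum>q=1..m g. of_bool (Z (i, g, q))))
                / real (tasks P))
        - price P * cost_of P m)"

definition stoch_opt :: "'g problem \<Rightarrow> real" where
  "stoch_opt P = Max (stoch_value P ` {m \<in> counts_on (workflows P). size_of P m \<le> Kmax P})"


section \<open>The algorithm\<close>

record 'g config =
  panel1 :: nat
  panel2 :: nat
  delta1 :: real
  delta2 :: real
  eps_ell :: real
  batch_size :: nat
  cmax :: real
  grid :: "nat set"
  init_pool :: "'g set"
  baseline :: "'g \<Rightarrow> nat"
  lower_bound :: real

text \<open>A Stage-1 realization is indexed by (task, workflow, panel position).\<close>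

definition est1 :: "'g config \<Rightarrow> (nat \<times> 'g \<times> nat \<Rightarrow> bool) \<Rightarrow> nat \<Rightarrow> 'g \<Rightarrow> real" where
  "est1 C z1 i g = (\<Sum>l=1..panel1 C. of_bool (z1 (i, g, l))) / real (panel1 C)"

definition eps_a :: "'g problem \<Rightarrow> 'g config \<Rightarrow> real" where
  "eps_a P C =
     sqrt (ln (2 * real (tasks P) * real (card (workflows P)) / delta1 C) / (2 * real (panel1 C)))"

definition eps_est :: "'g problem \<Rightarrow> 'g config \<Rightarrow> real" where
  "eps_est P C = min 1 (real (Kmax P) * eps_a P C)"

definition eps_rnd :: "'g problem \<Rightarrow> 'g config \<Rightarrow> real" where
  "eps_rnd P C = Max ((\<lambda>k. curvature P k / exp 1) ` grid C)"


subsection \<open>Plug-in epigraph dual\<close>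

type_synonym scenario = "nat \<times> nat \<Rightarrow> nat"

definition scenarios :: "'g problem \<Rightarrow> 'g config \<Rightarrow> nat \<Rightarrow> scenario set" where
  "scenarios P C k = (\<Pi>\<^sub>E _\<in>{1..tasks P} \<times> {1..k}. {1..panel1 C})"

definition scen_prob :: "'g problem \<Rightarrow> 'g config \<Rightarrow> nat \<Rightarrow> real" where
  "scen_prob P C k = 1 / real (panel1 C) ^ (tasks P * k)"

definition plug_correct ::
    "'g config \<Rightarrow> (nat \<times> 'g \<times> nat \<Rightarrow> bool) \<Rightarrow> nat \<Rightarrow> 'g \<Rightarrow> nat \<Rightarrow> scenario \<Rightarrow> real" where
  "plug_correct C z1 i g q \<omega> = of_bool (real (\<omega> (i, q)) \<le> real (panel1 C) * est1 C z1 i g)"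

definition score ::
    "'g problem \<Rightarrow> 'g config \<Rightarrow> (nat \<times> 'g \<times> nat \<Rightarrow> bool) \<Rightarrow> nat \<Rightarrow> nat \<Rightarrow>
     (nat \<Rightarrow> scenario \<Rightarrow> real) \<Rightarrow> 'g \<Rightarrow> real" where
  "score P C z1 k q \<mu> g =
     (\<Sum>\<omega>\<in>scenarios P C k. scen_prob P C k * (\<Sum>i=1..tasks P. \<mu> i \<omega> * plug_correct C z1 i g q \<omega>))
     - price P * cost P g"

datatype dvar = Mu nat scenario | Xi nat scenario | Th nat

type_synonym point = "dvar \<Rightarrow> real"

definition dvars :: "'g problem \<Rightarrow> 'g config \<Rightarrow> nat \<Rightarrow> dvar set" where
  "dvars P C k =
     {Mu i \<omega> | i \<omega>. i \<in> {1..tasks P} \<and> \<omega> \<in> scenarios P C k} \<union>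
     {Xi i \<omega> | i \<omega>. i \<in> {1..tasks P} \<and> \<omega> \<in> scenarios P C k} \<union>
     Th ` {1..k}"

text \<open>A pair \<open>(a, b)\<close> stands for the linear constraint \<open>(\<Sum>v. a v * z v) \<le> b\<close>.\<close>

definition violated :: "dvar set \<Rightarrow> point \<Rightarrow> point \<times> real \<Rightarrow> bool" where
  "violated I z = (\<lambda>(a, b). (\<Sum>v\<in>I. a v * z v) > b)"

definition unit :: "dvar \<Rightarrow> point" where
  "unit v = (\<lambda>w. of_bool (w = v))"

definition explicit_constraints ::
    "'g problem \<Rightarrow> 'g config \<Rightarrow> nat \<Rightarrow> (point \<times> real) set" where
  "explicit_constraints P C k =
     (\<Union>i\<in>{1..tasks P}. \<Union>\<omega>\<in>scenarios P C k.
        {(\<lambda>v. - unit (Xi i \<omega>) v - real r * unit (Mu i \<omega>) v, - curve P k r / real (tasks P)) | r. r \<le> k}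
        \<union> {(\<lambda>v. - unit (Mu i \<omega>) v, 0), (unit (Mu i \<omega>), increment P k 1 / real (tasks P)),
           (\<lambda>v. - unit (Xi i \<omega>) v, 0), (unit (Xi i \<omega>), 1 / real (tasks P))})
     \<union> (\<Union>q\<in>{1..k}. {(\<lambda>v. - unit (Th q) v, price P * cmax C), (unit (Th q), increment P k 1)})"

text \<open>Left-hand side of \<open>score \<mu> g - \<theta>\<^sub>q \<le> 0\<close>, up to the constant \<open>- price * cost g\<close>.\<close>

definition workflow_normal ::
    "'g problem \<Rightarrow> 'g config \<Rightarrow> (nat \<times> 'g \<times> nat \<Rightarrow> bool) \<Rightarrow> nat \<Rightarrow> nat \<Rightarrow> 'g \<Rightarrow> point" where
  "workflow_normal P C z1 k q g =
     (\<lambda>v. case v of Mu i \<omega> \<Rightarrow> scen_prob P C k * plug_correct C z1 i g q \<omega>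
                  | Xi i \<omega> \<Rightarrow> 0
                  | Th q' \<Rightarrow> - of_bool (q' = q))"

definition objective_normal :: "'g problem \<Rightarrow> 'g config \<Rightarrow> nat \<Rightarrow> point" where
  "objective_normal P C k =
     (\<lambda>v. case v of Mu i \<omega> \<Rightarrow> 0 | Xi i \<omega> \<Rightarrow> scen_prob P C k | Th q \<Rightarrow> 1)"


subsection \<open>Ellipsoid method\<close>

text \<open>\<open>(z, B)\<close> stands for the ellipsoid \<open>{y. (y - z)\<^sup>T B\<^sup>-\<^sup>1 (y - z) \<le> 1}\<close> in the coordinates \<open>I\<close>.
  A central cut replaces it by the smallest ellipsoid around its half \<open>{y. a\<^sup>T y \<le> a\<^sup>T z}\<close>.\<close>

type_synonym ellipsoid = "point \<times> (dvar \<Rightarrow> dvar \<Rightarrow> real)"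

definition central_cut :: "dvar set \<Rightarrow> point \<Rightarrow> ellipsoid \<Rightarrow> ellipsoid" where
  "central_cut I a = (\<lambda>(z, B).
     let N = real (card I);
         Ba = (\<lambda>v. \<Sum>w\<in>I. B v w * a w);
         s = (\<Sum>v\<in>I. a v * Ba v)
     in (\<lambda>v. z v - Ba v / ((N + 1) * sqrt s),
         \<lambda>v w. N\<^sup>2 / (N\<^sup>2 - 1) * (B v w - 2 / (N + 1) * (Ba v * Ba w) / s)))"

text \<open>The explicit constraints put the dual feasible set into the ball of radius \<open>outer_radius\<close>
  around the origin. It contains a ball of radius \<open>inner_radius\<close>, around
  \<open>\<mu> = d / (2 n)\<close>, \<open>\<xi> = 1 / n - d / (8 n)\<close>, \<open>\<theta> = 3 d / 4\<close> with \<open>d = d\<^bsub>1,k\<^esub>\<close> and \<open>n\<close> tasks,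
  and the objective varies on it by at most \<open>objective_range\<close>. In dimension \<open>N\<close> a cut shrinks the
  volume by a factor of at most \<open>exp (- 1 / (2 (N + 1)))\<close>, so after \<open>ell_iterations\<close> many cuts
  the ellipsoid is too small to contain all feasible points that are optimal up to \<open>tol\<close>.\<close>

definition outer_radius :: "'g problem \<Rightarrow> 'g config \<Rightarrow> nat \<Rightarrow> real" where
  "outer_radius P C k = sqrt (real (card (dvars P C k))) * max 1 (price P * cmax C)"

definition inner_radius :: "'g problem \<Rightarrow> nat \<Rightarrow> real" where
  "inner_radius P k = increment P k 1 / (8 * real (tasks P))"

definition objective_range :: "'g problem \<Rightarrow> 'g config \<Rightarrow> nat \<Rightarrow> real" where
  "objective_range P C k = 1 + real k * (1 + price P * cmax C)"

definition ell_iterations :: "'g problem \<Rightarrow> 'g config \<Rightarrow> nat \<Rightarrow> real \<Rightarrow> nat" where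
  "ell_iterations P C k tol =
     (let N = real (card (dvars P C k));
          r = min 1 (tol / objective_range P C k) * inner_radius P k
      in nat \<lceil>2 * N * (N + 1) * ln (outer_radius P C k / r)\<rceil> + 1)"

definition initial_ellipsoid :: "'g problem \<Rightarrow> 'g config \<Rightarrow> nat \<Rightarrow> ellipsoid" where
  "initial_ellipsoid P C k = (\<lambda>_. 0, \<lambda>v w. of_bool (v = w) * (outer_radius P C k)\<^sup>2)"


subsection \<open>Stage 1: dual-guided generation\<close>

text \<open>A query is a triple \<open>(k, q, \<mu>)\<close>; the log holds one entry per pricing batch, oldest first.\<close>

type_synonym query = "nat \<times> nat \<times> (nat \<Rightarrow> scenario \<Rightarrow> real)"

record 'g gen_state =
  pool :: "'g set"
  qlog :: "query list"

text \<open>Primitive pricing calls are numbered consecutively over the whole run, and \<open>y j\<close> is the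
  answer to call \<open>j\<close>; the calls of batch \<open>b\<close> have the numbers in \<open>{b * m..<b * m + m}\<close>.\<close>

definition batch_answers :: "'g config \<Rightarrow> (nat \<Rightarrow> 'g) \<Rightarrow> nat \<Rightarrow> 'g set" where
  "batch_answers C y b = y ` {b * batch_size C..<b * batch_size C + batch_size C}"

text \<open>If several columns \<open>q\<close> have a violated workflow constraint, the ellipsoid is cut with the first
  one. If no explicit constraint and no retained workflow constraint is violated, the iterate is
  accepted as weakly feasible and the ellipsoid is cut with the objective.\<close>

definition ell_step ::
    "'g problem \<Rightarrow> 'g config \<Rightarrow> (nat \<times> 'g \<times> nat \<Rightarrow> bool) \<Rightarrow> (nat \<Rightarrow> 'g) \<Rightarrow> nat \<Rightarrow>
     'g gen_state \<times> ellipsoid \<Rightarrow> 'g gen_state \<times> ellipsoid" where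
  "ell_step P C z1 y k = (\<lambda>(S, E).
     let I = dvars P C k;
         z = fst E;
         viol = {c \<in> explicit_constraints P C k. violated I z c}
     in if viol \<noteq> {} then (S, central_cut I (fst (SOME c. c \<in> viol)) E)
        else
          let \<mu> = (\<lambda>i \<omega>. z (Mu i \<omega>));
              b = length (qlog S);
              answers = (\<lambda>q. batch_answers C y (b + q - 1));
              best = (\<lambda>q. arg_max_on (score P C z1 k q \<mu>) (answers q));
              Q = {q \<in> {1..k}. score P C z1 k q \<mu> (best q) > z (Th q)};
              a = (if Q = {} then objective_normal P C k
                   else workflow_normal P C z1 k (Min Q) (best (Min Q)))
          in (S\<lparr>pool := pool S \<union> (\<Union>q\<in>{1..k}. answers q),
                qlog := qlog S @ map (\<lambda>q. (k, q, \<mu>)) [1..<Suc k]\<rparr>,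
              central_cut I a E))"

text \<open>Primal recovery works on the columns already in the pool. It changes neither the pool nor
  the output of the algorithm and is therefore left out.\<close>

definition ell_run ::
    "'g problem \<Rightarrow> 'g config \<Rightarrow> (nat \<times> 'g \<times> nat \<Rightarrow> bool) \<Rightarrow> (nat \<Rightarrow> 'g) \<Rightarrow> nat \<Rightarrow>
     'g gen_state \<Rightarrow> 'g gen_state" where
  "ell_run P C z1 y k S =
     fst ((ell_step P C z1 y k ^^ ell_iterations P C k (eps_ell C / 2)) (S, initial_ellipsoid P C k))"

definition generation ::
    "'g problem \<Rightarrow> 'g config \<Rightarrow> (nat \<times> 'g \<times> nat \<Rightarrow> bool) \<Rightarrow> (nat \<Rightarrow> 'g) \<Rightarrow> 'g gen_state" where
  "generation P C z1 y =
     fold (ell_run P C z1 y) (sorted_list_of_set (grid C)) \<lparr>pool = init_pool C, qlog = []\<rparr>"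

definition call_made ::
    "'g problem \<Rightarrow> 'g config \<Rightarrow> (nat \<times> 'g \<times> nat \<Rightarrow> bool) \<Rightarrow> (nat \<Rightarrow> 'g) \<Rightarrow> nat \<Rightarrow> bool" where
  "call_made P C z1 y j \<longleftrightarrow> j div batch_size C < length (qlog (generation P C z1 y))"

definition pricing_tol :: "'g config \<Rightarrow> nat \<Rightarrow> real" where
  "pricing_tol C k = eps_ell C / (2 * real k)"

definition call_good ::
    "'g problem \<Rightarrow> 'g config \<Rightarrow> (nat \<times> 'g \<times> nat \<Rightarrow> bool) \<Rightarrow> (nat \<Rightarrow> 'g) \<Rightarrow> nat \<Rightarrow> bool" where
  "call_good P C z1 y j =
     (case qlog (generation P C z1 y) ! (j div batch_size C) of (k, q, \<mu>) \<Rightarrow>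
        score P C z1 k q \<mu> (y j) \<ge> Max (score P C z1 k q \<mu> ` workflows P) - pricing_tol C k)"

text \<open>The history before call \<open>j\<close>: all queries up to the present one, and the answers to the earlier
  calls together with their quality. The quality has to be recorded because it depends on
  panels that may not have been revealed.\<close>

definition query_history ::
    "'g problem \<Rightarrow> 'g config \<Rightarrow> (nat \<times> 'g \<times> nat \<Rightarrow> bool) \<Rightarrow> (nat \<Rightarrow> 'g) \<Rightarrow> nat \<Rightarrow>
     query list \<times> ('g \<times> bool) list" where
  "query_history P C z1 y j =
     (take (Suc (j div batch_size C)) (qlog (generation P C z1 y)),
      map (\<lambda>j'. (y j', call_good P C z1 y j')) [0..<j])"


subsection \<open>Stage 2: final selection\<close>

definition candidates :: "'g problem \<Rightarrow> 'g config \<Rightarrow> 'g set \<Rightarrow> ('g \<Rightarrow> nat) set" where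
  "candidates P C S = {\<lambda>_. 0} \<union> {m \<in> counts_on S. size_of P m \<in> grid C}"

definition num_candidates :: "'g config \<Rightarrow> 'g set \<Rightarrow> nat" where
  "num_candidates C S = 1 + (\<Sum>k\<in>grid C. (card S + k - 1) choose k)"

definition eps_samp :: "'g problem \<Rightarrow> 'g config \<Rightarrow> 'g set \<Rightarrow> real" where
  "eps_samp P C S =
     sqrt (ln (2 * real (num_candidates C S) / delta2 C) / (2 * real (tasks P) * real (panel2 C)))"

text \<open>A Stage-2 realization is indexed by (sample, task, workflow, copy).\<close>

definition final_estimate ::
    "'g problem \<Rightarrow> 'g config \<Rightarrow> 'g set \<Rightarrow> (nat \<times> nat \<times> 'g \<times> nat \<Rightarrow> bool) \<Rightarrow> ('g \<Rightarrow> nat) \<Rightarrow> real" where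
  "final_estimate P C S z2 m =
     (if m = (\<lambda>_. 0) then 0 else
        (\<Sum>l=1..panel2 C.
           (\<Sum>i=1..tasks P.
              curve P (size_of P m) (\<Sum>g\<in>S. \<Sum>q=1..m g. of_bool (z2 (l, i, g, q))))
           / real (tasks P))
        / real (panel2 C)
        - price P * cost_of P m)"

definition final_choice ::
    "'g problem \<Rightarrow> 'g config \<Rightarrow> 'g set \<Rightarrow> (nat \<times> nat \<times> 'g \<times> nat \<Rightarrow> bool) \<Rightarrow> 'g \<Rightarrow> nat" where
  "final_choice P C S z2 =
     (let m = arg_max_on (final_estimate P C S z2) (candidates P C S)
      in if final_estimate P C S z2 m - eps_samp P C S \<ge> lower_bound C then m else baseline C)"

definition frozen_pool ::
    "'g problem \<Rightarrow> 'g config \<Rightarrow> (nat \<times> 'g \<times> nat \<Rightarrow> bool) \<Rightarrow> (nat \<Rightarrow> 'g) \<Rightarrow> 'g set" where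
  "frozen_pool P C z1 y = pool (generation P C z1 y)"

definition returned ::
    "'g problem \<Rightarrow> 'g config \<Rightarrow> (nat \<times> 'g \<times> nat \<Rightarrow> bool) \<Rightarrow> (nat \<Rightarrow> 'g) \<Rightarrow>
     (nat \<times> nat \<times> 'g \<times> nat \<Rightarrow> bool) \<Rightarrow> 'g \<Rightarrow> nat" where
  "returned P C z1 y z2 = final_choice P C (frozen_pool P C z1 y) z2"


subsection \<open>Index sets of the execution indicators\<close>

definition stage1_index :: "'g problem \<Rightarrow> 'g config \<Rightarrow> (nat \<times> 'g \<times> nat) set" where
  "stage1_index P C = {1..tasks P} \<times> workflows P \<times> {1..panel1 C}"

text \<open>Stage-2 indicators are indexed by all workflow types, not only by those in the frozen pool,
  which is random; \<open>final_estimate\<close> reads those of the frozen pool only.\<close>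

definition stage2_index :: "'g problem \<Rightarrow> 'g config \<Rightarrow> (nat \<times> nat \<times> 'g \<times> nat) set" where
  "stage2_index P C = {1..panel2 C} \<times> {1..tasks P} \<times> workflows P \<times> {1..Kmax P}"

end

theory Submission
  imports Defs "Jordan_Normal_Form.Char_Poly"
begin

text \<open>The guarantee for the frozen pool needs neither strong linear programming duality nor
  randomized rounding. Let \<open>k\<close> be a grid size that carries a portfolio with a plug-in value \<open>V\<close> of
  at least the optimum divided by the coverage ratio, up to the estimation error; it exists because
  \<open>h x / x\<close> is nonincreasing, so that dropping an average execution from \<open>k\<close> many keeps a fraction
  \<open>(k - 1) / k\<close> of the value.

  Every point that is feasible for the dual restricted to the pool has an objective of at least
  \<open>V - eps_ell\<close>. Otherwise a shrunken copy of the feasible set around it has an objective below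
  \<open>V - eps_ell / 2\<close>. This copy survives all cuts: feasibility cuts keep it, and the objective is cut
  only at weakly feasible iterates, whose objective is at least \<open>V - eps_ell / 2\<close> by weak duality.
  This bounds the determinant of the ellipsoid matrix from below, but every cut of \<open>N\<close> dimensions
  multiplies it by at most \<open>exp (- 1 / (N + 1))\<close>.

  This lower bound for the dual is then applied to multipliers that do not depend on the scenario,
  namely the expected marginal gains of a partial portfolio, discounted by powers of \<open>1 - 1 / k\<close>.
  It shows that a greedy choice from the pool makes enough progress, and telescoping gives a
  portfolio from the pool with value at least \<open>V - eps_ell - eps_rnd\<close>.

  Both sampling stages are controlled by Hoeffding's inequality, the second one separately for
  each value of the pool, and the pricing calls by conditioning on the query history.\<close>

section \<open>Sums of independent Bernoulli variables\<close>

text \<open>Write the recovery curve as \<open>last_inc * r + excess r\<close>. The expected linear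
  part is additive in the executions, like the cost, so both can be selected without loss; only the
  excess has diminishing gains. This is why the rounding loss is an additive curvature term. The
  excess never exceeds \<open>1 - k * last_inc\<close>, and the discounts
  \<open>(1 - 1 / k) ^ (k - j)\<close> make its contributions at consecutive greedy steps cancel.

  The obstacle in the ellipsoid analysis is that the ellipsoid is cut only by constraints of
  proposed workflows, and which these are is known only at the end. Near-optimality is therefore
  defined with respect to the final pool, and each intermediate state is compared with the final
  one: its pool and its query log can only be extended. Volume enters only through the determinant
  of the ellipsoid matrix, and membership only through support functions, so a cut reduces to an
  inequality in two variables.

  On the probabilistic side, the bound on the number of batches makes the generation phase a
  function of finitely many observations. Pools and query histories then take finitely many values,
  and conditioning becomes finite summation.\<close>

text \<open>The expectation of \<open>f\<close> at the number of successes of independent trials with success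
  probabilities \<open>ps\<close>.\<close>

fun pb :: "real list \<Rightarrow> (nat \<Rightarrow> real) \<Rightarrow> real" where
  "pb [] f = f 0"
| "pb (p # ps) f = p * pb ps (\<lambda>r. f (Suc r)) + (1 - p) * pb ps f"

lemma pb_add: "pb ps (\<lambda>r. f r + g r) = pb ps f + pb ps g"
proof (induction ps arbitrary: f g)
  case (Cons p ps)
  show ?case unfolding pb.simps Cons by (simp add: algebra_simps)
qed simp

lemma pb_cmult: "pb ps (\<lambda>r. c * f r) = c * pb ps f"
proof (induction ps arbitrary: f)
  case (Cons p ps)
  show ?case unfolding pb.simps Cons by (simp add: algebra_simps)
qed simp

lemma pb_diff: "pb ps (\<lambda>r. f r - g r) = pb ps f - pb ps g"
  using pb_add[of ps "\<lambda>r. f r - g r" g] by simp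

lemma pb_const: "pb ps (\<lambda>_. c) = c"
  by (induction ps) (simp_all add: algebra_simps)

lemma pb_of_nat: "pb ps real = sum_list ps"
proof (induction ps)
  case (Cons p ps)
  have "pb ps (\<lambda>r. 1 + real r) = 1 + sum_list ps"
    using Cons pb_add[of ps "\<lambda>_. 1" real] by (simp add: pb_const)
  then show ?case using Cons by (simp add: algebra_simps)
qed simp

text \<open>In this form the marginal gain is linear in \<open>p\<close>, which is what lets a dual
  multiplier price it.\<close>

lemma pb_Cons_increment: "pb (p # ps) f - pb ps f = p * pb ps (\<lambda>r. f (Suc r) - f r)"
  by (simp add: pb_diff algebra_simps)

lemma pb_mono:
  assumes "set ps \<subseteq> {0..1}" "\<And>r. r \<le> length ps \<Longrightarrow> f r \<le> g r"
  shows "pb ps f \<le> pb ps g"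
  using assms
proof (induction ps arbitrary: f g)
  case (Cons p ps)
  have "pb ps (\<lambda>r. f (Suc r)) \<le> pb ps (\<lambda>r. g (Suc r))" "pb ps f \<le> pb ps g"
    using Cons.prems by (auto intro!: Cons.IH)
  then show ?case using Cons.prems by (auto intro!: add_mono mult_left_mono)
qed simp

lemma pb_bounds:
  assumes "set ps \<subseteq> {0..1}" "\<And>r. r \<le> length ps \<Longrightarrow> f r \<in> {a..b}"
  shows "pb ps f \<in> {a..b}"
  using pb_mono[of ps "\<lambda>_. a" f] pb_mono[of ps f "\<lambda>_. b"] assms by (auto simp: pb_const)

lemma pb_move: "pb (us @ p # vs) f = pb (p # us @ vs) f"
proof (induction us arbitrary: f)
  case (Cons u us)
  show ?case unfolding append_Cons pb.simps Cons by (simp add: algebra_simps)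
qed simp

text \<open>An execution-count vector fixes its executions only up to order, so values computed
  along different enumerations have to be comparable.\<close>

lemma pb_mset:
  assumes "mset ps = mset qs"
  shows "pb ps f = pb qs f"
  using assms
proof (induction ps arbitrary: qs f)
  case (Cons p ps)
  then have "p \<in> set qs" using mset_eq_setD by fastforce
  then obtain us vs where qs: "qs = us @ p # vs" by (meson split_list)
  then have "mset ps = mset (us @ vs)" using Cons.prems by simp
  then have "pb ps f' = pb (us @ vs) f'" for f' by (rule Cons.IH)
  then show ?case by (simp add: qs pb_move del: pb.simps) simp
qed simp

section \<open>Deleting one trial\<close>

definition drop_nth :: "nat \<Rightarrow> 'a list \<Rightarrow> 'a list" where
  "drop_nth j xs = take j xs @ drop (Suc j) xs"

lemma drop_nth_0 [simp]: "drop_nth 0 (x # xs) = xs"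
  and drop_nth_Suc [simp]: "drop_nth (Suc j) (x # xs) = x # drop_nth j xs"
  by (simp_all add: drop_nth_def)

lemma map_drop_nth: "map f (drop_nth j xs) = drop_nth j (map f xs)"
  by (simp add: drop_nth_def take_map drop_map)

lemma length_drop_nth: "j < length xs \<Longrightarrow> length (drop_nth j xs) = length xs - 1"
  by (simp add: drop_nth_def)

lemma set_drop_nth: "set (drop_nth j xs) \<subseteq> set xs"
  by (auto simp: drop_nth_def dest: in_set_takeD in_set_dropD)

lemma sum_sum_list_drop_nth:
  fixes xs :: "real list"
  shows "(\<Sum>j<length xs. sum_list (drop_nth j xs)) = (real (length xs) - 1) * sum_list xs"
  by (induction xs) (simp_all add: sum.lessThan_Suc_shift sum.distrib algebra_simps del: sum.lessThan_Suc)

text \<open>If \<open>r\<close> of the trials succeed, then \<open>r\<close> of the deletions remove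
  a success and the remaining ones remove a failure. Summing the outcomes of all deletions turns
  this count into the weights on the right.\<close>

lemma sum_pb_drop_nth:
  "(\<Sum>j<length ps. pb (drop_nth j ps) f) =
    pb ps (\<lambda>r. real r * f (r - 1) + (real (length ps) - real r) * f r)"
proof (induction ps arbitrary: f)
  case (Cons p ps)
  let ?k = "real (length ps)"
  have distr: "x + p * (y - x) + (1 - p) * (z - x) = p * y + (1 - p) * z" for x y z
    by (simp add: algebra_simps)
  have "(\<Sum>j<length (p # ps). pb (drop_nth j (p # ps)) f) =
      pb ps f + p * (\<Sum>j<length ps. pb (drop_nth j ps) (\<lambda>r. f (Suc r)))
        + (1 - p) * (\<Sum>j<length ps. pb (drop_nth j ps) f)"
    by (simp add: sum.lessThan_Suc_shift sum.distrib sum_distrib_left del: sum.lessThan_Suc)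
  also have "\<dots> = pb ps f + p * pb ps (\<lambda>r. real r * f (Suc (r - 1)) + (?k - real r) * f (Suc r))
        + (1 - p) * pb ps (\<lambda>r. real r * f (r - 1) + (?k - real r) * f r)"
    by (simp add: Cons)
  \<comment> \<open>\<open>Suc (r - 1)\<close> differs from \<open>r\<close> only at
    \<open>r = 0\<close>, where its coefficient vanishes.\<close>
  also have "(\<lambda>r. real r * f (Suc (r - 1)) + (?k - real r) * f (Suc r)) =
      (\<lambda>r. (real (Suc r) * f r + (real (Suc (length ps)) - real (Suc r)) * f (Suc r)) - f r)"
    (is "?l = ?r")
  proof
    fix r show "real r * f (Suc (r - 1)) + (?k - real r) * f (Suc r) =
      (real (Suc r) * f r + (real (Suc (length ps)) - real (Suc r)) * f (Suc r)) - f r"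
      by (cases r) (simp_all add: algebra_simps)
  qed
  also have "(\<lambda>r. real r * f (r - 1) + (?k - real r) * f r) =
      (\<lambda>r. (real r * f (r - 1) + (real (Suc (length ps)) - real r) * f r) - f r)"
    by (simp add: fun_eq_iff algebra_simps)
  also have "pb ps f + p * pb ps (\<lambda>r. (real (Suc r) * f r + (real (Suc (length ps)) - real (Suc r)) * f (Suc r)) - f r)
      + (1 - p) * pb ps (\<lambda>r. (real r * f (r - 1) + (real (Suc (length ps)) - real r) * f r) - f r) =
      pb (p # ps) (\<lambda>r. real r * f (r - 1) + (real (length (p # ps)) - real r) * f r)"
    unfolding pb_diff pb.simps length_Cons diff_Suc_1 by (rule distr)
  finally show ?case .
qed simp

text \<open>Replacing one success probability changes the expectation by the difference of the
  probabilities times an average of \<open>f (Suc r) - f r\<close>, which is at most 1 in absolute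
  value. The probabilities are replaced one after the other.\<close>

lemma pb_lipschitz:
  assumes "set ps \<subseteq> {0..1}" "set qs \<subseteq> {0..1}" "length ps = length qs"
    and "\<And>r. r < length ps \<Longrightarrow> \<bar>f (Suc r) - f r\<bar> \<le> 1"
    and "\<And>j. j < length ps \<Longrightarrow> \<bar>ps ! j - qs ! j\<bar> \<le> e"
  shows "\<bar>pb ps f - pb qs f\<bar> \<le> real (length ps) * e"
  using assms(3,1,2,4,5)
proof (induction ps qs arbitrary: f rule: list_induct2)
  case (Cons p ps q qs)
  define D where "D = pb ps (\<lambda>r. f (Suc r)) - pb ps f"
  have e: "\<bar>p - q\<bar> \<le> e" using Cons.prems(4)[of 0] by simp
  have IH: "\<bar>pb ps f - pb qs f\<bar> \<le> real (length ps) * e"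
      "\<bar>pb ps (\<lambda>r. f (Suc r)) - pb qs (\<lambda>r. f (Suc r))\<bar> \<le> real (length ps) * e"
    using Cons.prems Cons.prems(4)[of "Suc j" for j] by (auto intro!: Cons.IH)
  have "pb ps (\<lambda>r. f (Suc r) - f r) \<in> {-1..1}"
  proof (rule pb_bounds)
    fix r assume "r \<le> length ps"
    then show "f (Suc r) - f r \<in> {-1..1}" using Cons.prems(3)[of r] by auto
  qed (use Cons.prems in auto)
  then have D: "\<bar>D\<bar> \<le> 1" by (auto simp: D_def pb_diff)
  have "pb (p # ps) f - pb (q # qs) f = (p - q) * D
      + (q * (pb ps (\<lambda>r. f (Suc r)) - pb qs (\<lambda>r. f (Suc r))) + (1 - q) * (pb ps f - pb qs f))"
    by (simp add: D_def algebra_simps)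
  also have "\<bar>\<dots>\<bar> \<le> \<bar>p - q\<bar> * \<bar>D\<bar> + (q * \<bar>pb ps (\<lambda>r. f (Suc r)) - pb qs (\<lambda>r. f (Suc r))\<bar>
      + (1 - q) * \<bar>pb ps f - pb qs f\<bar>)"
    using Cons.prems(2) by (intro order.trans[OF abs_triangle_ineq] add_mono) (auto simp: abs_mult)
  also have "\<dots> \<le> e * 1 + (q * (real (length ps) * e) + (1 - q) * (real (length ps) * e))"
    using Cons.prems(2) e D IH by (intro add_mono mult_mono mult_left_mono) auto
  finally show ?case by (simp add: algebra_simps)
qed simp

text \<open>The recursion of \<open>pb\<close> is conditioning on the first indicator, which is
  independent of the sum of the others.\<close>

lemma (in prob_space) expectation_pb:
  fixes Z :: "'b \<Rightarrow> 'a \<Rightarrow> bool"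
  assumes "indep_vars (\<lambda>_. count_space UNIV) Z (set xs)" "distinct xs"
    and "\<And>x. x \<in> set xs \<Longrightarrow> expectation (\<lambda>w. of_bool (Z x w)) = a x"
  shows "expectation (\<lambda>w. f (\<Sum>x\<in>set xs. of_bool (Z x w))) = pb (map a xs) f"
  using assms
proof (induction xs arbitrary: f)
  case Nil
  then show ?case by (simp add: prob_space)
next
  case (Cons x xs)
  let ?B = "\<lambda>w. of_bool (Z x w) :: real"
  let ?T = "\<lambda>w. \<Sum>y\<in>set xs. of_bool (Z y w) :: nat"
  have Z: "indep_vars (\<lambda>_. borel) (\<lambda>y w. of_bool (Z y w) :: real) (insert x (set xs))"
    using indep_vars_compose2[OF Cons.prems(1), where Y = "\<lambda>_. of_bool" and N = "\<lambda>_. borel :: real measure"]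
    by simp
  have ind: "indep_var borel ?B borel (\<lambda>w. \<Sum>y\<in>set xs. of_bool (Z y w) :: real)"
    by (rule indep_vars_sum) (use Cons.prems Z in auto)
  \<comment> \<open>Independence holds for the real-valued sum; a function of the natural number
    count is recovered from it by rounding down. The affine form \<open>c + d * b\<close> covers the
    indicator and its complement at once.\<close>
  have ind': "indep_var borel ((\<lambda>b. c + d * b) \<circ> ?B) borel
      ((\<lambda>t. g (nat \<lfloor>t\<rfloor>)) \<circ> (\<lambda>w. \<Sum>y\<in>set xs. of_bool (Z y w) :: real))" for c d :: real and g :: "nat \<Rightarrow> real"
    by (rule indep_var_compose[OF ind]) measurable
  have T: "(\<Sum>y\<in>set xs. of_bool (Z y w) :: real) = real (?T w)" for w
    by simp
  have meas: "(\<lambda>w. of_bool (Z y w) :: real) \<in> borel_measurable M" if "y \<in> insert x (set xs)" for y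
    using Z that by (auto simp: indep_vars_def)
  have bdd: "?T w \<le> length xs" for w
  proof -
    have "?T w \<le> (\<Sum>y\<in>set xs. 1)" by (rule sum_mono) simp
    then show ?thesis using card_length[of xs] by simp
  qed
  have intB: "integrable M (\<lambda>w. c + d * ?B w)" for c d
    using meas[of x] by (intro integrable_const_bound[where B = "\<bar>c\<bar> + \<bar>d\<bar>"]) auto
  have intT: "integrable M (\<lambda>w. g (?T w))" for g :: "nat \<Rightarrow> real"
  proof (rule integrable_const_bound[where B = "\<Sum>r\<le>length xs. \<bar>g r\<bar>"])
    show "AE w in M. norm (g (?T w)) \<le> (\<Sum>r\<le>length xs. \<bar>g r\<bar>)"
      using bdd by (intro AE_I2) (auto intro!: member_le_sum[where f = "\<lambda>r. \<bar>g r\<bar>"])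
    have "(\<lambda>w. g (nat \<lfloor>\<Sum>y\<in>set xs. of_bool (Z y w) :: real\<rfloor>)) \<in> borel_measurable M"
      using meas by measurable
    then show "(\<lambda>w. g (?T w)) \<in> borel_measurable M"
      by (simp only: T floor_of_nat nat_int)
  qed
  have prod: "expectation (\<lambda>w. (c + d * ?B w) * g (?T w)) =
      expectation (\<lambda>w. c + d * ?B w) * expectation (\<lambda>w. g (?T w))"
    and int: "integrable M (\<lambda>w. (c + d * ?B w) * g (?T w))" for c d and g :: "nat \<Rightarrow> real"
    using indep_var_lebesgue_integral[OF ind'[of c d g]] indep_var_integrable[OF ind'[of c d g]]
      intB[of c d] intT[of g]
    by (simp_all only: o_def T floor_of_nat nat_int)
  have EB: "expectation ?B = a x" using Cons.prems(3) by simp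
  have IH: "expectation (\<lambda>w. g (?T w)) = pb (map a xs) g" for g
    by (rule Cons.IH) (use Cons.prems indep_vars_subset[OF Cons.prems(1)] in auto)
  have "f (\<Sum>y\<in>set (x # xs). of_bool (Z y w)) =
      (0 + 1 * ?B w) * f (Suc (?T w)) + (1 + (-1) * ?B w) * f (?T w)" for w
    using Cons.prems(2) by (cases "Z x w") auto
  then have "expectation (\<lambda>w. f (\<Sum>y\<in>set (x # xs). of_bool (Z y w))) =
      expectation (\<lambda>w. (0 + 1 * ?B w) * f (Suc (?T w))) + expectation (\<lambda>w. (1 + (-1) * ?B w) * f (?T w))"
    using int[of 0 1 "\<lambda>r. f (Suc r)"] int[of 1 "-1" f] by (simp add: Bochner_Integration.integral_add)
  also have "\<dots> = expectation (\<lambda>w. 0 + 1 * ?B w) * expectation (\<lambda>w. f (Suc (?T w)))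
      + expectation (\<lambda>w. 1 + (-1) * ?B w) * expectation (\<lambda>w. f (?T w))"
    by (simp only: prod[of 0 1 "\<lambda>r. f (Suc r)"] prod[of 1 "-1" f])
  also have "expectation (\<lambda>w. 1 + (-1) * ?B w) = 1 - a x"
    using intB[of 0 1] EB by (simp add: prob_space)
  finally show ?case
    using EB by (simp only: IH[of f] IH[of "\<lambda>r. f (Suc r)"] mult_1 add_0 list.map pb.simps)
qed

section \<open>Concave recovery curves and distorted greedy selection\<close>

definition avg :: "nat \<Rightarrow> (nat \<Rightarrow> 'g \<Rightarrow> real) \<Rightarrow> 'g list \<Rightarrow> (nat \<Rightarrow> real) \<Rightarrow> real" where
  "avg n \<alpha> gs f = (\<Sum>i=1..n. pb (map (\<alpha> i) gs) f) / real n"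

locale recovery_curve =
  fixes \<psi> :: "nat \<Rightarrow> real" and k :: nat
  assumes k_pos: "k \<ge> 1" and zero: "\<psi> 0 = 0" and one: "\<psi> k = 1"
    and mono: "\<And>r. r < k \<Longrightarrow> \<psi> r \<le> \<psi> (Suc r)"
    and concave: "\<And>r. Suc r < k \<Longrightarrow> \<psi> (Suc (Suc r)) - \<psi> (Suc r) \<le> \<psi> (Suc r) - \<psi> r"
begin

definition inc :: "nat \<Rightarrow> real" where
  "inc r = \<psi> (Suc r) - \<psi> r"

lemma inc_nonneg: "r < k \<Longrightarrow> 0 \<le> inc r"
  using mono by (simp add: inc_def)

lemma inc_antimono:
  assumes "r \<le> s" "s < k"
  shows "inc s \<le> inc r"
  using assms
proof (induction s rule: dec_induct)
  case (step s)
  then show ?case using concave[of s] by (simp add: inc_def)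
qed simp

lemma psi_mono: "r \<le> s \<Longrightarrow> s \<le> k \<Longrightarrow> \<psi> r \<le> \<psi> s"
proof (induction s rule: dec_induct)
  case (step s)
  then show ?case using mono[of s] by simp
qed simp

lemma psi_range: "r \<le> k \<Longrightarrow> \<psi> r \<in> {0..1}"
  using psi_mono[of 0 r] psi_mono[of r k] by (simp add: zero one)

lemma psi_diff: "r \<le> s \<Longrightarrow> \<psi> s - \<psi> r = (\<Sum>t\<in>{r..<s}. inc t)"
  by (simp add: inc_def sum_Suc_diff')

text \<open>The increments to the right of \<open>R\<close> are at most \<open>inc R\<close>, those
  to the left at least \<open>inc R\<close>, so the line through \<open>R\<close> with slope
  \<open>inc R\<close> lies above the curve on both sides.\<close>

lemma tangent:
  assumes "r \<le> k" "R < k"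
  shows "\<psi> r \<le> \<psi> R + (real r - real R) * inc R"
proof (cases "R \<le> r")
  case True
  have "(\<Sum>t\<in>{R..<r}. inc t) \<le> (\<Sum>t\<in>{R..<r}. inc R)"
    using assms by (intro sum_mono inc_antimono) auto
  then show ?thesis using psi_diff[OF True] True by (simp add: of_nat_diff)
next
  case False
  have "(\<Sum>t\<in>{r..<R}. inc R) \<le> (\<Sum>t\<in>{r..<R}. inc t)"
    using assms by (intro sum_mono inc_antimono) auto
  then show ?thesis using psi_diff[of r R] False by (simp add: of_nat_diff algebra_simps)
qed

abbreviation "last_inc \<equiv> inc (k - 1)"

lemma last_inc: "0 \<le> last_inc" "r < k \<Longrightarrow> last_inc \<le> inc r"
  using k_pos by (auto intro: inc_nonneg inc_antimono)

lemma first_inc_ge: "1 \<le> real k * inc 0"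
  using tangent[of k 0] k_pos by (simp add: zero one)

lemma first_inc_le: "inc 0 \<le> 1"
  using psi_range[of 1] k_pos by (simp add: inc_def zero)

text \<open>\<open>1 - k * last_inc\<close> is what remains of \<open>\<psi> k\<close> after the
  minimal slope is removed. It is at most the curvature because \<open>inc 0\<close> is at least
  \<open>1 / k\<close>.\<close>

lemma curvature_ge: "0 \<le> 1 - real k * last_inc" "1 - real k * last_inc \<le> 1 - last_inc / inc 0"
proof -
  have "1 = (\<Sum>t\<in>{0..<k}. inc t)" using psi_diff[of 0 k] by (simp add: zero one)
  also have "\<dots> \<ge> (\<Sum>t\<in>{0..<k}. last_inc)" by (intro sum_mono last_inc) auto
  finally show "0 \<le> 1 - real k * last_inc" by simp
  have pos: "0 < inc 0" using first_inc_ge k_pos by (metis less_numeral_extra(1) mult_not_zero not_less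
        order.strict_iff_order order.trans zero_le_one inc_nonneg less_le_trans)
  have "last_inc * 1 \<le> last_inc * (real k * inc 0)"
    using first_inc_ge last_inc(1) by (rule mult_left_mono)
  then show "1 - real k * last_inc \<le> 1 - last_inc / inc 0"
    using pos by (simp add: field_simps)
qed

text \<open>The part of the curve above its minimal slope. It is still concave and nondecreasing up
  to \<open>k\<close>, while the removed linear part has an expectation that is additive in the
  executions.\<close>

definition excess :: "nat \<Rightarrow> real" where
  "excess r = \<psi> r - last_inc * real r"

lemma excess_inc: "excess (Suc r) - excess r = inc r - last_inc"
  by (simp add: excess_def inc_def algebra_simps)

lemma excess_le: "r \<le> k \<Longrightarrow> excess r \<le> 1 - real k * last_inc"
proof (induction "k - r" arbitrary: r)
  case 0
  then have "r = k" by simp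
  show ?case unfolding \<open>r = k\<close> excess_def one by simp
next
  case (Suc d)
  have "excess (Suc r) \<le> 1 - real k * last_inc" using Suc.hyps(2) by (intro Suc.hyps(1)) auto
  moreover have "excess r \<le> excess (Suc r)"
    using excess_inc[of r] last_inc(2)[of r] Suc.hyps(2) by linarith
  ultimately show ?case by simp
qed

section \<open>Greedy selection from a lower bound on the dual\<close>

context
  fixes n :: nat and S :: "'g set" and \<alpha> :: "nat \<Rightarrow> 'g \<Rightarrow> real" and c :: "'g \<Rightarrow> real" and V :: real
  assumes n: "n \<ge> 1" and S: "finite S" "S \<noteq> {}"
    and \<alpha>: "\<And>i g. i \<in> {1..n} \<Longrightarrow> g \<in> S \<Longrightarrow> \<alpha> i g \<in> {0..1}"
    \<comment> \<open>The right-hand side is the dual objective at multipliers common to all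
      scenarios, with the remaining variables eliminated: each \<open>\<xi>\<close> and
      \<open>\<theta>\<close> takes the smallest value that its constraints allow.\<close>
    and dual: "\<And>\<mu>. (\<And>i. i \<in> {1..n} \<Longrightarrow> \<mu> i \<in> {0..inc 0 / real n}) \<Longrightarrow>
      V \<le> (\<Sum>i=1..n. Max ((\<lambda>r. \<psi> r / real n - real r * \<mu> i) ` {..k}))
        + real k * Max ((\<lambda>g. (\<Sum>i=1..n. \<mu> i * \<alpha> i g) - c g) ` S)"
begin

text \<open>The dual multipliers are the expected marginal gains at the current selection, with the part
  of the curve above its minimal slope discounted by \<open>\<beta>\<close>. They do not depend on the scenario, so
  every column prices a fresh copy.\<close>

lemma greedy_step:
  assumes gs: "set gs \<subseteq> S" "length gs < k" and beta: "0 \<le> \<beta>" "\<beta> \<le> 1"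
  shows "\<exists>g\<in>S. V \<le> (1 - \<beta>) * (1 - real k * last_inc) + \<beta> * avg n \<alpha> gs excess
    + real k * (last_inc * ((\<Sum>i=1..n. \<alpha> i g) / real n)
        + \<beta> * (avg n \<alpha> (g # gs) excess - avg n \<alpha> gs excess) - c g)"
proof -
  define e where "e i = pb (map (\<alpha> i) gs) (\<lambda>r. inc r - last_inc)" for i
  define \<mu> where "\<mu> i = (last_inc + \<beta> * e i) / real n" for i
  let ?D = "1 - real k * last_inc"
  have probs: "set (map (\<alpha> i) gs) \<subseteq> {0..1}" if "i \<in> {1..n}" for i
    using \<alpha> that gs by auto
  have e: "0 \<le> e i" "e i \<le> inc 0 - last_inc" if "i \<in> {1..n}" for i
  proof -
    have "e i \<in> {0..inc 0 - last_inc}"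
      unfolding e_def using last_inc(2) gs(2)
      by (intro pb_bounds probs that) (auto intro!: inc_antimono)
    then show "0 \<le> e i" "e i \<le> inc 0 - last_inc" by auto
  qed
  have \<mu>: "\<mu> i \<in> {0..inc 0 / real n}" if "i \<in> {1..n}" for i
  proof -
    have "\<beta> * e i \<le> 1 * e i" using e[OF that] beta by (intro mult_right_mono) auto
    then have "0 \<le> last_inc + \<beta> * e i" "last_inc + \<beta> * e i \<le> inc 0"
      using e[OF that] beta last_inc(1) by auto
    then show ?thesis by (simp add: \<mu>_def divide_right_mono)
  qed
  \<comment> \<open>Two upper bounds on \<open>excess r\<close> are combined with weights
    \<open>1 - \<beta>\<close> and \<open>\<beta>\<close>: the constant one, and the tangent at the
    random number of successes of the current selection.\<close>
  have xi: "\<psi> r / real n - real r * \<mu> i \<le> ((1 - \<beta>) * ?D + \<beta> * pb (map (\<alpha> i) gs) excess) / real n"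
    if i: "i \<in> {1..n}" and r: "r \<le> k" for i r
  proof -
    have "excess r - real r * e i = pb (map (\<alpha> i) gs) (\<lambda>R. excess r - real r * (inc R - last_inc))"
      by (simp add: e_def pb_diff pb_cmult pb_const)
    \<comment> \<open>The tangent inequality at \<open>R\<close>, averaged over \<open>R\<close>;
      the nonnegative term \<open>R * (inc R - last_inc)\<close> is dropped.\<close>
    also have "\<dots> \<le> pb (map (\<alpha> i) gs) excess"
    proof (rule pb_mono)
      fix R assume "R \<le> length (map (\<alpha> i) gs)"
      then have R: "R < k" using gs by simp
      have "0 \<le> real R * (inc R - last_inc)" using last_inc(2)[OF R] by simp
      then show "excess r - real r * (inc R - last_inc) \<le> excess R"
        using tangent[OF r R] by (simp add: excess_def algebra_simps)
    qed (rule probs[OF i])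
    finally have "\<beta> * (excess r - real r * e i) \<le> \<beta> * pb (map (\<alpha> i) gs) excess"
      using beta by (intro mult_left_mono)
    moreover have "(1 - \<beta>) * excess r \<le> (1 - \<beta>) * ?D"
      using beta excess_le[OF r] by (intro mult_left_mono) auto
    ultimately have "\<psi> r - real r * (last_inc + \<beta> * e i) \<le> (1 - \<beta>) * ?D + \<beta> * pb (map (\<alpha> i) gs) excess"
      by (simp add: excess_def algebra_simps)
    then have "(\<psi> r - real r * (last_inc + \<beta> * e i)) / real n
        \<le> ((1 - \<beta>) * ?D + \<beta> * pb (map (\<alpha> i) gs) excess) / real n"
      by (rule divide_right_mono) simp
    then show ?thesis by (simp add: \<mu>_def diff_divide_distrib)
  qed
  have "(\<Sum>i=1..n. Max ((\<lambda>r. \<psi> r / real n - real r * \<mu> i) ` {..k}))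
      \<le> (\<Sum>i=1..n. ((1 - \<beta>) * ?D + \<beta> * pb (map (\<alpha> i) gs) excess) / real n)"
    using xi by (intro sum_mono) (auto simp: Max_le_iff)
  also have "\<dots> = (1 - \<beta>) * ?D + \<beta> * avg n \<alpha> gs excess"
    using n by (simp add: avg_def sum.distrib sum_distrib_left sum_divide_distrib add_divide_distrib)
  finally have xis: "(\<Sum>i=1..n. Max ((\<lambda>r. \<psi> r / real n - real r * \<mu> i) ` {..k}))
      \<le> (1 - \<beta>) * ?D + \<beta> * avg n \<alpha> gs excess" .
  have "Max ((\<lambda>g. (\<Sum>i=1..n. \<mu> i * \<alpha> i g) - c g) ` S) \<in> (\<lambda>g. (\<Sum>i=1..n. \<mu> i * \<alpha> i g) - c g) ` S"
    using S by (intro Max_in) auto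
  then obtain g where g: "g \<in> S"
    and gmax: "Max ((\<lambda>g. (\<Sum>i=1..n. \<mu> i * \<alpha> i g) - c g) ` S) = (\<Sum>i=1..n. \<mu> i * \<alpha> i g) - c g"
    by auto
  \<comment> \<open>The multipliers are built from \<open>e\<close>, so that the price of
    \<open>g\<close> is exactly its gain in the linear part plus \<open>\<beta>\<close> times its
    gain in the excess.\<close>
  have "avg n \<alpha> (g # gs) excess - avg n \<alpha> gs excess = (\<Sum>i=1..n. \<alpha> i g * e i) / real n"
    unfolding avg_def diff_divide_distrib[symmetric] sum_subtractf[symmetric] list.map
      pb_Cons_increment excess_inc e_def ..
  then have "(\<Sum>i=1..n. \<mu> i * \<alpha> i g) = last_inc * ((\<Sum>i=1..n. \<alpha> i g) / real n)
      + \<beta> * (avg n \<alpha> (g # gs) excess - avg n \<alpha> gs excess)"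
    by (simp add: \<mu>_def sum_divide_distrib sum_distrib_left sum.distrib[symmetric] field_simps)
  then have "V \<le> (1 - \<beta>) * ?D + \<beta> * avg n \<alpha> gs excess
      + real k * (last_inc * ((\<Sum>i=1..n. \<alpha> i g) / real n) + \<beta> * (avg n \<alpha> (g # gs) excess - avg n \<alpha> gs excess) - c g)"
    using dual[of \<mu>, OF \<mu>] xis unfolding gmax by simp
  with g show ?thesis by blast
qed

text \<open>The potential after \<open>j\<close> choices is the linear part minus the cost plus
  \<open>\<Lambda> j\<close> times the excess. The discount rises from
  \<open>(1 - 1 / k) ^ k\<close> to 1, so the final potential is the true value. The potential gains
  at least \<open>V / k\<close> per step, up to a loss whose sum is the last term.\<close>

lemma greedy_selection:
  "\<exists>gs. set gs \<subseteq> S \<and> length gs = k \<and>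
    V \<le> avg n \<alpha> gs \<psi> - sum_list (map c gs) + (1 - 1 / real k) ^ k * (1 - real k * last_inc)"
proof -
  define D where "D = 1 - real k * last_inc"
  define x where "x = 1 - 1 / real k"
  define \<Lambda> where "\<Lambda> j = x ^ (k - j)" for j
  define A where "A gs = (\<Sum>i=1..n. sum_list (map (\<alpha> i) gs)) / real n" for gs
  have x: "0 \<le> x" "x \<le> 1" using k_pos by (auto simp: x_def)
  have "j \<le> k \<Longrightarrow> \<exists>gs. set gs \<subseteq> S \<and> length gs = j \<and>
      real j * V \<le> (\<Sum>t<j. 1 - \<Lambda> (Suc t)) * D
        + real k * (last_inc * A gs + \<Lambda> j * avg n \<alpha> gs excess - sum_list (map c gs))" for j
  proof (induction j)
    case 0
    show ?case by (intro exI[of _ "[]"]) (simp add: A_def avg_def excess_def zero)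
  next
    case (Suc j)
    then obtain gs where gs: "set gs \<subseteq> S" "length gs = j"
      and IH: "real j * V \<le> (\<Sum>t<j. 1 - \<Lambda> (Suc t)) * D
        + real k * (last_inc * A gs + \<Lambda> j * avg n \<alpha> gs excess - sum_list (map c gs))"
      by auto
    let ?l = "\<Lambda> (Suc j)"
    have "0 \<le> ?l" "?l \<le> 1" using x by (auto simp: \<Lambda>_def power_le_one)
    then obtain g where g: "g \<in> S" and step: "V \<le> (1 - ?l) * D + ?l * avg n \<alpha> gs excess
      + real k * (last_inc * ((\<Sum>i=1..n. \<alpha> i g) / real n)
        + ?l * (avg n \<alpha> (g # gs) excess - avg n \<alpha> gs excess) - c g)"
      using greedy_step[of gs ?l] gs Suc.prems by (auto simp: D_def)
    have "k - j = Suc (k - Suc j)" using Suc.prems by simp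
    then have "\<Lambda> j = x * ?l" by (simp add: \<Lambda>_def)
    \<comment> \<open>Raising the discount from \<open>\<Lambda> j\<close> to \<open>?l\<close> adds
      \<open>?l * avg n \<alpha> gs excess\<close> to \<open>k\<close> times the potential. This is
      exactly the excess term on the right of \<open>step\<close>, so the two cancel.\<close>
    then have L: "real k * \<Lambda> j = real k * ?l - ?l" using k_pos by (simp add: x_def field_simps)
    have "A (g # gs) = (\<Sum>i=1..n. \<alpha> i g) / real n + A gs"
      by (simp add: A_def sum.distrib add_divide_distrib)
    then have "(1 - ?l) * D + ?l * avg n \<alpha> gs excess
      + real k * (last_inc * ((\<Sum>i=1..n. \<alpha> i g) / real n)
        + ?l * (avg n \<alpha> (g # gs) excess - avg n \<alpha> gs excess) - c g)
      + ((\<Sum>t<j. 1 - \<Lambda> (Suc t)) * D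
        + real k * (last_inc * A gs + \<Lambda> j * avg n \<alpha> gs excess - sum_list (map c gs)))
      = (\<Sum>t<Suc j. 1 - \<Lambda> (Suc t)) * D
        + real k * (last_inc * A (g # gs) + ?l * avg n \<alpha> (g # gs) excess - sum_list (map c (g # gs)))
        + (real k * \<Lambda> j - (real k * ?l - ?l)) * avg n \<alpha> gs excess"
      by (simp add: algebra_simps)
    then have "V + real j * V \<le> (\<Sum>t<Suc j. 1 - \<Lambda> (Suc t)) * D
        + real k * (last_inc * A (g # gs) + ?l * avg n \<alpha> (g # gs) excess - sum_list (map c (g # gs)))"
      using step IH L by simp
    then show ?case using gs g
      by (intro exI[of _ "g # gs"]) (simp add: algebra_simps)
  qed
  from this[of k] obtain gs where gs: "set gs \<subseteq> S" "length gs = k"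
    and V: "real k * V \<le> (\<Sum>t<k. 1 - \<Lambda> (Suc t)) * D
        + real k * (last_inc * A gs + \<Lambda> k * avg n \<alpha> gs excess - sum_list (map c gs))" by auto
  \<comment> \<open>By the geometric sum the losses \<open>1 - \<Lambda> (Suc t)\<close> average to
    \<open>x ^ k\<close>.\<close>
  have "(\<Sum>t<k. \<Lambda> (Suc t)) = (\<Sum>s<k. x ^ s)"
    unfolding \<Lambda>_def by (rule sum.nat_diff_reindex[where g = "\<lambda>s. x ^ s"])
  also have "\<dots> = - ((x ^ k - 1) * real k)"
    using k_pos geometric_sum[of x k] by (simp add: x_def)
  finally have sum: "(\<Sum>t<k. 1 - \<Lambda> (Suc t)) = real k * x ^ k"
    by (simp add: sum_subtractf algebra_simps)
  have "avg n \<alpha> gs \<psi> = avg n \<alpha> gs (\<lambda>r. excess r + last_inc * real r)"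
    by (simp add: excess_def)
  also have "\<dots> = avg n \<alpha> gs excess + last_inc * A gs"
    by (simp add: avg_def A_def pb_add pb_cmult pb_of_nat sum.distrib add_divide_distrib sum_distrib_left)
  finally have avg: "last_inc * A gs + \<Lambda> k * avg n \<alpha> gs excess = avg n \<alpha> gs \<psi>"
    by (simp add: \<Lambda>_def)
  have "real k * V \<le> real k * (avg n \<alpha> gs \<psi> - sum_list (map c gs) + x ^ k * D)"
    using V unfolding sum avg by (simp add: algebra_simps)
  then have "V \<le> avg n \<alpha> gs \<psi> - sum_list (map c gs) + x ^ k * D"
    using k_pos by (simp add: mult_le_cancel_left_pos)
  then show ?thesis using gs by (auto simp: x_def D_def)
qed

end

text \<open>This is the origin of \<open>eps_rnd\<close>: \<open>(1 - 1 / k) ^ k\<close> is at most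
  \<open>1 / e\<close>, and the total excess is at most the curvature.\<close>

lemma distortion_le: "(1 - 1 / real k) ^ k * (1 - real k * last_inc) \<le> (1 - last_inc / inc 0) / exp 1"
proof -
  have "1 + (- 1 / real k) \<le> exp (- 1 / real k)" by (rule exp_ge_add_one_self)
  then have "(1 - 1 / real k) ^ k \<le> exp (- 1 / real k) ^ k"
    using k_pos by (intro power_mono) auto
  also have "\<dots> = exp (- 1)" using k_pos by (simp flip: exp_of_nat_mult)
  finally have "(1 - 1 / real k) ^ k * (1 - real k * last_inc) \<le> exp (- 1) * (1 - last_inc / inc 0)"
    using curvature_ge by (intro mult_mono) auto
  then show ?thesis by (simp add: exp_minus field_simps)
qed

end

section \<open>Determinants of quadratic forms\<close>

text \<open>The matrix determinant lemma. The bordered matrix with blocks \<open>1\<close>,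
  \<open>u\<close>, \<open>- v\<close> and \<open>1\<close> is triangularized in two ways:
  eliminating the last row and column leaves the rank one update, eliminating the large block leaves
  the scalar.\<close>

lemma det_one_plus_outer:
  fixes u v :: "nat \<Rightarrow> real"
  shows "det (mat n n (\<lambda>(i, j). of_bool (i = j) + u i * v j)) = 1 + (\<Sum>i<n. v i * u i)"
proof -
  let ?U = "mat n 1 (\<lambda>(i, j). u i)"
  let ?V = "mat 1 n (\<lambda>(i, j). v j)"
  let ?V' = "mat 1 n (\<lambda>(i, j). - v j)"
  let ?M = "mat n n (\<lambda>(i, j). of_bool (i = j) + u i * v j)"
  let ?Y = "four_block_mat (1\<^sub>m n) ?U ?V' (1\<^sub>m 1)"
  have "four_block_mat ?M ?U (0\<^sub>m 1 n) (1\<^sub>m 1) * four_block_mat (1\<^sub>m n) (0\<^sub>m n 1) ?V' (1\<^sub>m 1) =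
      four_block_mat (?M * 1\<^sub>m n + ?U * ?V') (?M * 0\<^sub>m n 1 + ?U * 1\<^sub>m 1)
        (0\<^sub>m 1 n * 1\<^sub>m n + 1\<^sub>m 1 * ?V') (0\<^sub>m 1 n * 0\<^sub>m n 1 + 1\<^sub>m 1 * 1\<^sub>m 1)"
    by (rule mult_four_block_mat[where ?nr1.0 = n and ?n1.0 = n and ?n2.0 = 1 and ?nr2.0 = 1
          and ?nc1.0 = n and ?nc2.0 = 1]) auto
  also have "\<dots> = ?Y"
    by (intro arg_cong4[where f = four_block_mat] eq_matI) (auto simp: scalar_prod_def)
  finally have Y: "?Y = four_block_mat ?M ?U (0\<^sub>m 1 n) (1\<^sub>m 1) *
      four_block_mat (1\<^sub>m n) (0\<^sub>m n 1) ?V' (1\<^sub>m 1)" by simp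
  have "det ?Y = det (four_block_mat ?M ?U (0\<^sub>m 1 n) (1\<^sub>m 1)) *
      det (four_block_mat (1\<^sub>m n) (0\<^sub>m n 1) ?V' (1\<^sub>m 1))"
    unfolding Y by (rule det_mult[of _ "n + 1"]) (auto intro!: four_block_carrier_mat)
  also have "\<dots> = det ?M"
    by (subst det_four_block_mat_lower_left_zero[of _ n _ 1], simp, simp, simp, simp,
        subst det_four_block_mat_upper_right_zero[of _ n _ 1]) simp_all
  finally have detY: "det ?Y = det ?M" .
  let ?D = "mat 1 1 (\<lambda>_. 1 + (\<Sum>i<n. v i * u i))"
  have "four_block_mat (1\<^sub>m n) (0\<^sub>m n 1) ?V (1\<^sub>m 1) * ?Y =
      four_block_mat (1\<^sub>m n * 1\<^sub>m n + 0\<^sub>m n 1 * ?V') (1\<^sub>m n * ?U + 0\<^sub>m n 1 * 1\<^sub>m 1)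
        (?V * 1\<^sub>m n + 1\<^sub>m 1 * ?V') (?V * ?U + 1\<^sub>m 1 * 1\<^sub>m 1)"
    by (rule mult_four_block_mat[where ?nr1.0 = n and ?n1.0 = n and ?n2.0 = 1 and ?nr2.0 = 1
          and ?nc1.0 = n and ?nc2.0 = 1]) auto
  also have "\<dots> = four_block_mat (1\<^sub>m n) ?U (0\<^sub>m 1 n) ?D"
    by (intro arg_cong4[where f = four_block_mat] eq_matI)
       (auto simp: scalar_prod_def atLeast0LessThan)
  finally have Y2: "four_block_mat (1\<^sub>m n) (0\<^sub>m n 1) ?V (1\<^sub>m 1) * ?Y =
      four_block_mat (1\<^sub>m n) ?U (0\<^sub>m 1 n) ?D" .
  have "det ?Y = det (four_block_mat (1\<^sub>m n) (0\<^sub>m n 1) ?V (1\<^sub>m 1)) * det ?Y"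
    by (subst det_four_block_mat_upper_right_zero[of _ n _ 1]) simp_all
  also have "\<dots> = det (four_block_mat (1\<^sub>m n) (0\<^sub>m n 1) ?V (1\<^sub>m 1) * ?Y)"
    by (rule det_mult[symmetric, of _ "n + 1"]) (auto intro!: four_block_carrier_mat)
  also have "\<dots> = det (four_block_mat (1\<^sub>m n) ?U (0\<^sub>m 1 n) ?D)" unfolding Y2 ..
  also have "\<dots> = 1 + (\<Sum>i<n. v i * u i)"
    by (subst det_four_block_mat_lower_left_zero[of _ n _ 1]) (simp_all add: det_single)
  finally show ?thesis using detY by simp
qed

text \<open>Since \<open>b = B a\<close>, the updated matrix factors as \<open>\<alpha>\<close>
  times \<open>B\<close> times the identity minus \<open>x a b\<close>, with \<open>a b\<close> read
  as an outer product. The factorization does not involve an inverse of \<open>B\<close>.\<close>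

lemma det_rank_one_update:
  fixes B :: "nat \<Rightarrow> nat \<Rightarrow> real"
  assumes b: "\<And>i. i < n \<Longrightarrow> b i = (\<Sum>j<n. B i j * a j)"
  shows "det (mat n n (\<lambda>(i, j). \<alpha> * (B i j - x * (b i * b j)))) =
    \<alpha> ^ n * (1 - x * (\<Sum>i<n. a i * b i)) * det (mat n n (\<lambda>(i, j). B i j))"
proof -
  let ?B = "mat n n (\<lambda>(i, j). B i j)"
  let ?R = "mat n n (\<lambda>(i, j). of_bool (i = j) + (- x * a i) * b j)"
  have R: "det ?R = 1 - x * (\<Sum>i<n. a i * b i)"
    unfolding det_one_plus_outer by (simp add: sum_distrib_left sum_negf mult_ac)
  have "mat n n (\<lambda>(i, j). \<alpha> * (B i j - x * (b i * b j))) = \<alpha> \<cdot>\<^sub>m (?B * ?R)"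
  proof (intro eq_matI, goal_cases)
    case (1 i j)
    then have ij: "i < n" "j < n" by auto
    have "(\<Sum>l<n. B i l * (of_bool (l = j) + (- x * a l) * b j)) =
        (\<Sum>l<n. (if l = j then B i l else 0) - (x * b j) * (B i l * a l))"
      by (rule sum.cong) (auto simp: algebra_simps)
    also have "\<dots> = (\<Sum>l<n. if l = j then B i l else 0) - (x * b j) * (\<Sum>l<n. B i l * a l)"
      by (simp add: sum_subtractf sum_distrib_left)
    also have "\<dots> = B i j - x * (b i * b j)"
      using ij by (simp add: b)
    finally show ?case using ij
      by (simp add: scalar_prod_def atLeast0LessThan)
  qed auto
  then have "det (mat n n (\<lambda>(i, j). \<alpha> * (B i j - x * (b i * b j)))) = \<alpha> ^ n * (det ?B * det ?R)"
    by (simp add: det_mult[of _ n])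
  then show ?thesis using R by simp
qed

text \<open>Up to the sign \<open>(-1) ^ n\<close>, both sides are the value of the characteristic
  polynomial at 0.\<close>

lemma det_eq_prod_roots:
  fixes A :: "complex mat"
  assumes A: "A \<in> carrier_mat n n" and roots: "char_poly A = (\<Prod>a\<leftarrow>as. [:- a, 1:])" "length as = n"
  shows "det A = prod_list as"
proof -
  have "- (char_matrix A 0) = (- 1) \<cdot>\<^sub>m A"
    using A by (intro eq_matI) (auto simp: char_matrix_def)
  then have "poly (char_poly A) 0 = (- 1) ^ n * det A"
    using A by (simp add: char_poly_matrix[OF A])
  moreover have "poly (\<Prod>a\<leftarrow>as. [:- a, 1:]) 0 = (- 1) ^ length as * prod_list as"
    by (induction as) simp_all
  ultimately show ?thesis using roots by simp
qed

text \<open>The determinant is the product of the complex roots of the characteristic polynomial,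
  counted with multiplicity. Symmetry makes each root real, and the quadratic form bound at an
  eigenvector makes it at least \<open>c\<close>.\<close>

lemma det_ge_power:
  fixes B :: "nat \<Rightarrow> nat \<Rightarrow> real"
  assumes sym: "\<And>i j. i < n \<Longrightarrow> j < n \<Longrightarrow> B i j = B j i"
    and pd: "\<And>a. c * (\<Sum>i<n. (a i)\<^sup>2) \<le> (\<Sum>i<n. a i * (\<Sum>j<n. B i j * a j))" and c: "c \<ge> 0"
  shows "c ^ n \<le> det (mat n n (\<lambda>(i, j). B i j))"
proof -
  let ?B = "mat n n (\<lambda>(i, j). B i j)"
  let ?A = "map_mat complex_of_real ?B"
  have A: "?A \<in> carrier_mat n n" by simp
  obtain as where as: "char_poly ?A = (\<Prod>a\<leftarrow>as. [:- a, 1:])" "length as = n"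
    using char_poly_factorized[OF A] by auto
  have root: "Im a = 0 \<and> c \<le> Re a" if "a \<in> set as" for a
  proof -
    have "poly (char_poly ?A) a = 0"
      using that by (auto simp: as(1) poly_prod_list prod_list_zero_iff image_iff intro!: bexI[of _ a])
    then obtain v where v: "eigenvector ?A v a"
      using eigenvalue_root_char_poly[OF A] by (auto simp: eigenvalue_def)
    then have dim: "dim_vec v = n" and ev: "?A *\<^sub>v v = a \<cdot>\<^sub>v v" and nz: "v \<noteq> 0\<^sub>v n"
      by (auto simp: eigenvector_def)
    define p where "p i = Re (vec_index v i)" for i
    define q where "q i = Im (vec_index v i)" for i
    have row: "(\<Sum>j<n. complex_of_real (B i j) * vec_index v j) = a * vec_index v i" if "i < n" for i
      using arg_cong[OF ev, of "\<lambda>w. vec_index w i"] that dim by (simp add: scalar_prod_def atLeast0LessThan)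
    have re: "(\<Sum>j<n. B i j * p j) = Re a * p i - Im a * q i"
      and im: "(\<Sum>j<n. B i j * q j) = Re a * q i + Im a * p i" if "i < n" for i
      using arg_cong[OF row[OF that], of Re] arg_cong[OF row[OF that], of Im]
      by (simp_all add: p_def q_def)
    \<comment> \<open>By symmetry the form takes the same value at the real and imaginary parts in
      either order. The two eigenvalue equations turn this into \<open>Im a\<close> times the
      squared norm being 0.\<close>
    have "(\<Sum>i<n. q i * (\<Sum>j<n. B i j * p j)) = (\<Sum>i<n. \<Sum>j<n. q i * B i j * p j)"
      by (simp add: sum_distrib_left mult_ac)
    also have "\<dots> = (\<Sum>j<n. \<Sum>i<n. q i * B i j * p j)" by (rule sum.swap)
    also have "\<dots> = (\<Sum>i<n. p i * (\<Sum>j<n. B i j * q j))"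
      by (auto simp: sum_distrib_left mult_ac sym intro!: sum.cong)
    finally have "(\<Sum>i<n. q i * (Re a * p i - Im a * q i)) = (\<Sum>i<n. p i * (Re a * q i + Im a * p i))"
      by (simp add: re im)
    then have im0: "Im a * (\<Sum>i<n. (p i)\<^sup>2 + (q i)\<^sup>2) = 0"
      by (simp add: sum_distrib_left power2_eq_square algebra_simps sum.distrib sum_subtractf)
    \<comment> \<open>Adding the bounds for the real and the imaginary part cancels the terms with
      \<open>Im a\<close> and leaves \<open>Re a\<close> times the squared norm.\<close>
    have "c * (\<Sum>i<n. (p i)\<^sup>2 + (q i)\<^sup>2) \<le>
        (\<Sum>i<n. p i * (Re a * p i - Im a * q i)) + (\<Sum>i<n. q i * (Re a * q i + Im a * p i))"
    proof -
      have "(\<Sum>i<n. p i * (\<Sum>j<n. B i j * p j)) = (\<Sum>i<n. p i * (Re a * p i - Im a * q i))"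
        "(\<Sum>i<n. q i * (\<Sum>j<n. B i j * q j)) = (\<Sum>i<n. q i * (Re a * q i + Im a * p i))"
        by (simp_all add: re im)
      then show ?thesis using pd[of p] pd[of q] by (simp only: sum.distrib distrib_left)
    qed
    also have "\<dots> = Re a * (\<Sum>i<n. (p i)\<^sup>2 + (q i)\<^sup>2)"
      unfolding sum_distrib_left sum.distrib[symmetric]
      by (rule sum.cong) (simp_all add: power2_eq_square algebra_simps)
    finally have re1: "c * (\<Sum>i<n. (p i)\<^sup>2 + (q i)\<^sup>2) \<le> Re a * (\<Sum>i<n. (p i)\<^sup>2 + (q i)\<^sup>2)" .
    obtain l where l: "l < n" "vec_index v l \<noteq> 0" using nz dim by (metis eq_vecI index_zero_vec(1,2))
    have "0 < (p l)\<^sup>2 + (q l)\<^sup>2"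
      using l by (simp add: p_def q_def complex_neq_0[symmetric])
    also have "\<dots> \<le> (\<Sum>i<n. (p i)\<^sup>2 + (q i)\<^sup>2)"
      using l by (intro member_le_sum) auto
    finally show ?thesis using im0 re1 by simp
  qed
  have "complex_of_real (det ?B) = det ?A" by (rule of_real_hom.hom_det[symmetric])
  also have "\<dots> = prod_list as" by (rule det_eq_prod_roots[OF A as])
  also have "\<dots> = complex_of_real (prod_list (map Re as))"
    using root by (induction as) (auto simp: complex_eq_iff)
  finally have "det ?B = prod_list (map Re as)" by (simp only: of_real_eq_iff)
  moreover have "c ^ length as \<le> prod_list (map Re as)"
    using root
  proof (induction as)
    case (Cons a as)
    then have "c \<le> Re a" "c ^ length as \<le> prod_list (map Re as)" by auto
    then show ?case using c by (auto intro!: mult_mono)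
  qed simp
  ultimately show ?thesis using as by simp
qed

section \<open>Central cuts\<close>

definition dot :: "dvar set \<Rightarrow> point \<Rightarrow> point \<Rightarrow> real" where
  "dot I a y = (\<Sum>v\<in>I. a v * y v)"

definition bil :: "dvar set \<Rightarrow> (dvar \<Rightarrow> dvar \<Rightarrow> real) \<Rightarrow> point \<Rightarrow> point \<Rightarrow> real" where
  "bil I B a b = (\<Sum>v\<in>I. a v * (\<Sum>w\<in>I. B v w * b w))"

text \<open>The ellipsoid is described by its support function, which avoids inverting \<open>B\<close>.\<close>

definition in_ellipsoid :: "dvar set \<Rightarrow> ellipsoid \<Rightarrow> point \<Rightarrow> bool" where
  "in_ellipsoid I E y \<longleftrightarrow> (\<forall>a. (dot I a y - dot I a (fst E))\<^sup>2 \<le> bil I (snd E) a a)"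

definition pos_def :: "dvar set \<Rightarrow> (dvar \<Rightarrow> dvar \<Rightarrow> real) \<Rightarrow> bool" where
  "pos_def I B \<longleftrightarrow> (\<forall>v\<in>I. \<forall>w\<in>I. B v w = B w v) \<and> (\<forall>a. (\<exists>v\<in>I. a v \<noteq> 0) \<longrightarrow> 0 < bil I B a a)"

lemma dot_lin: "dot I (\<lambda>v. x * a v + y * b v) z = x * dot I a z + y * dot I b z"
  by (simp add: dot_def sum.distrib sum_distrib_left algebra_simps)

lemma bil_lin1: "bil I B (\<lambda>v. x * a v + y * b v) c = x * bil I B a c + y * bil I B b c"
  by (simp add: bil_def sum.distrib sum_distrib_left algebra_simps)

lemma bil_lin2: "bil I B c (\<lambda>v. x * a v + y * b v) = x * bil I B c a + y * bil I B c b"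
  by (simp add: bil_def sum.distrib sum_distrib_left algebra_simps)

lemma bil_sym:
  assumes "\<forall>v\<in>I. \<forall>w\<in>I. B v w = B w v"
  shows "bil I B a b = bil I B b a"
proof -
  have "bil I B a b = (\<Sum>v\<in>I. \<Sum>w\<in>I. a v * B v w * b w)"
    by (simp add: bil_def sum_distrib_left mult_ac)
  also have "\<dots> = (\<Sum>w\<in>I. \<Sum>v\<in>I. a v * B v w * b w)" by (rule sum.swap)
  also have "\<dots> = bil I B b a"
    using assms by (auto simp: bil_def sum_distrib_left mult_ac intro!: sum.cong)
  finally show ?thesis .
qed

lemma bil_quad:
  assumes "pos_def I B"
  shows "bil I B (\<lambda>v. x * a v + y * b v) (\<lambda>v. x * a v + y * b v) =
    x\<^sup>2 * bil I B a a + 2 * x * y * bil I B a b + y\<^sup>2 * bil I B b b"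
proof -
  have "bil I B b a = bil I B a b" using assms by (intro bil_sym) (simp add: pos_def_def)
  then show ?thesis unfolding bil_lin1 bil_lin2 by (simp add: power2_eq_square algebra_simps)
qed

lemma bil_nonneg:
  assumes "pos_def I B"
  shows "0 \<le> bil I B a a"
proof (cases "\<exists>v\<in>I. a v \<noteq> 0")
  case False
  then show ?thesis by (simp add: bil_def)
qed (use assms in \<open>auto simp: pos_def_def less_imp_le\<close>)

lemma bil_Cauchy_Schwarz:
  assumes "pos_def I B"
  shows "(bil I B c a)\<^sup>2 \<le> bil I B c c * bil I B a a"
proof (cases "bil I B a a = 0")
  case True
  then have "\<forall>v\<in>I. a v = 0" using assms by (force simp: pos_def_def)
  then show ?thesis by (simp add: bil_def)
next
  case False
  define s where "s = bil I B a a"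
  have s: "s > 0" using False bil_nonneg[OF assms, of a] by (simp add: s_def)
  have "0 \<le> s\<^sup>2 * bil I B c c + 2 * s * (- bil I B c a) * bil I B c a + (- bil I B c a)\<^sup>2 * s"
    using bil_nonneg[OF assms, of "\<lambda>v. s * c v + (- bil I B c a) * a v"]
    unfolding bil_quad[OF assms] s_def .
  also have "\<dots> = s * (bil I B c c * s - (bil I B c a)\<^sup>2)"
    by (simp add: power2_eq_square algebra_simps)
  finally show ?thesis using s by (simp add: s_def zero_le_mult_iff)
qed

text \<open>The hypothesis says that \<open>(u, t)\<close> respects the support function of the
  planar ellipse with squared half-axes \<open>A\<close> and 1. The conclusion is its equation,
  multiplied by \<open>A\<close> so that it also covers the degenerate case
  \<open>A = 0\<close>.\<close>

lemma quadratic_form_bound: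
  fixes u t A :: real
  assumes "\<And>p q. (p * u + q * t)\<^sup>2 \<le> p\<^sup>2 * A + q\<^sup>2"
  shows "u\<^sup>2 \<le> A * (1 - t\<^sup>2)" "t\<^sup>2 \<le> 1"
proof -
  show t: "t\<^sup>2 \<le> 1" using assms[of 0 1] by simp
  \<comment> \<open>With \<open>p = 1 - t^2\<close> and \<open>q = u * t\<close> the left-hand side
    collapses to \<open>u^2\<close>.\<close>
  have "((1 - t\<^sup>2) * u + u * t * t)\<^sup>2 \<le> (1 - t\<^sup>2)\<^sup>2 * A + (u * t)\<^sup>2" by (rule assms)
  then have *: "(1 - t\<^sup>2) * u\<^sup>2 \<le> (1 - t\<^sup>2) * (A * (1 - t\<^sup>2))"
    by (simp add: power2_eq_square algebra_simps)
  show "u\<^sup>2 \<le> A * (1 - t\<^sup>2)"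
  proof (cases "t\<^sup>2 = 1")
    case True
    have "u = 0"
    proof (rule ccontr)
      assume "u \<noteq> 0"
      \<comment> \<open>For \<open>t^2 = 1\<close> the terms in \<open>q^2\<close> cancel and the
        hypothesis is affine in \<open>q\<close>; this \<open>q\<close> violates it.\<close>
      define q where "q = (A + 1) / (2 * u * t)"
      have "2 * u * t * q = A + 1" using \<open>u \<noteq> 0\<close> True by (auto simp: q_def)
      moreover have "(1 * u + q * t)\<^sup>2 \<le> 1\<^sup>2 * A + q\<^sup>2" by (rule assms)
      then have "u\<^sup>2 + 2 * u * t * q + q\<^sup>2 * t\<^sup>2 \<le> A + q\<^sup>2"
        by (simp add: power2_eq_square algebra_simps)
      ultimately have "u\<^sup>2 + 1 \<le> 0" unfolding True by simp
      then show False using zero_le_power2[of u] by linarith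
    qed
    then show ?thesis using True by simp
  next
    case False
    then have "0 < 1 - t\<^sup>2" using t by simp
    then show ?thesis using * by (simp only: mult_le_cancel_left_pos)
  qed
qed

text \<open>The planar core of a central cut: \<open>t\<close> is the normalized coordinate along
  the cut and \<open>u\<close> the part of a direction uncorrelated with it. The new center lies at
  \<open>t = - 1 / (N + 1)\<close>, and \<open>(N - 1) / (N + 1)\<close> is the squared ratio of the
  new half-axes along and across the cut.\<close>

lemma half_ellipsoid_bound:
  fixes u \<kappa> t A N :: real
  assumes u: "u\<^sup>2 \<le> A * (1 - t\<^sup>2)" and t: "-1 \<le> t" "t \<le> 0" and A: "0 \<le> A" and N: "2 \<le> N"
  shows "(u + \<kappa> * (t + 1 / (N + 1)))\<^sup>2 \<le> N\<^sup>2 / (N\<^sup>2 - 1) * (A + \<kappa>\<^sup>2 * ((N - 1) / (N + 1)))"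
proof -
  define \<tau> where "\<tau> = t + 1 / (N + 1)"
  define m where "m = (N - 1) / (N + 1)"
  define \<alpha> where "\<alpha> = N\<^sup>2 / (N\<^sup>2 - 1)"
  have N2: "N\<^sup>2 - 1 = (N - 1) * (N + 1)" by (simp add: power2_eq_square algebra_simps)
  have m: "m > 0" using N by (simp add: m_def)
  \<comment> \<open>The last term is at most 0 exactly for \<open>t\<close> between -1 and 0, and
    this is where the restriction to the half ellipsoid enters.\<close>
  have \<tau>m: "\<tau>\<^sup>2 / m = \<alpha> - (1 - t\<^sup>2) + 2 / (N - 1) * (t * (t + 1))"
  proof -
    have "N + 1 \<noteq> 0" "N - 1 \<noteq> 0" using N by auto
    then show ?thesis unfolding \<tau>_def m_def \<alpha>_def N2
      by (simp add: divide_simps) (simp add: power2_eq_square algebra_simps)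
  qed
  have "2 / (N - 1) * (t * (t + 1)) \<le> 0"
    using t N by (intro mult_nonneg_nonpos mult_nonpos_nonneg) auto
  then have \<tau>: "\<tau>\<^sup>2 / m \<le> \<alpha> - (1 - t\<^sup>2)" using \<tau>m by simp
  have \<alpha>: "0 \<le> \<alpha>" using N by (simp add: \<alpha>_def N2)
  have "(u + \<kappa> * \<tau>)\<^sup>2 \<le> \<alpha> * (A + \<kappa>\<^sup>2 * m)"
  proof (cases "A = 0")
    case True
    have "t\<^sup>2 \<le> 1" using t by (simp add: abs_square_le_1)
    then have "\<tau>\<^sup>2 / m \<le> \<alpha>" using \<tau> by simp
    then have "\<tau>\<^sup>2 \<le> \<alpha> * m" using m by (simp add: pos_divide_le_eq)
    moreover have "u = 0" using u True by simp
    ultimately show ?thesis using True mult_left_mono[of "\<tau>\<^sup>2" "\<alpha> * m" "\<kappa>\<^sup>2"]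
      by (simp add: power_mult_distrib algebra_simps)
  next
    case False
    then have A: "A > 0" using A by simp
    \<comment> \<open>Cauchy-Schwarz with weights \<open>A\<close> and \<open>m\<close>.\<close>
    have "(u + \<kappa> * \<tau>)\<^sup>2 \<le> (A + \<kappa>\<^sup>2 * m) * (u\<^sup>2 / A + \<tau>\<^sup>2 / m)"
    proof -
      have "(A + \<kappa>\<^sup>2 * m) * (u\<^sup>2 / A + \<tau>\<^sup>2 / m) - (u + \<kappa> * \<tau>)\<^sup>2 = (A * \<tau> - \<kappa> * m * u)\<^sup>2 / (A * m)"
        using A m by (simp add: divide_simps) (simp add: power2_eq_square algebra_simps)
      also have "\<dots> \<ge> 0" using A m by simp
      finally show ?thesis by simp
    qed
    also have "\<dots> \<le> (A + \<kappa>\<^sup>2 * m) * \<alpha>"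
    proof (rule mult_left_mono)
      have "u\<^sup>2 / A \<le> 1 - t\<^sup>2" using u A by (simp add: pos_divide_le_eq mult.commute)
      then show "u\<^sup>2 / A + \<tau>\<^sup>2 / m \<le> \<alpha>" using \<tau> by simp
      show "0 \<le> A + \<kappa>\<^sup>2 * m" using A m by simp
    qed
    finally show ?thesis by (simp add: mult.commute)
  qed
  then show ?thesis by (simp add: \<tau>_def m_def \<alpha>_def)
qed

lemma central_cut_simps:
  fixes I a z B
  defines "N \<equiv> real (card I)" and "Ba \<equiv> (\<lambda>v. \<Sum>w\<in>I. B v w * a w)"
  shows "fst (central_cut I a (z, B)) = (\<lambda>v. z v - Ba v / ((N + 1) * sqrt (bil I B a a)))"
    and "snd (central_cut I a (z, B)) =
      (\<lambda>v w. N\<^sup>2 / (N\<^sup>2 - 1) * (B v w - 2 / (N + 1) * (Ba v * Ba w) / bil I B a a))"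
  unfolding central_cut_def N_def Ba_def bil_def Let_def by simp_all

lemma dot_Ba: "dot I c (\<lambda>v. \<Sum>w\<in>I. B v w * a w) = bil I B c a"
  by (simp add: dot_def bil_def)

lemma central_cut_bil:
  fixes I a z B
  defines "N \<equiv> real (card I)"
  shows "bil I (snd (central_cut I a (z, B))) c c =
    N\<^sup>2 / (N\<^sup>2 - 1) * (bil I B c c - 2 / (N + 1) * (bil I B c a)\<^sup>2 / bil I B a a)"
proof -
  let ?Ba = "\<lambda>v. \<Sum>w\<in>I. B v w * a w"
  let ?x = "2 / (N + 1) / bil I B a a"
  have "bil I (snd (central_cut I a (z, B))) c c =
      (\<Sum>v\<in>I. c v * (\<Sum>w\<in>I. N\<^sup>2 / (N\<^sup>2 - 1) * (B v w * c w - ?x * ?Ba v * (c w * ?Ba w))))"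
    by (subst bil_def, rule sum.cong[OF refl], rule arg_cong[where f = "(*) _"], rule sum.cong[OF refl])
       (simp add: central_cut_simps N_def algebra_simps)
  also have "\<dots> = (\<Sum>v\<in>I. c v * (N\<^sup>2 / (N\<^sup>2 - 1) * ((\<Sum>w\<in>I. B v w * c w) - ?x * ?Ba v * dot I c ?Ba)))"
    unfolding dot_def sum_subtractf[symmetric] sum_distrib_left by (simp only: mult_ac)
  also have "\<dots> = (\<Sum>v\<in>I. N\<^sup>2 / (N\<^sup>2 - 1) * (c v * (\<Sum>w\<in>I. B v w * c w) - ?x * dot I c ?Ba * (c v * ?Ba v)))"
    by (intro sum.cong refl) (simp add: algebra_simps)
  also have "\<dots> = N\<^sup>2 / (N\<^sup>2 - 1) * (bil I B c c - ?x * dot I c ?Ba * dot I c ?Ba)"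
    unfolding bil_def dot_def sum_subtractf[symmetric] sum_distrib_left by (simp only: mult_ac)
  finally show ?thesis unfolding dot_Ba by (simp add: power2_eq_square)
qed

text \<open>By Cauchy-Schwarz the subtracted term is at most \<open>2 / (n + 1)\<close> of the old
  form. This fraction is below 1, and the scaling factor is positive, because the dimension is at
  least 2.\<close>

lemma pos_def_central_cut:
  assumes pd: "pos_def I B" and a: "\<exists>v\<in>I. a v \<noteq> 0" and N: "card I \<ge> 2"
  shows "pos_def I (snd (central_cut I a (z, B)))"
  unfolding pos_def_def
proof (intro conjI ballI allI impI)
  fix v w assume "v \<in> I" "w \<in> I"
  then show "snd (central_cut I a (z, B)) v w = snd (central_cut I a (z, B)) w v"
    using pd by (simp add: central_cut_simps pos_def_def mult_ac)
next
  fix c :: point assume c: "\<exists>v\<in>I. c v \<noteq> 0"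
  define n where "n = real (card I)"
  have n: "n \<ge> 2" using N by (simp add: n_def)
  have s: "0 < bil I B a a" "0 < bil I B c c" using pd a c by (auto simp: pos_def_def)
  have "(bil I B c a)\<^sup>2 / bil I B a a \<le> bil I B c c"
    using bil_Cauchy_Schwarz[OF pd] s by (simp add: pos_divide_le_eq)
  then have "2 / (n + 1) * ((bil I B c a)\<^sup>2 / bil I B a a) \<le> 2 / (n + 1) * bil I B c c"
    using n by (intro mult_left_mono) auto
  also have "\<dots> < 1 * bil I B c c"
    using s n by (intro mult_strict_right_mono) auto
  finally have "0 < bil I B c c - 2 / (n + 1) * (bil I B c a)\<^sup>2 / bil I B a a" by simp
  moreover have "0 < n\<^sup>2 / (n\<^sup>2 - 1)"
    using n power_strict_mono[of 1 n 2] by (intro divide_pos_pos) auto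
  ultimately show "0 < bil I (snd (central_cut I a (z, B))) c c"
    unfolding central_cut_bil n_def by (rule mult_pos_pos[rotated])
qed

text \<open>For each direction \<open>c\<close> only the plane of \<open>c\<close> and
  \<open>a\<close> matters. Subtracting from \<open>c\<close> its correlation
  \<open>\<kappa>\<close> with the normalized cut direction gives the two coordinates of
  \<open>half_ellipsoid_bound\<close>.\<close>

lemma in_central_cut:
  assumes pd: "pos_def I B" and a: "\<exists>v\<in>I. a v \<noteq> 0" and N: "card I \<ge> 2"
    and y: "in_ellipsoid I (z, B) y" and cut: "dot I a y \<le> dot I a z"
  shows "in_ellipsoid I (central_cut I a (z, B)) y"
  unfolding in_ellipsoid_def
proof
  fix c :: point
  define s where "s = bil I B a a"
  define r where "r = sqrt s"
  define n where "n = real (card I)"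
  define \<kappa> where "\<kappa> = bil I B c a / r"
  define t where "t = (dot I a y - dot I a z) / r"
  define u where "u = dot I c y - dot I c z - \<kappa> * t"
  define A where "A = bil I B c c - \<kappa>\<^sup>2"
  have s: "0 < s" using pd a by (auto simp: pos_def_def s_def)
  then have r: "0 < r" "r * r = s" by (auto simp: r_def)
  have \<kappa>2: "\<kappa>\<^sup>2 = (bil I B c a)\<^sup>2 / s" using r by (simp add: \<kappa>_def power_divide power2_eq_square)
  have "A \<ge> 0"
    using bil_Cauchy_Schwarz[OF pd, of c a] s by (simp add: A_def \<kappa>2 pos_divide_le_eq s_def)
  \<comment> \<open>The support function is evaluated in the direction
    \<open>p * c + ?d * a\<close>, where \<open>?d\<close> is chosen to make the coefficient of
    \<open>t\<close> equal to \<open>q\<close>.\<close>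
  have quad: "(p * u + q * t)\<^sup>2 \<le> p\<^sup>2 * A + q\<^sup>2" for p q
  proof -
    let ?d = "(q - p * \<kappa>) / r"
    let ?c = "\<lambda>v. p * c v + ?d * a v"
    have "dot I ?c y - dot I ?c z = p * u + q * t"
      unfolding dot_lin u_def t_def using r by (simp add: field_simps)
    moreover have "bil I B ?c ?c = p\<^sup>2 * A + q\<^sup>2"
    proof -
      have "?d\<^sup>2 * s = (q - p * \<kappa>)\<^sup>2" using r s by (simp add: power_divide power2_eq_square[of r])
      moreover have "bil I B c a = \<kappa> * r" using r by (simp add: \<kappa>_def)
      then have "2 * p * ?d * bil I B c a = 2 * p * (q - p * \<kappa>) * \<kappa>" using r by simp
      ultimately show ?thesis
        unfolding bil_quad[OF pd] A_def s_def[symmetric]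
        by (simp add: power2_eq_square algebra_simps)
    qed
    ultimately show ?thesis
      using y unfolding in_ellipsoid_def fst_conv snd_conv by metis
  qed
  note bound = quadratic_form_bound[OF quad]
  have "-1 \<le> t" using bound(2) by (simp add: abs_square_le_1 abs_le_iff)
  moreover have "t \<le> 0" using cut r by (simp add: t_def divide_nonpos_pos)
  ultimately have main: "(u + \<kappa> * (t + 1 / (n + 1)))\<^sup>2 \<le> n\<^sup>2 / (n\<^sup>2 - 1) * (A + \<kappa>\<^sup>2 * ((n - 1) / (n + 1)))"
    using bound(1) \<open>A \<ge> 0\<close> N by (intro half_ellipsoid_bound) (auto simp: n_def)
  have fst_dot: "dot I c (fst (central_cut I a (z, B))) = dot I c z - bil I B c a / ((n + 1) * r)"
  proof -
    have "dot I c (\<lambda>v. z v - X v / d) = dot I c z - dot I c X / d" for X d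
      by (simp add: dot_def sum_subtractf right_diff_distrib sum_divide_distrib)
    then show ?thesis unfolding central_cut_simps n_def r_def s_def dot_Ba[symmetric] .
  qed
  have 1: "dot I c y - dot I c (fst (central_cut I a (z, B))) = u + \<kappa> * (t + 1 / (n + 1))"
  proof -
    have "bil I B c a / ((n + 1) * r) = \<kappa> * (1 / (n + 1))" by (simp add: \<kappa>_def)
    with fst_dot show ?thesis unfolding u_def by (simp only: distrib_left)
  qed
  have "1 - 2 / (n + 1) = (n - 1) / (n + 1)" by (simp add: n_def field_simps)
  then have m: "A + \<kappa>\<^sup>2 * ((n - 1) / (n + 1)) = A + \<kappa>\<^sup>2 * (1 - 2 / (n + 1))" by simp
  have 2: "bil I (snd (central_cut I a (z, B))) c c = n\<^sup>2 / (n\<^sup>2 - 1) * (A + \<kappa>\<^sup>2 * ((n - 1) / (n + 1)))"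
  proof -
    have "2 / (n + 1) * (bil I B c a)\<^sup>2 / s = \<kappa>\<^sup>2 * (2 / (n + 1))" by (simp add: \<kappa>2 mult_ac)
    then have "bil I B c c - 2 / (n + 1) * (bil I B c a)\<^sup>2 / s = A + \<kappa>\<^sup>2 * (1 - 2 / (n + 1))"
      unfolding A_def by (simp add: right_diff_distrib)
    with m show ?thesis unfolding central_cut_bil n_def[symmetric] s_def[symmetric] by simp
  qed
  show "(dot I c y - dot I c (fst (central_cut I a (z, B))))\<^sup>2 \<le> bil I (snd (central_cut I a (z, B))) c c"
    unfolding 1 2 by (rule main)
qed

section \<open>The determinant under cuts\<close>

text \<open>Proportional to the squared volume of the ellipsoid. One enumeration of
  \<open>I\<close>, fixed by choice, serves every matrix over \<open>I\<close>, so values before and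
  after a cut are comparable.\<close>

definition qdet :: "dvar set \<Rightarrow> (dvar \<Rightarrow> dvar \<Rightarrow> real) \<Rightarrow> real" where
  "qdet I B = (let f = (SOME f. bij_betw f {..<card I} I)
    in det (mat (card I) (card I) (\<lambda>(i, j). B (f i) (f j))))"

lemma qdet_enum:
  assumes "finite I"
  obtains f where "bij_betw f {..<card I} I"
    "\<And>B. qdet I B = det (mat (card I) (card I) (\<lambda>(i, j). B (f i) (f j)))"
proof -
  have "\<exists>f. bij_betw f {..<card I} I"
    using ex_bij_betw_nat_finite[OF assms] by (simp add: atLeast0LessThan)
  then have "bij_betw (SOME f. bij_betw f {..<card I} I) {..<card I} I" by (rule someI_ex)
  then show thesis by (rule that) (simp add: qdet_def Let_def)
qed

lemma qdet_diag:
  assumes "finite I"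
  shows "qdet I (\<lambda>v w. of_bool (v = w) * d) = d ^ card I"
proof -
  obtain f where f: "bij_betw f {..<card I} I"
    and q: "\<And>B. qdet I B = det (mat (card I) (card I) (\<lambda>(i, j). B (f i) (f j)))"
    using qdet_enum[OF assms] by blast
  have "mat (card I) (card I) (\<lambda>(i, j). of_bool (f i = f j) * d) = d \<cdot>\<^sub>m 1\<^sub>m (card I)"
    using f by (intro eq_matI) (auto simp: bij_betw_def inj_on_def)
  then show ?thesis by (simp add: q)
qed

lemma qdet_central_cut:
  assumes "finite I" "bil I B a a \<noteq> 0"
  shows "qdet I (snd (central_cut I a (z, B))) =
    ((real (card I))\<^sup>2 / ((real (card I))\<^sup>2 - 1)) ^ card I * (1 - 2 / (real (card I) + 1)) * qdet I B"
proof -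
  obtain f where f: "bij_betw f {..<card I} I"
    and q: "\<And>B. qdet I B = det (mat (card I) (card I) (\<lambda>(i, j). B (f i) (f j)))"
    using qdet_enum[OF assms(1)] by blast
  have re: "(\<Sum>v\<in>I. g v) = (\<Sum>i<card I. g (f i))" for g :: "dvar \<Rightarrow> real"
    using sum.reindex_bij_betw[OF f, of g] by simp
  define n where "n = real (card I)"
  define Ba where "Ba v = (\<Sum>w\<in>I. B v w * a w)" for v
  let ?x = "2 / (n + 1) / bil I B a a"
  have "qdet I (snd (central_cut I a (z, B))) = det (mat (card I) (card I)
      (\<lambda>(i, j). n\<^sup>2 / (n\<^sup>2 - 1) * (B (f i) (f j) - ?x * (Ba (f i) * Ba (f j)))))"
    unfolding q central_cut_simps n_def Ba_def by (simp add: mult_ac)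
  also have "\<dots> = (n\<^sup>2 / (n\<^sup>2 - 1)) ^ card I * (1 - ?x * (\<Sum>i<card I. a (f i) * Ba (f i))) *
      det (mat (card I) (card I) (\<lambda>(i, j). B (f i) (f j)))"
    by (rule det_rank_one_update) (simp add: Ba_def re)
  also have "(\<Sum>i<card I. a (f i) * Ba (f i)) = bil I B a a"
    by (simp add: bil_def Ba_def re)
  finally show ?thesis using assms(2) by (simp add: q n_def)
qed

lemma qdet_ge_power:
  assumes I: "finite I" and pd: "pos_def I B" and c: "c \<ge> 0"
    and ge: "\<And>a. c * (\<Sum>v\<in>I. (a v)\<^sup>2) \<le> bil I B a a"
  shows "c ^ card I \<le> qdet I B"
proof -
  obtain f where f: "bij_betw f {..<card I} I"
    and q: "\<And>B. qdet I B = det (mat (card I) (card I) (\<lambda>(i, j). B (f i) (f j)))"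
    using qdet_enum[OF I] by blast
  have re: "(\<Sum>v\<in>I. g v) = (\<Sum>i<card I. g (f i))" for g :: "dvar \<Rightarrow> real"
    using sum.reindex_bij_betw[OF f, of g] by simp
  have fI: "f i \<in> I" if "i < card I" for i using f that by (auto simp: bij_betw_def)
  show ?thesis unfolding q
  proof (rule det_ge_power[OF _ _ c])
    fix a :: "nat \<Rightarrow> real"
    have inv: "the_inv_into {..<card I} f (f i) = i" if "i < card I" for i
      using f that by (simp add: bij_betw_def the_inv_into_f_f)
    show "c * (\<Sum>i<card I. (a i)\<^sup>2) \<le> (\<Sum>i<card I. a i * (\<Sum>j<card I. B (f i) (f j) * a j))"
      using ge[of "\<lambda>v. a (the_inv_into {..<card I} f v)"] by (simp add: bil_def re inv)
  qed (use pd fI in \<open>auto simp: pos_def_def\<close>)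
qed

text \<open>One factor \<open>N^2 / (N^2 - 1)\<close> combines with the last one to
  \<open>(N / (N + 1))^2\<close>. Then \<open>1 + x \<le> exp x\<close> bounds the two groups by
  \<open>exp (1 / (N + 1))\<close> and \<open>exp (- 2 / (N + 1))\<close>. The result is the square
  of the usual volume factor.\<close>

lemma cut_factor_le:
  fixes N :: nat
  assumes "N \<ge> 2"
  shows "((real N)\<^sup>2 / ((real N)\<^sup>2 - 1)) ^ N * (1 - 2 / (real N + 1)) \<le> exp (- 1 / (real N + 1))"
proof -
  define n where "n = real N"
  have n: "n \<ge> 2" using assms by (simp add: n_def)
  have n2: "n\<^sup>2 - 1 = (n - 1) * (n + 1)" by (simp add: power2_eq_square algebra_simps)
  have "n\<^sup>2 - 1 > 0" using n by (simp add: n2)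
  then have "n\<^sup>2 / (n\<^sup>2 - 1) = 1 + 1 / (n\<^sup>2 - 1)" by (simp add: field_simps)
  also have "\<dots> \<le> exp (1 / (n\<^sup>2 - 1))" by (rule exp_ge_add_one_self)
  finally have "(n\<^sup>2 / (n\<^sup>2 - 1)) ^ (N - 1) \<le> exp (1 / (n\<^sup>2 - 1)) ^ (N - 1)"
    using n by (intro power_mono) (auto simp: n2)
  also have "\<dots> = exp ((n - 1) * (1 / (n\<^sup>2 - 1)))"
    using assms by (simp add: exp_of_nat_mult[symmetric] n_def of_nat_diff)
  also have "(n - 1) * (1 / (n\<^sup>2 - 1)) = 1 / (n + 1)" using n by (simp add: n2)
  finally have 1: "(n\<^sup>2 / (n\<^sup>2 - 1)) ^ (N - 1) \<le> exp (1 / (n + 1))" .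
  have "n / (n + 1) = 1 + (- 1 / (n + 1))" using n by (simp add: field_simps)
  also have "\<dots> \<le> exp (- 1 / (n + 1))" by (rule exp_ge_add_one_self)
  finally have "(n / (n + 1))\<^sup>2 \<le> (exp (- 1 / (n + 1)))\<^sup>2" using n by (intro power_mono) auto
  also have "\<dots> = exp (- 2 / (n + 1))" by (simp flip: exp_of_nat_mult)
  finally have 2: "(n / (n + 1))\<^sup>2 \<le> exp (- 2 / (n + 1))" .
  have *: "(n\<^sup>2 / (n\<^sup>2 - 1)) * (1 - 2 / (n + 1)) = (n / (n + 1))\<^sup>2"
    using n unfolding n2 by (simp add: divide_simps) (simp add: power2_eq_square)
  have "(n\<^sup>2 / (n\<^sup>2 - 1)) ^ N * (1 - 2 / (n + 1)) = (n\<^sup>2 / (n\<^sup>2 - 1)) ^ (N - 1) * (n / (n + 1))\<^sup>2"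
  proof -
    have "(n\<^sup>2 / (n\<^sup>2 - 1)) ^ N = (n\<^sup>2 / (n\<^sup>2 - 1)) ^ (N - 1) * (n\<^sup>2 / (n\<^sup>2 - 1))"
      using assms power_Suc2[of "n\<^sup>2 / (n\<^sup>2 - 1)" "N - 1"] by simp
    with * show ?thesis by (simp only: mult.assoc)
  qed
  also have "\<dots> \<le> exp (1 / (n + 1)) * exp (- 2 / (n + 1))"
    using 1 2 by (intro mult_mono) auto
  also have "\<dots> = exp (1 / (n + 1) + - 2 / (n + 1))" by (rule exp_add[symmetric])
  also have "1 / (n + 1) + - 2 / (n + 1) = - 1 / (n + 1)" unfolding add_divide_distrib[symmetric] by simp
  finally show ?thesis by (simp add: n_def)
qed

text \<open>Both points at distance \<open>r\<close> from \<open>c\<close> in the directions \<open>a\<close> and \<open>- a\<close> lie in the slab that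
  the ellipsoid cuts out for \<open>a\<close>, which therefore has width at least \<open>2 r\<close>.\<close>

lemma ball_in_ellipsoid:
  assumes I: "finite I" and r: "r > 0"
    and ball: "\<And>y. (\<And>v. v \<in> I \<Longrightarrow> \<bar>y v - c v\<bar> \<le> r) \<Longrightarrow> in_ellipsoid I (z, B) y"
    and pd: "pos_def I B"
  shows "r\<^sup>2 * (\<Sum>v\<in>I. (a v)\<^sup>2) \<le> bil I B a a"
proof (cases "\<exists>v\<in>I. a v \<noteq> 0")
  case False
  then show ?thesis using bil_nonneg[OF pd] by (simp add: bil_def)
next
  case True
  define l where "l = sqrt (\<Sum>v\<in>I. (a v)\<^sup>2)"
  have pos: "0 < (\<Sum>v\<in>I. (a v)\<^sup>2)" using True I by (auto intro: sum_pos2)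
  then have l: "l > 0" "l * l = (\<Sum>v\<in>I. (a v)\<^sup>2)" by (auto simp: l_def)
  have le: "\<bar>a v\<bar> \<le> l" if "v \<in> I" for v
    using member_le_sum[OF that, of "\<lambda>v. (a v)\<^sup>2"] I by (auto simp: l_def intro!: real_le_rsqrt)
  define x where "x = dot I a c - dot I a z"
  have y: "(x + e * r * l)\<^sup>2 \<le> bil I B a a" if e: "\<bar>e\<bar> = 1" for e
  proof -
    \<comment> \<open>The point at Euclidean distance \<open>r\<close> from \<open>c\<close> along
      \<open>a\<close>; each coordinate moves by at most \<open>r\<close>, so it lies in the cube of
      the hypothesis.\<close>
    let ?y = "\<lambda>v. c v + e * r * a v / l"
    have "in_ellipsoid I (z, B) ?y"
    proof (rule ball)
      fix v assume "v \<in> I"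
      then have "r * \<bar>a v\<bar> / l \<le> r * l / l" using le r l by (intro divide_right_mono mult_left_mono) auto
      then show "\<bar>?y v - c v\<bar> \<le> r" using e r l by (simp add: abs_mult)
    qed
    moreover have "dot I a ?y = dot I a c + e * r * l"
    proof -
      have "dot I a ?y = (\<Sum>v\<in>I. a v * c v + e * r / l * (a v)\<^sup>2)"
        unfolding dot_def by (rule sum.cong) (simp_all add: power2_eq_square distrib_left)
      also have "\<dots> = dot I a c + e * r / l * (\<Sum>v\<in>I. (a v)\<^sup>2)"
        by (simp add: dot_def sum.distrib sum_distrib_left)
      also have "\<dots> = dot I a c + e * r * l" using l(1) unfolding l(2)[symmetric] by simp
      finally show ?thesis .
    qed
    ultimately have "(dot I a c + e * r * l - dot I a z)\<^sup>2 \<le> bil I B a a"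
      unfolding in_ellipsoid_def fst_conv snd_conv by metis
    then show ?thesis by (simp add: x_def add_diff_eq diff_add_eq)
  qed
  \<comment> \<open>Adding the inequalities for the two opposite points removes the unknown offset
    \<open>x\<close> between the centers.\<close>
  have "(x + r * l)\<^sup>2 + (x - r * l)\<^sup>2 \<le> 2 * bil I B a a"
    using y[of 1] y[of "-1"] by simp
  moreover have "(x + r * l)\<^sup>2 + (x - r * l)\<^sup>2 = 2 * (x\<^sup>2 + (r * l)\<^sup>2)"
    by (simp add: power2_eq_square algebra_simps)
  ultimately have "x\<^sup>2 + (r * l)\<^sup>2 \<le> bil I B a a" by simp
  then have "(r * l)\<^sup>2 \<le> bil I B a a" using zero_le_power2[of x] by linarith
  then show ?thesis unfolding power_mult_distrib power2_eq_square[of l] l(2) .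
qed

section \<open>Values of execution-count vectors as values of lists\<close>

lemma counts_on_count_list:
  assumes "finite S" "m \<in> counts_on S"
  obtains gs where "set gs \<subseteq> S" "m = count_list gs"
proof -
  obtain ws where ws: "set ws = S" "distinct ws" using finite_distinct_list[OF assms(1)] by auto
  define gs where "gs = concat (map (\<lambda>g. replicate (m g) g) ws)"
  have rep: "count_list (replicate j x) y = (if x = y then j else 0)" for j and x y :: 'a
    by (induction j) auto
  have "count_list gs g = m g" for g
  proof -
    have "count_list (concat (map (\<lambda>g. replicate (m g) g) xs)) g = (if g \<in> set xs then m g else 0)"
      if "distinct xs" for xs
      using that by (induction xs) (auto simp: count_list_append rep)
    then show ?thesis using ws assms(2) by (auto simp: gs_def counts_on_def)
  qed
  then have "m = count_list gs" by (simp add: fun_eq_iff)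
  moreover have "set gs \<subseteq> S" using ws by (auto simp: gs_def)
  ultimately show thesis using that by blast
qed

lemma count_list_in_counts_on: "set gs \<subseteq> S \<Longrightarrow> count_list gs \<in> counts_on S"
  by (auto simp: counts_on_def count_list_0_iff)

lemma count_list_eq_0_iff: "count_list gs = (\<lambda>_. 0) \<longleftrightarrow> gs = []"
proof
  assume "count_list gs = (\<lambda>_. 0)"
  then have "count_list gs (hd gs) = 0" by simp
  then show "gs = []" by (cases gs) auto
qed auto

lemma size_of_count_list:
  "finite (workflows P) \<Longrightarrow> set gs \<subseteq> workflows P \<Longrightarrow> size_of P (count_list gs) = length gs"
  by (simp add: size_of_def sum_count_set)

lemma cost_of_count_list:
  assumes "finite (workflows P)" "set gs \<subseteq> workflows P"
  shows "cost_of P (count_list gs) = sum_list (map (cost P) gs)"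
  using assms(2)
proof (induction gs)
  case (Cons x gs)
  have "cost_of P (count_list (x # gs)) =
      (\<Sum>g\<in>workflows P. cost P g * real (count_list gs g) + (if g = x then cost P g else 0))"
    unfolding cost_of_def by (rule sum.cong) (auto simp: algebra_simps)
  then show ?case using Cons assms(1) by (simp add: sum.distrib cost_of_def)
qed (simp add: cost_of_def)

definition list_value :: "'g problem \<Rightarrow> (nat \<Rightarrow> 'g \<Rightarrow> real) \<Rightarrow> 'g list \<Rightarrow> real" where
  "list_value P a gs = (\<Sum>i=1..tasks P. pb (map (a i) gs) (curve P (length gs))) / real (tasks P)
    - price P * sum_list (map (cost P) gs)"

text \<open>Serves both the execution model and the Stage-2 draws: \<open>e g q\<close> names the
  indicator of copy \<open>q\<close> of workflow \<open>g\<close>. As distinct copies use distinct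
  indicators, the double sum runs over independent trials.\<close>

lemma (in prob_space) expectation_counts:
  fixes Z :: "'b \<Rightarrow> 'a \<Rightarrow> bool" and e :: "'g \<Rightarrow> nat \<Rightarrow> 'b"
  assumes indep: "indep_vars (\<lambda>_. count_space UNIV) Z I"
    and S: "finite S" "set gs \<subseteq> S"
    and inj: "inj_on (\<lambda>(g, q). e g q) (SIGMA g:S. {1..count_list gs g})"
    and e: "\<And>g q. g \<in> S \<Longrightarrow> q \<in> {1..count_list gs g} \<Longrightarrow> e g q \<in> I \<and> expectation (\<lambda>w. of_bool (Z (e g q) w)) = a g"
  shows "expectation (\<lambda>w. f (\<Sum>g\<in>S. \<Sum>q=1..count_list gs g. of_bool (Z (e g q) w))) = pb (map a gs) f"
proof -
  define J where "J = (SIGMA g:S. {1..count_list gs g})"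
  have finJ: "finite J" using S by (auto simp: J_def)
  obtain ps where ps: "set ps = J" "distinct ps" using finite_distinct_list[OF finJ] by auto
  define xs where "xs = map (\<lambda>(g, q). e g q) ps"
  have inj': "inj_on (\<lambda>(g, q). e g q) J" using inj by (simp add: J_def)
  have dist: "distinct xs" using ps inj' by (simp add: xs_def distinct_map)
  have sub: "set xs \<subseteq> I" using e by (auto simp: xs_def ps J_def)
  define a' :: "'b \<Rightarrow> real" where "a' x = expectation (\<lambda>w. of_bool (Z x w))" for x
  have "map a' xs = map a (map fst ps)"
    using e ps by (auto simp: xs_def a'_def J_def)
  \<comment> \<open>Listing the pairs \<open>(g, q)\<close> and forgetting the copy number gives
    \<open>gs\<close> back up to order.\<close>
  moreover have "mset (map fst ps) = mset gs"
  proof (rule multiset_eqI)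
    fix g
    have "count (mset (map fst ps)) g = length (filter (\<lambda>p. g = fst p) ps)"
      by (simp only: count_mset count_list_eq_length_filter filter_map length_map o_def)
    also have "\<dots> = card {p \<in> J. fst p = g}"
      using ps distinct_card[of "filter (\<lambda>p. g = fst p) ps"] by (simp add: eq_commute)
    also have "{p \<in> J. fst p = g} = (if g \<in> S then Pair g ` {1..count_list gs g} else {})"
      by (auto simp: J_def)
    also have "card \<dots> = count (mset gs) g"
      using S by (auto simp: card_image inj_on_def count_mset count_list_0_iff)
    finally show "count (mset (map fst ps)) g = count (mset gs) g" .
  qed
  ultimately have perm: "mset (map a' xs) = mset (map a gs)"
    by (metis mset_map)
  have E: "expectation (\<lambda>w. f (\<Sum>x\<in>set xs. of_bool (Z x w))) = pb (map a' xs) f"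
    by (rule expectation_pb[OF indep_vars_subset[OF indep sub] dist]) (simp add: a'_def)
  have "(\<Sum>x\<in>set xs. of_bool (Z x w) :: nat) = (\<Sum>g\<in>S. \<Sum>q=1..count_list gs g. of_bool (Z (e g q) w))" for w
  proof -
    have "(\<Sum>x\<in>set xs. of_bool (Z x w) :: nat) = (\<Sum>(g, q)\<in>J. of_bool (Z (e g q) w))"
      using sum.reindex[OF inj', of "\<lambda>x. of_bool (Z x w)"] ps
      by (simp add: xs_def case_prod_unfold o_def)
    also have "\<dots> = (\<Sum>g\<in>S. \<Sum>q=1..count_list gs g. of_bool (Z (e g q) w))"
      unfolding J_def by (rule sum.Sigma[symmetric]) (use S in auto)
    finally show ?thesis .
  qed
  then show ?thesis using E by (simp only: pb_mset[OF perm])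
qed

text \<open>The empty list is excluded because the value of the zero vector is 0 by convention,
  while \<open>list_value\<close> would read \<open>curve P 0\<close>.\<close>

lemma stoch_value_count_list:
  assumes W: "finite (workflows P)" "set gs \<subseteq> workflows P" and gs: "gs \<noteq> []"
    and acc: "\<And>i g. i \<in> {1..tasks P} \<Longrightarrow> g \<in> workflows P \<Longrightarrow> 0 \<le> acc P i g \<and> acc P i g \<le> 1"
  shows "stoch_value P (count_list gs) = list_value P (acc P) gs"
proof -
  define J where "J = {1..tasks P} \<times> (SIGMA g:workflows P. {1..count_list gs g})"
  have finJ: "finite J" using W by (auto simp: J_def)
  define X where "X = exec_pmf P (count_list gs)"
  have X: "X = Pi_pmf J False (\<lambda>(i, g, q). bernoulli_pmf (acc P i g))"
    by (simp add: X_def exec_pmf_def J_def)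
  have fin: "finite (set_pmf X)"
    unfolding X by (rule finite_subset[OF set_Pi_pmf_subset'[OF finJ]]) (use finJ in auto)
  have comp: "measure_pmf.expectation X (\<lambda>Z. of_bool (Z (i, g, q))) = acc P i g"
    if "(i, g, q) \<in> J" for i g q
  proof -
    have "measure_pmf.expectation X (\<lambda>Z. of_bool (Z (i, g, q))) =
        measure_pmf.expectation (map_pmf (\<lambda>Z. Z (i, g, q)) X) (of_bool :: bool \<Rightarrow> real)" by simp
    also have "\<dots> = acc P i g"
      unfolding X Pi_pmf_component[OF finJ] using that acc[of i g] by (simp add: J_def)
    finally show ?thesis .
  qed
  let ?R = "\<lambda>i Z. \<Sum>g\<in>workflows P. \<Sum>q=1..count_list gs g. of_bool (Z (i, g, q)) :: nat"
  have "measure_pmf.expectation X (\<lambda>Z. f (?R i Z)) = pb (map (acc P i) gs) f" if "i \<in> {1..tasks P}" for i f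
  proof (rule prob_space.expectation_counts[OF measure_pmf.prob_space_axioms, where I = J])
    show "prob_space.indep_vars (measure_pmf X) (\<lambda>_. count_space UNIV) (\<lambda>x Z. Z x) J"
      unfolding X by (rule indep_vars_Pi_pmf[OF finJ])
  qed (use W comp that in \<open>auto simp: inj_on_def J_def\<close>)
  then have "measure_pmf.expectation X (\<lambda>Z. (\<Sum>i=1..tasks P. curve P (length gs) (?R i Z)) / real (tasks P)) =
      (\<Sum>i=1..tasks P. pb (map (acc P i) gs) (curve P (length gs))) / real (tasks P)"
    using fin by (simp add: Bochner_Integration.integral_sum integrable_measure_pmf_finite)
  then show ?thesis
    using gs W by (simp add: stoch_value_def count_list_eq_0_iff size_of_count_list cost_of_count_list
        list_value_def X_def)
qed

section \<open>The scenario distribution\<close>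

lemma finite_scenarios: "finite (scenarios P C k)"
  unfolding scenarios_def by (intro finite_PiE) auto

lemma card_scenarios: "card (scenarios P C k) = panel1 C ^ (tasks P * k)"
  unfolding scenarios_def by (simp add: card_PiE)

lemma est1_range:
  assumes "panel1 C \<ge> 1"
  shows "est1 C z1 i g \<in> {0..1}"
proof -
  have "(\<Sum>l=1..panel1 C. of_bool (z1 (i, g, l)) :: real) \<le> (\<Sum>l=1..panel1 C. 1)" by (rule sum_mono) simp
  then show ?thesis using assms by (auto simp: est1_def divide_le_eq sum_nonneg)
qed

context
  fixes P :: "'g problem" and C :: "'g config" and k :: nat
  assumes panel1: "panel1 C \<ge> 1"
begin

text \<open>The uniform distribution on scenarios as a product measure, which makes the coordinates
  independent.\<close>

definition scen_pmf :: "scenario pmf" where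
  "scen_pmf = Pi_pmf ({1..tasks P} \<times> {1..k}) undefined (\<lambda>_. pmf_of_set {1..panel1 C})"

lemma scen_pmf_sum:
  fixes f :: "scenario \<Rightarrow> real"
  shows "measure_pmf.expectation scen_pmf f = (\<Sum>\<omega>\<in>scenarios P C k. scen_prob P C k * f \<omega>)"
proof -
  have "PiE_dflt ({1..tasks P} \<times> {1..k}) undefined (\<lambda>_. {1..panel1 C}) = scenarios P C k"
    by (auto simp: PiE_dflt_def scenarios_def PiE_def Pi_def extensional_def)
  then have "scen_pmf = pmf_of_set (scenarios P C k)"
    unfolding scen_pmf_def using panel1 by (subst Pi_pmf_of_set) auto
  moreover have "scenarios P C k \<noteq> {}" using card_scenarios[of P C k] panel1 by fastforce
  ultimately show ?thesis
    by (simp add: integral_pmf_of_set finite_scenarios card_scenarios scen_prob_def sum_divide_distrib)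
qed

lemma sum_scen_prob: "(\<Sum>\<omega>\<in>scenarios P C k. scen_prob P C k) = 1"
  using scen_pmf_sum[of "\<lambda>_. 1"] by simp

text \<open>\<open>panel1 C * est1 C z1 i g\<close> is the integer number of successes in the panel,
  and a uniform element of \<open>{1..panel1 C}\<close> is at most \<open>s\<close> with probability
  \<open>s / panel1 C\<close>.\<close>

lemma scen_marginal:
  assumes i: "i \<in> {1..tasks P}" and q: "q \<in> {1..k}"
  shows "(\<Sum>\<omega>\<in>scenarios P C k. scen_prob P C k * plug_correct C z1 i g q \<omega>) = est1 C z1 i g"
proof -
  define s where "s = (\<Sum>l=1..panel1 C. of_bool (z1 (i, g, l)) :: nat)"
  have "s \<le> (\<Sum>l=1..panel1 C. 1)" unfolding s_def by (rule sum_mono) simp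
  then have s: "s \<le> panel1 C" by simp
  have est: "real (panel1 C) * est1 C z1 i g = real s"
    using panel1 by (simp add: est1_def s_def)
  have "(\<Sum>\<omega>\<in>scenarios P C k. scen_prob P C k * plug_correct C z1 i g q \<omega>) =
      measure_pmf.expectation scen_pmf (\<lambda>\<omega>. of_bool (\<omega> (i, q) \<le> s))"
    unfolding scen_pmf_sum plug_correct_def est by simp
  also have "\<dots> = measure_pmf.expectation (map_pmf (\<lambda>\<omega>. \<omega> (i, q)) scen_pmf) (\<lambda>u. of_bool (u \<le> s))"
    by simp
  also have "\<dots> = (\<Sum>u\<in>{1..panel1 C}. of_bool (u \<le> s)) / real (panel1 C)"
    unfolding scen_pmf_def using i q panel1 by (subst Pi_pmf_component) (auto simp: integral_pmf_of_set)
  also have "(\<Sum>u\<in>{1..panel1 C}. of_bool (u \<le> s) :: real) = (\<Sum>u\<in>{1..s}. 1)"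
    using s by (intro sum.mono_neutral_cong_right) auto
  also have "(\<Sum>u\<in>{1..s}. 1) / real (panel1 C) = est1 C z1 i g"
    using panel1 by (simp add: est1_def s_def)
  finally show ?thesis .
qed

text \<open>Different columns read different coordinates of the scenario, so repeated use of one
  workflow still gives independent plug-in executions. Columns are numbered from 1 and list
  positions from 0.\<close>

lemma scen_pb:
  assumes i: "i \<in> {1..tasks P}" and gs: "length gs = k"
  shows "(\<Sum>\<omega>\<in>scenarios P C k. scen_prob P C k *
      f (\<Sum>q=1..k. of_bool (real (\<omega> (i, q)) \<le> real (panel1 C) * est1 C z1 i (gs ! (q - 1))))) =
    pb (map (est1 C z1 i) gs) f"
proof -
  let ?J = "{1..tasks P} \<times> {1..k}"
  let ?t = "\<lambda>q. real (panel1 C) * est1 C z1 i (gs ! (q - 1))"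
  let ?xs = "map (\<lambda>q. (i, q)) [1..<Suc k]"
  let ?Z = "\<lambda>x \<omega>. real (\<omega> x) \<le> ?t (snd x)"
  have ind: "prob_space.indep_vars (measure_pmf scen_pmf) (\<lambda>_. count_space UNIV) (\<lambda>x \<omega>. \<omega> x) ?J"
    unfolding scen_pmf_def by (rule indep_vars_Pi_pmf) simp
  have ind2: "prob_space.indep_vars (measure_pmf scen_pmf) (\<lambda>_. count_space UNIV) ?Z (set ?xs)"
    by (rule prob_space.indep_vars_compose2[OF measure_pmf.prob_space_axioms
          prob_space.indep_vars_subset[OF measure_pmf.prob_space_axioms ind]]) (use i in auto)
  have "measure_pmf.expectation scen_pmf (\<lambda>\<omega>. f (\<Sum>x\<in>set ?xs. of_bool (?Z x \<omega>))) =
      pb (map (\<lambda>x. est1 C z1 i (gs ! (snd x - 1))) ?xs) f"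
  proof (rule prob_space.expectation_pb[OF measure_pmf.prob_space_axioms ind2])
    fix x assume "x \<in> set ?xs"
    then obtain q where "x = (i, q)" "q \<in> {1..k}" by auto
    then show "measure_pmf.expectation scen_pmf (\<lambda>\<omega>. of_bool (?Z x \<omega>)) = est1 C z1 i (gs ! (snd x - 1))"
      using scen_marginal[OF i, of q z1 "gs ! (q - 1)"] by (simp add: scen_pmf_sum plug_correct_def)
  qed (simp add: distinct_map inj_on_def)
  moreover have "map (\<lambda>x. est1 C z1 i (gs ! (snd x - 1))) ?xs = map (est1 C z1 i) gs"
    using gs by (intro nth_equalityI) (auto simp del: upt_Suc)
  moreover have "(\<Sum>x\<in>set ?xs. of_bool (?Z x \<omega>) :: nat) = (\<Sum>q=1..k. of_bool (real (\<omega> (i, q)) \<le> ?t q))" for \<omega>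
  proof -
    have "set ?xs = Pair i ` {1..k}" by auto
    moreover have "inj_on (Pair i) {1..k}" by (simp add: inj_on_def)
    ultimately show ?thesis by (simp only: sum.reindex o_def snd_conv)
  qed
  ultimately show ?thesis by (simp only: scen_pmf_sum)
qed

end

section \<open>Coverage of portfolio sizes\<close>

locale workflow_setting =
  fixes P :: "'g problem" and C :: "'g config" and h :: "real \<Rightarrow> real" and \<rho> :: real
  assumes tasks: "tasks P \<ge> 1"
    and Kmax: "Kmax P \<ge> 1"
    and workflows: "finite (workflows P)"
    and acc: "\<And>i g. i \<in> {1..tasks P} \<Longrightarrow> g \<in> workflows P \<Longrightarrow> 0 \<le> acc P i g \<and> acc P i g \<le> 1"
    and cost: "\<And>g. g \<in> workflows P \<Longrightarrow> 0 \<le> cost P g \<and> cost P g \<le> cmax C"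
    and price: "price P \<ge> 0"
    and h_mono: "mono_on {0..1} h"
    and h_concave: "concave_on {0..1} h"
    and h_ends: "h 0 = 0" "h 1 = 1"
    and curve: "\<And>k r. k \<in> {1..Kmax P} \<Longrightarrow> r \<le> k \<Longrightarrow> curve P k r = h (real r / real k)"
    and grid: "grid C \<subseteq> {1..Kmax P}"
    and coverage: "\<rho> \<ge> 1"
      "\<And>k. k \<in> {1..Kmax P} \<Longrightarrow> \<exists>b\<in>grid C. b \<le> k \<and> real k \<le> \<rho> * real b"
    and init_pool: "init_pool C \<subseteq> workflows P"
    and baseline: "baseline C \<in> candidates P C (init_pool C)"
      "stoch_value P (baseline C) \<ge> lower_bound C" "lower_bound C > 0"
    and sizes: "panel1 C \<ge> 1" "panel2 C \<ge> 1" "batch_size C \<ge> 1"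
    and delta1: "0 < delta1 C" "delta1 C < 1"
    and delta2: "0 < delta2 C" "delta2 C < 1"
    and eps_ell: "eps_ell C > 0"
begin

lemma h_scale:
  assumes "x \<in> {0..1}" "t \<in> {0..1}"
  shows "t * h x \<le> h (t * x)"
  using concave_onD[OF h_concave, of t 0 x] assms h_ends by simp

lemma recovery_curve:
  assumes k: "k \<in> {1..Kmax P}"
  shows "recovery_curve (curve P k) k"
proof
  show "1 \<le> k" "curve P k 0 = 0" "curve P k k = 1" using k curve h_ends by auto
  show "curve P k r \<le> curve P k (Suc r)" if "r < k" for r
    using that k by (auto simp: curve divide_right_mono intro!: mono_onD[OF h_mono])
  show "curve P k (Suc (Suc r)) - curve P k (Suc r) \<le> curve P k (Suc r) - curve P k r"
    if "Suc r < k" for r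
  proof -
    have "(1 - 1/2) * h (real r / real k) + 1/2 * h (real (Suc (Suc r)) / real k)
        \<le> h ((1 - 1/2) * (real r / real k) + 1/2 * (real (Suc (Suc r)) / real k))"
      using concave_onD[OF h_concave, of "1/2" "real r / real k" "real (Suc (Suc r)) / real k"] that by simp
    also have "(1 - 1/2) * (real r / real k) + 1/2 * (real (Suc (Suc r)) / real k) = real (Suc r) / real k"
      using that by (simp add: field_simps)
    finally show ?thesis using that k by (simp add: curve)
  qed
qed

lemma increment_eq:
  assumes k: "k \<in> {1..Kmax P}"
  shows "increment P k 1 = recovery_curve.inc (curve P k) 0"
    and "increment P k k = recovery_curve.inc (curve P k) (k - 1)"
  using k recovery_curve.inc_def[OF recovery_curve[OF k]] by (auto simp: increment_def)

text \<open>The pointwise inequality behind the deletion argument. Concavity with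
  \<open>h 0 = 0\<close> gives \<open>(r / R) * h (R / k) \<le> h (r / k)\<close>, and the smaller
  size only increases the argument. Taking \<open>r = R - 1\<close> and \<open>r = R\<close> with
  weights \<open>R\<close> and \<open>k - R\<close> gives the total factor
  \<open>k - 1\<close>.\<close>

lemma curve_drop:
  assumes k: "k \<in> {2..Kmax P}" and R: "R \<le> k"
  shows "(real k - 1) * curve P k R \<le>
    real R * curve P (k - 1) (R - 1) + (real k - real R) * curve P (k - 1) R"
proof -
  have k1: "k - 1 \<in> {1..Kmax P}" using k by auto
  have ge: "real r / real R * curve P k R \<le> curve P (k - 1) r" if "r \<le> k - 1" "r \<le> R" "R > 0" for r
  proof -
    have "real r / real R * h (real R / real k) \<le> h (real r / real R * (real R / real k))"
      using that R k by (intro h_scale) auto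
    also have "\<dots> \<le> h (real r / real (k - 1))"
      using that R k by (intro mono_onD[OF h_mono]) (auto simp: frac_le)
    finally have "real r / real R * h (real R / real k) \<le> h (real r / real (k - 1))" .
    then show ?thesis using that R k k1 by (simp add: curve)
  qed
  \<comment> \<open>For \<open>R = k\<close> the curve of size \<open>k - 1\<close> would be read
    outside its range, but there the coefficient \<open>k - R\<close> is 0.\<close>
  consider "R = 0" | "R > 0" "R = k" | "R > 0" "R \<le> k - 1" using R by linarith
  then show ?thesis
  proof cases
    case 1
    then show ?thesis using k k1 h_ends by (simp add: curve)
  next
    case 2
    then show ?thesis using ge[of "k - 1"] k by (simp add: field_simps of_nat_diff)
  next
    case 3
    have "(real R - 1) * curve P k R \<le> real R * curve P (k - 1) (R - 1)"
      using ge[of "R - 1"] 3 by (simp add: field_simps of_nat_diff)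
    moreover have "(real k - real R) * curve P k R \<le> (real k - real R) * curve P (k - 1) R"
      using ge[of R] 3 by (intro mult_left_mono) auto
    ultimately show ?thesis by (simp add: algebra_simps)
  qed
qed

text \<open>Averaging over all deletions: the expected recovery keeps a fraction
  \<open>(k - 1) / k\<close> by \<open>curve_drop\<close>, and the cost keeps exactly this fraction
  because each execution survives \<open>k - 1\<close> of the \<open>k\<close> deletions. Some
  deletion is at least as good as the average.\<close>

lemma value_drop:
  assumes gs: "set gs \<subseteq> workflows P" and k: "length gs \<in> {2..Kmax P}"
  shows "\<exists>gs'. set gs' \<subseteq> workflows P \<and> length gs' = length gs - 1 \<and>
    (real (length gs) - 1) / real (length gs) * list_value P (acc P) gs \<le> list_value P (acc P) gs'"
proof (rule ccontr)
  define k where "k = length gs"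
  have k2: "k \<in> {2..Kmax P}" using k by (simp add: k_def)
  define V where "V = list_value P (acc P) gs"
  assume "\<not> ?thesis"
  then have less: "list_value P (acc P) (drop_nth j gs) < (real k - 1) / real k * V" if "j < k" for j
    using that gs set_drop_nth[of j gs] length_drop_nth[of j gs]
    unfolding k_def V_def by (meson not_le order.trans)
  have "(\<Sum>j<k. list_value P (acc P) (drop_nth j gs)) < (\<Sum>j<k. (real k - 1) / real k * V)"
    using less k2 by (intro sum_strict_mono) (auto simp: lessThan_empty_iff)
  also have "\<dots> = (real k - 1) * V" using k2 by simp
  finally have lt: "(\<Sum>j<k. list_value P (acc P) (drop_nth j gs)) < (real k - 1) * V" .
  define n where "n = real (tasks P)"
  have n: "n > 0" using tasks by (simp add: n_def)
  have probs: "set (map (acc P i) gs) \<subseteq> {0..1}" if "i \<in> {1..tasks P}" for i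
    using gs acc that by auto
  have cov: "(real k - 1) * pb (map (acc P i) gs) (curve P k) \<le>
      (\<Sum>j<k. pb (drop_nth j (map (acc P i) gs)) (curve P (k - 1)))" if "i \<in> {1..tasks P}" for i
  proof -
    have "(real k - 1) * pb (map (acc P i) gs) (curve P k) =
        pb (map (acc P i) gs) (\<lambda>r. (real k - 1) * curve P k r)" by (simp add: pb_cmult)
    also have "\<dots> \<le> pb (map (acc P i) gs) (\<lambda>r. real r * curve P (k - 1) (r - 1)
        + (real (length (map (acc P i) gs)) - real r) * curve P (k - 1) r)"
      using curve_drop[OF k2] by (intro pb_mono probs that) (simp_all add: k_def)
    also have "\<dots> = (\<Sum>j<k. pb (drop_nth j (map (acc P i) gs)) (curve P (k - 1)))"
      unfolding sum_pb_drop_nth[symmetric] by (simp add: k_def)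
    finally show ?thesis .
  qed
  have "(\<Sum>j<k. list_value P (acc P) (drop_nth j gs)) =
      (\<Sum>j<k. (\<Sum>i=1..tasks P. pb (drop_nth j (map (acc P i) gs)) (curve P (k - 1))) / n
        - price P * sum_list (drop_nth j (map (cost P) gs)))"
    by (rule sum.cong) (simp_all add: list_value_def map_drop_nth length_drop_nth k_def n_def)
  also have "\<dots> = (\<Sum>i=1..tasks P. \<Sum>j<k. pb (drop_nth j (map (acc P i) gs)) (curve P (k - 1))) / n
        - price P * ((real k - 1) * sum_list (map (cost P) gs))"
  proof -
    have "(\<Sum>j<k. \<Sum>i=1..tasks P. pb (drop_nth j (map (acc P i) gs)) (curve P (k - 1))) =
        (\<Sum>i=1..tasks P. \<Sum>j<k. pb (drop_nth j (map (acc P i) gs)) (curve P (k - 1)))"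
      by (rule sum.swap)
    moreover have "(\<Sum>j<k. sum_list (drop_nth j (map (cost P) gs))) = (real k - 1) * sum_list (map (cost P) gs)"
      using sum_sum_list_drop_nth[of "map (cost P) gs"] by (simp add: k_def)
    ultimately show ?thesis
      by (simp only: sum_subtractf sum_divide_distrib[symmetric] sum_distrib_left[symmetric])
  qed
  also have "\<dots> \<ge> (\<Sum>i=1..tasks P. (real k - 1) * pb (map (acc P i) gs) (curve P k)) / n
        - price P * ((real k - 1) * sum_list (map (cost P) gs))"
    using n cov by (intro diff_right_mono divide_right_mono sum_mono) auto
  also have "(\<Sum>i=1..tasks P. (real k - 1) * pb (map (acc P i) gs) (curve P k)) / n
        - price P * ((real k - 1) * sum_list (map (cost P) gs)) = (real k - 1) * V"
    by (simp add: V_def list_value_def k_def n_def sum_distrib_left[symmetric] right_diff_distrib)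
  finally show False using lt by simp
qed

text \<open>The fractions kept by successive deletions telescope.\<close>

lemma value_shrink:
  assumes "set gs \<subseteq> workflows P" "length gs \<le> Kmax P" "1 \<le> b" "b \<le> length gs"
  shows "\<exists>gs'. set gs' \<subseteq> workflows P \<and> length gs' = b \<and>
    real b / real (length gs) * list_value P (acc P) gs \<le> list_value P (acc P) gs'"
  using assms(4,3)
proof (induction b rule: inc_induct)
  case base
  show ?case using assms by (intro exI[of _ gs]) auto
next
  case (step b)
  then obtain gs' where gs': "set gs' \<subseteq> workflows P" "length gs' = Suc b"
    "real (Suc b) / real (length gs) * list_value P (acc P) gs \<le> list_value P (acc P) gs'" by auto
  obtain gs'' where gs'': "set gs'' \<subseteq> workflows P" "length gs'' = b"
    "real b / real (Suc b) * list_value P (acc P) gs' \<le> list_value P (acc P) gs''"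
    using value_drop[OF gs'(1)] gs'(2) step assms by auto
  have "real b / real (length gs) * list_value P (acc P) gs =
      real b / real (Suc b) * (real (Suc b) / real (length gs) * list_value P (acc P) gs)" by simp
  also have "\<dots> \<le> real b / real (Suc b) * list_value P (acc P) gs'"
    using gs'(3) by (intro mult_left_mono) auto
  finally show ?case using gs'' by (intro exI[of _ gs'']) auto
qed

lemma stoch_value_count_list':
  "set gs \<subseteq> workflows P \<Longrightarrow> gs \<noteq> [] \<Longrightarrow> stoch_value P (count_list gs) = list_value P (acc P) gs"
  by (rule stoch_value_count_list[OF workflows _ _ acc])

lemma finite_sized_counts:
  assumes "finite S" "S \<subseteq> workflows P"
  shows "finite {m \<in> counts_on S. size_of P m \<le> K}"
proof (rule finite_subset)
  show "{m \<in> counts_on S. size_of P m \<le> K} \<subseteq> count_list ` {gs. set gs \<subseteq> S \<and> length gs \<le> K}"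
  proof
    fix m assume m: "m \<in> {m \<in> counts_on S. size_of P m \<le> K}"
    then obtain gs where gs: "set gs \<subseteq> S" "m = count_list gs"
      using counts_on_count_list[OF assms(1)] by blast
    then have "length gs \<le> K" using m assms workflows by (simp add: size_of_count_list)
    then show "m \<in> count_list ` {gs. set gs \<subseteq> S \<and> length gs \<le> K}" using gs by auto
  qed
qed (use assms finite_lists_length_le[of S K] in auto)

text \<open>Positivity of the lower bound rules out the zero vector; this is what makes the pool and
  the grid nonempty and the optimum positive.\<close>

lemma baseline_props:
  "baseline C \<in> counts_on (init_pool C)" "size_of P (baseline C) \<in> grid C" "init_pool C \<noteq> {}"
  "lower_bound C \<le> stoch_opt P"
proof -
  have nz: "baseline C \<noteq> (\<lambda>_. 0)" using baseline by (auto simp: stoch_value_def)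
  then show bl: "baseline C \<in> counts_on (init_pool C)" "size_of P (baseline C) \<in> grid C"
    using baseline(1) by (auto simp: candidates_def)
  with nz show "init_pool C \<noteq> {}" by (auto simp: counts_on_def)
  have "baseline C \<in> {m \<in> counts_on (workflows P). size_of P m \<le> Kmax P}"
    using bl init_pool grid by (fastforce simp: counts_on_def)
  then have "stoch_value P (baseline C) \<le> stoch_opt P"
    unfolding stoch_opt_def using finite_sized_counts[OF workflows order.refl, of "Kmax P"] by (intro Max_ge) auto
  then show "lower_bound C \<le> stoch_opt P" using baseline by simp
qed

lemma workflows_nonempty: "workflows P \<noteq> {}"
  using baseline_props init_pool by auto

lemma cmax_nonneg: "0 \<le> cmax C"
  using workflows_nonempty cost by fastforce

lemma finite_grid: "finite (grid C)"
  using grid by (rule finite_subset) simp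

lemma grid_nonempty: "grid C \<noteq> {}"
  using baseline_props by auto

lemma covering_portfolio:
  obtains k gs where "k \<in> grid C" "set gs \<subseteq> workflows P" "length gs = k"
    "1 / \<rho> * stoch_opt P \<le> list_value P (acc P) gs"
proof -
  have "stoch_opt P \<in> stoch_value P ` {m \<in> counts_on (workflows P). size_of P m \<le> Kmax P}"
    unfolding stoch_opt_def
  proof (rule Max_in)
    show "finite (stoch_value P ` {m \<in> counts_on (workflows P). size_of P m \<le> Kmax P})"
      using finite_sized_counts[OF workflows] by simp
    have "(\<lambda>_. 0) \<in> {m \<in> counts_on (workflows P). size_of P m \<le> Kmax P}"
      by (simp add: counts_on_def size_of_def)
    then show "stoch_value P ` {m \<in> counts_on (workflows P). size_of P m \<le> Kmax P} \<noteq> {}" by blast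
  qed
  then obtain m where m: "m \<in> counts_on (workflows P)" "size_of P m \<le> Kmax P" "stoch_opt P = stoch_value P m"
    by auto
  obtain gs where gs: "set gs \<subseteq> workflows P" "m = count_list gs"
    using counts_on_count_list[OF workflows m(1)] by blast
  \<comment> \<open>Positivity is used twice: an optimal vector is not the zero vector, and the
    optimum may be multiplied by the estimate of the covering ratio.\<close>
  have pos: "0 < stoch_opt P" using baseline_props(4) baseline(3) by simp
  then have "gs \<noteq> []" using m gs by (auto simp: stoch_value_def count_list_eq_0_iff)
  have len: "length gs \<in> {1..Kmax P}"
    using m gs \<open>gs \<noteq> []\<close> workflows by (simp add: size_of_count_list Suc_le_eq)
  then obtain b where b: "b \<in> grid C" "b \<le> length gs" "real (length gs) \<le> \<rho> * real b"
    using coverage by blast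
  have "1 \<le> b" using b grid by auto
  then obtain gs' where gs': "set gs' \<subseteq> workflows P" "length gs' = b"
    "real b / real (length gs) * list_value P (acc P) gs \<le> list_value P (acc P) gs'"
    using value_shrink[OF gs(1)] len b by auto
  have val: "stoch_opt P = list_value P (acc P) gs"
    using m gs \<open>gs \<noteq> []\<close> by (simp add: stoch_value_count_list')
  have "1 / \<rho> \<le> real b / real (length gs)"
  proof -
    have "0 < real (length gs)" "0 < \<rho>" using len coverage(1) by auto
    with b show ?thesis by (simp add: field_simps)
  qed
  then have "1 / \<rho> * stoch_opt P \<le> real b / real (length gs) * stoch_opt P"
    using pos by (intro mult_right_mono) auto
  then show thesis using that[OF b(1) gs'(1,2)] gs'(3) val by simp
qed

text \<open>The costs cancel. The two bounds in the minimum come from the range of the curve and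
  from changing at most \<open>Kmax P\<close> success probabilities.\<close>

lemma list_value_perturb:
  assumes gs: "set gs \<subseteq> workflows P" "length gs \<in> {1..Kmax P}"
    and a: "\<And>i g. i \<in> {1..tasks P} \<Longrightarrow> g \<in> workflows P \<Longrightarrow> a i g \<in> {0..1} \<and> \<bar>a i g - acc P i g\<bar> \<le> e"
  shows "\<bar>list_value P a gs - list_value P (acc P) gs\<bar> \<le> min 1 (real (Kmax P) * e)"
proof -
  define k where "k = length gs"
  interpret curve: recovery_curve "curve P k" k by (rule recovery_curve) (use gs k_def in simp)
  have n: "real (tasks P) > 0" using tasks by simp
  have e: "0 \<le> e"
    using a[of 1] tasks workflows_nonempty by (fastforce intro: order.trans[OF abs_ge_zero])
  have probs: "set (map (acc P i) gs) \<subseteq> {0..1}" "set (map (a i) gs) \<subseteq> {0..1}" if "i \<in> {1..tasks P}" for i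
    using gs acc a that by auto
  have one: "\<bar>pb (map (a i) gs) (curve P k) - pb (map (acc P i) gs) (curve P k)\<bar> \<le> min 1 (real (Kmax P) * e)"
    if i: "i \<in> {1..tasks P}" for i
  proof (rule min.boundedI)
    have "pb (map (a i) gs) (curve P k) \<in> {0..1}" "pb (map (acc P i) gs) (curve P k) \<in> {0..1}"
      using curve.psi_range by (intro pb_bounds probs[OF i]; simp add: k_def)+
    then show "\<bar>pb (map (a i) gs) (curve P k) - pb (map (acc P i) gs) (curve P k)\<bar> \<le> 1" by auto
    have "\<bar>pb (map (a i) gs) (curve P k) - pb (map (acc P i) gs) (curve P k)\<bar> \<le> real (length (map (a i) gs)) * e"
    proof (rule pb_lipschitz[OF probs(2)[OF i] probs(1)[OF i]])
      fix r assume "r < length (map (a i) gs)"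
      then have r: "r < k" by (simp add: k_def)
      then show "\<bar>curve P k (Suc r) - curve P k r\<bar> \<le> 1"
        using curve.mono[OF r] curve.psi_range[of r] curve.psi_range[of "Suc r"] by auto
    next
      fix j assume "j < length (map (a i) gs)"
      moreover from this have "gs ! j \<in> workflows P" using gs nth_mem[of j gs] by auto
      ultimately show "\<bar>map (a i) gs ! j - map (acc P i) gs ! j\<bar> \<le> e"
        using a[OF i, of "gs ! j"] by simp
    qed simp
    also have "\<dots> \<le> real (Kmax P) * e" using e gs by (intro mult_right_mono) auto
    finally show "\<bar>pb (map (a i) gs) (curve P k) - pb (map (acc P i) gs) (curve P k)\<bar> \<le> real (Kmax P) * e" .
  qed
  have "list_value P a gs - list_value P (acc P) gs =
      (\<Sum>i=1..tasks P. pb (map (a i) gs) (curve P k) - pb (map (acc P i) gs) (curve P k)) / real (tasks P)"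
    by (simp add: list_value_def k_def sum_subtractf diff_divide_distrib)
  also have "\<bar>\<dots>\<bar> \<le> (\<Sum>i=1..tasks P. min 1 (real (Kmax P) * e)) / real (tasks P)"
    unfolding abs_divide using n one e
    by (intro frac_le order.trans[OF sum_abs] sum_mono) (auto intro!: mult_nonneg_nonneg)
  also have "\<dots> = min 1 (real (Kmax P) * e)" using n by simp
  finally show ?thesis .
qed

end

section \<open>The plug-in epigraph dual\<close>

lemma dvars_eq: "dvars P C k = (\<lambda>(i, \<omega>). Mu i \<omega>) ` ({1..tasks P} \<times> scenarios P C k)
    \<union> (\<lambda>(i, \<omega>). Xi i \<omega>) ` ({1..tasks P} \<times> scenarios P C k) \<union> Th ` {1..k}"
  by (auto simp: dvars_def)

lemma finite_dvars: "finite (dvars P C k)"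
  unfolding dvars_eq using finite_scenarios[of P C k] by auto

lemma sum_dvars: "(\<Sum>v\<in>dvars P C k. g v) =
    (\<Sum>i=1..tasks P. \<Sum>\<omega>\<in>scenarios P C k. g (Mu i \<omega>))
    + (\<Sum>i=1..tasks P. \<Sum>\<omega>\<in>scenarios P C k. g (Xi i \<omega>)) + (\<Sum>q=1..k. g (Th q))"
proof -
  have "(\<Sum>v\<in>dvars P C k. g v) = sum g ((\<lambda>(i, \<omega>). Mu i \<omega>) ` ({1..tasks P} \<times> scenarios P C k))
      + sum g ((\<lambda>(i, \<omega>). Xi i \<omega>) ` ({1..tasks P} \<times> scenarios P C k)) + sum g (Th ` {1..k})"
    unfolding dvars_eq using finite_scenarios[of P C k]
    by (subst sum.union_disjoint, simp, simp, force, subst sum.union_disjoint) auto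
  also have "sum g ((\<lambda>(i, \<omega>). Mu i \<omega>) ` ({1..tasks P} \<times> scenarios P C k)) =
      (\<Sum>i=1..tasks P. \<Sum>\<omega>\<in>scenarios P C k. g (Mu i \<omega>))"
    by (subst sum.reindex) (auto simp: inj_on_def sum.cartesian_product case_prod_unfold)
  also have "sum g ((\<lambda>(i, \<omega>). Xi i \<omega>) ` ({1..tasks P} \<times> scenarios P C k)) =
      (\<Sum>i=1..tasks P. \<Sum>\<omega>\<in>scenarios P C k. g (Xi i \<omega>))"
    by (subst sum.reindex) (auto simp: inj_on_def sum.cartesian_product case_prod_unfold)
  also have "sum g (Th ` {1..k}) = (\<Sum>q=1..k. g (Th q))"
    by (subst sum.reindex) (auto simp: inj_on_def)
  finally show ?thesis .
qed

lemma sum_swap3: "(\<Sum>a\<in>A. \<Sum>b\<in>B. \<Sum>c\<in>D. F a b c) = (\<Sum>c\<in>D. \<Sum>b\<in>B. \<Sum>a\<in>A. F a b c)"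
proof -
  have "(\<Sum>a\<in>A. \<Sum>b\<in>B. \<Sum>c\<in>D. F a b c) = (\<Sum>a\<in>A. \<Sum>c\<in>D. \<Sum>b\<in>B. F a b c)"
    by (intro sum.cong refl sum.swap)
  also have "\<dots> = (\<Sum>c\<in>D. \<Sum>a\<in>A. \<Sum>b\<in>B. F a b c)" by (rule sum.swap)
  also have "\<dots> = (\<Sum>c\<in>D. \<Sum>b\<in>B. \<Sum>a\<in>A. F a b c)"
    by (intro sum.cong refl sum.swap)
  finally show ?thesis .
qed

lemma dot_unit: "finite I \<Longrightarrow> v \<in> I \<Longrightarrow> dot I (unit v) y = y v"
  by (simp add: dot_def unit_def of_bool_def if_distrib if_distribR cong: if_cong)

lemma dot_lin2: "dot I a (\<lambda>v. x * y v + t * z v) = x * dot I a y + t * dot I a z"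
  by (simp add: dot_def sum.distrib sum_distrib_left algebra_simps)

lemma violated_iff: "violated I y (a, b) \<longleftrightarrow> b < dot I a y"
  by (simp add: violated_def dot_def)

definition explicit_ok :: "'g problem \<Rightarrow> 'g config \<Rightarrow> nat \<Rightarrow> point \<Rightarrow> bool" where
  "explicit_ok P C k y \<longleftrightarrow> (\<forall>c\<in>explicit_constraints P C k. \<not> violated (dvars P C k) y c)"

lemma explicit_ok_iff: "explicit_ok P C k y \<longleftrightarrow>
    (\<forall>i\<in>{1..tasks P}. \<forall>\<omega>\<in>scenarios P C k.
      (\<forall>r\<le>k. curve P k r / real (tasks P) \<le> y (Xi i \<omega>) + real r * y (Mu i \<omega>))
      \<and> 0 \<le> y (Mu i \<omega>) \<and> y (Mu i \<omega>) \<le> increment P k 1 / real (tasks P)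
      \<and> 0 \<le> y (Xi i \<omega>) \<and> y (Xi i \<omega>) \<le> 1 / real (tasks P))
    \<and> (\<forall>q\<in>{1..k}. - (price P * cmax C) \<le> y (Th q) \<and> y (Th q) \<le> increment P k 1)"
proof -
  let ?I = "dvars P C k"
  have d: "dot ?I (unit v) y = y v" "dot ?I (\<lambda>w. - unit v w) y = - y v" if "v \<in> ?I" for v
    using dot_unit[OF finite_dvars that, of y] by (simp_all add: dot_def sum_negf)
  have mem: "Mu i \<omega> \<in> ?I" "Xi i \<omega> \<in> ?I" if "i \<in> {1..tasks P}" "\<omega> \<in> scenarios P C k" for i \<omega>
    using that by (auto simp: dvars_def)
  have memq: "Th q \<in> ?I" if "q \<in> {1..k}" for q using that by (auto simp: dvars_def)
  have two: "dot ?I (\<lambda>v. - unit (Xi i \<omega>) v - real r * unit (Mu i \<omega>) v) y = - y (Xi i \<omega>) - real r * y (Mu i \<omega>)"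
    if "i \<in> {1..tasks P}" "\<omega> \<in> scenarios P C k" for i \<omega> r
    using dot_lin[of ?I "-1" "unit (Xi i \<omega>)" "- real r" "unit (Mu i \<omega>)" y] d(1)[OF mem(1)[OF that]] d(1)[OF mem(2)[OF that]]
    by simp
  have lines: "(\<forall>c\<in>{(\<lambda>v. - unit (Xi i \<omega>) v - real r * unit (Mu i \<omega>) v, - curve P k r / real (tasks P)) | r. r \<le> k}.
      \<not> violated ?I y c) \<longleftrightarrow> (\<forall>r\<le>k. curve P k r / real (tasks P) \<le> y (Xi i \<omega>) + real r * y (Mu i \<omega>))"
    if "i \<in> {1..tasks P}" "\<omega> \<in> scenarios P C k" for i \<omega>
    unfolding setcompr_eq_image ball_simps by (auto simp: violated_iff two[OF that])
  show ?thesis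
    unfolding explicit_ok_def explicit_constraints_def ball_Un ball_UN
    by (rule arg_cong2[where f = "(\<and>)"]; intro ball_cong refl; (simp only: lines)?)
       (auto simp: violated_iff d mem memq not_less)
qed

text \<open>A central cut divides by the form at its normal, which is positive only for a nonzero
  normal.\<close>

lemma explicit_normal_nonzero:
  assumes "(a, b) \<in> explicit_constraints P C k"
  shows "\<exists>v\<in>dvars P C k. a v \<noteq> 0"
proof -
  have un: "unit v v = 1" "unit (Mu i \<omega>) (Xi i \<omega>) = 0" for v i \<omega> by (simp_all add: unit_def)
  from assms show ?thesis unfolding explicit_constraints_def
  proof (elim UnE UN_E)
    fix i \<omega>
    assume i: "i \<in> {1..tasks P}" "\<omega> \<in> scenarios P C k"
      and "(a, b) \<in> {(\<lambda>v. - unit (Xi i \<omega>) v - real r * unit (Mu i \<omega>) v, - curve P k r / real (tasks P)) | r. r \<le> k}"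
    then obtain r where "a = (\<lambda>v. - unit (Xi i \<omega>) v - real r * unit (Mu i \<omega>) v)" by auto
    then show ?thesis using i by (intro bexI[of _ "Xi i \<omega>"]) (auto simp: un dvars_def)
  next
    fix i \<omega>
    assume i: "i \<in> {1..tasks P}" "\<omega> \<in> scenarios P C k"
      and "(a, b) \<in> {(\<lambda>v. - unit (Mu i \<omega>) v, 0), (unit (Mu i \<omega>), increment P k 1 / real (tasks P)),
           (\<lambda>v. - unit (Xi i \<omega>) v, 0), (unit (Xi i \<omega>), 1 / real (tasks P))}"
    then have "a (Mu i \<omega>) \<noteq> 0 \<or> a (Xi i \<omega>) \<noteq> 0" by (auto simp: un)
    then show ?thesis using i by (auto simp: dvars_def)
  next
    fix q
    assume "q \<in> {1..k}"
      and "(a, b) \<in> {(\<lambda>v. - unit (Th q) v, price P * cmax C), (unit (Th q), increment P k 1)}"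
    then show ?thesis by (intro bexI[of _ "Th q"]) (auto simp: un dvars_def)
  qed
qed

lemma dot_objective: "dot (dvars P C k) (objective_normal P C k) y =
    (\<Sum>i=1..tasks P. \<Sum>\<omega>\<in>scenarios P C k. scen_prob P C k * y (Xi i \<omega>)) + (\<Sum>q=1..k. y (Th q))"
  unfolding dot_def sum_dvars by (simp add: objective_normal_def)

lemma dot_workflow:
  assumes "q \<in> {1..k}"
  shows "dot (dvars P C k) (workflow_normal P C z1 k q g) y =
    score P C z1 k q (\<lambda>i \<omega>. y (Mu i \<omega>)) g + price P * cost P g - y (Th q)"
proof -
  have "(\<Sum>q'=1..k. - of_bool (q' = q) * y (Th q')) = - y (Th q)"
    using assms by (simp add: of_bool_def if_distrib if_distribR sum_negf cong: if_cong)
  moreover have "(\<Sum>i=1..tasks P. \<Sum>\<omega>\<in>scenarios P C k. scen_prob P C k * plug_correct C z1 i g q \<omega> * y (Mu i \<omega>)) =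
      (\<Sum>\<omega>\<in>scenarios P C k. scen_prob P C k * (\<Sum>i=1..tasks P. y (Mu i \<omega>) * plug_correct C z1 i g q \<omega>))"
    by (subst sum.swap) (simp add: sum_distrib_left mult_ac)
  ultimately show ?thesis
    unfolding dot_def sum_dvars by (simp add: workflow_normal_def score_def)
qed

lemma workflow_normal_nonzero: "q \<in> {1..k} \<Longrightarrow> \<exists>v\<in>dvars P C k. workflow_normal P C z1 k q g v \<noteq> 0"
  by (rule bexI[of _ "Th q"]) (auto simp: workflow_normal_def dvars_def)

lemma objective_normal_nonzero: "k \<ge> 1 \<Longrightarrow> \<exists>v\<in>dvars P C k. objective_normal P C k v \<noteq> 0"
  by (rule bexI[of _ "Th 1"]) (auto simp: objective_normal_def dvars_def)

definition feasible :: "'g problem \<Rightarrow> 'g config \<Rightarrow> (nat \<times> 'g \<times> nat \<Rightarrow> bool) \<Rightarrow> nat \<Rightarrow> 'g set \<Rightarrow> point \<Rightarrow> bool" where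
  "feasible P C z1 k S y \<longleftrightarrow> explicit_ok P C k y \<and>
    (\<forall>q\<in>{1..k}. \<forall>g\<in>S. score P C z1 k q (\<lambda>i \<omega>. y (Mu i \<omega>)) g \<le> y (Th q))"

lemma feasible_iff: "feasible P C z1 k S y \<longleftrightarrow>
    (\<forall>(a, b)\<in>explicit_constraints P C k. dot (dvars P C k) a y \<le> b) \<and>
    (\<forall>q\<in>{1..k}. \<forall>g\<in>S. dot (dvars P C k) (workflow_normal P C z1 k q g) y \<le> price P * cost P g)"
  unfolding feasible_def explicit_ok_def
  by (auto simp: dot_workflow violated_iff not_less)

lemma feasible_convex:
  assumes "feasible P C z1 k S y" "feasible P C z1 k S z" "0 \<le> t" "t \<le> 1"
  shows "feasible P C z1 k S (\<lambda>v. (1 - t) * y v + t * z v)"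
proof -
  have "dot (dvars P C k) a (\<lambda>v. (1 - t) * y v + t * z v) \<le> b"
    if "dot (dvars P C k) a y \<le> b" "dot (dvars P C k) a z \<le> b" for a b
    unfolding dot_lin2 using convex_bound_le[OF that, of "1 - t" t] assms(3,4) by simp
  then show ?thesis using assms(1,2) unfolding feasible_iff by blast
qed

section \<open>Weak duality, rounding and the geometry of the dual\<close>

context workflow_setting
begin

abbreviation "obj k \<equiv> dot (dvars P C k) (objective_normal P C k)"

lemma card_dvars: "k \<ge> 1 \<Longrightarrow> card (dvars P C k) \<ge> 2"
proof -
  assume k: "k \<ge> 1"
  have "scenarios P C k \<noteq> {}" using card_scenarios[of P C k] sizes by fastforce
  then obtain \<omega> where "\<omega> \<in> scenarios P C k" by blast
  then have "{Mu 1 \<omega>, Th 1} \<subseteq> dvars P C k" using tasks k by (auto simp: dvars_def)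
  then have "card {Mu 1 \<omega>, Th 1} \<le> card (dvars P C k)" by (rule card_mono[OF finite_dvars])
  then show ?thesis by simp
qed

lemma scen_prob_pos: "0 < scen_prob P C k"
  using sizes by (simp add: scen_prob_def)

lemma sum_scen: "(\<Sum>\<omega>\<in>scenarios P C k. scen_prob P C k * c) = c"
  using sum_scen_prob[where P = P and C = C and k = k] sizes by (simp add: sum_distrib_right[symmetric])

context
  fixes k :: nat and z1 :: "nat \<times> 'g \<times> nat \<Rightarrow> bool"
  assumes k: "k \<in> grid C"
begin

lemma k_range: "k \<in> {1..Kmax P}"
  using k grid by auto

interpretation curve: recovery_curve "curve P k" k
  by (rule recovery_curve[OF k_range])

abbreviation "d1 \<equiv> increment P k 1"

lemma d1: "0 < d1" "d1 \<le> 1"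
proof -
  have "0 < real k * curve.inc 0" using curve.first_inc_ge by simp
  then show "0 < d1" unfolding increment_eq(1)[OF k_range] by (simp add: zero_less_mult_iff)
  show "d1 \<le> 1" unfolding increment_eq(1)[OF k_range] by (rule curve.first_inc_le)
qed

text \<open>The portfolio \<open>gs\<close> acts as an integral primal point that uses its
  \<open>q\<close>-th entry in column \<open>q\<close>. In each scenario its recovery is bounded by
  the explicit constraint at the number of correct columns; exchanging sums then yields one score
  per column, and the slack \<open>\<tau>\<close> is paid \<open>k\<close> times.\<close>

lemma weak_duality:
  assumes y: "explicit_ok P C k y"
    and sc: "\<And>q g. q \<in> {1..k} \<Longrightarrow> g \<in> workflows P \<Longrightarrow>
      score P C z1 k q (\<lambda>i \<omega>. y (Mu i \<omega>)) g \<le> y (Th q) + \<tau>"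
    and gs: "set gs \<subseteq> workflows P" "length gs = k"
  shows "list_value P (est1 C z1) gs \<le> obj k y + real k * \<tau>"
proof -
  define n where "n = real (tasks P)"
  define R where "R i \<omega> = (\<Sum>q=1..k. of_bool (real (\<omega> (i, q)) \<le> real (panel1 C) * est1 C z1 i (gs ! (q - 1))) :: nat)"
    for i and \<omega> :: scenario
  have R: "real (R i \<omega>) = (\<Sum>q=1..k. plug_correct C z1 i (gs ! (q - 1)) q \<omega>)" for i \<omega>
    by (simp add: R_def plug_correct_def)
  have Rk: "R i \<omega> \<le> k" for i \<omega>
  proof -
    have "R i \<omega> \<le> (\<Sum>q=1..k. 1)" unfolding R_def by (rule sum_mono) simp
    then show ?thesis by simp
  qed
  let ?p = "scen_prob P C k"
  have sp: "(\<Sum>\<omega>\<in>scenarios P C k. ?p * curve P k (R i \<omega>)) = pb (map (est1 C z1 i) gs) (curve P k)"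
    if "i \<in> {1..tasks P}" for i
    unfolding R_def by (rule scen_pb[OF sizes(1) that gs(2)])
  have "(\<Sum>i=1..tasks P. pb (map (est1 C z1 i) gs) (curve P k)) / n =
      (\<Sum>i=1..tasks P. (\<Sum>\<omega>\<in>scenarios P C k. ?p * curve P k (R i \<omega>)) / n)"
    by (simp add: sp sum_divide_distrib)
  also have "\<dots> = (\<Sum>i=1..tasks P. \<Sum>\<omega>\<in>scenarios P C k. ?p * (curve P k (R i \<omega>) / n))"
    by (simp add: sum_divide_distrib)
  also have "\<dots> \<le> (\<Sum>i=1..tasks P. \<Sum>\<omega>\<in>scenarios P C k. ?p * (y (Xi i \<omega>) + real (R i \<omega>) * y (Mu i \<omega>)))"
    using y Rk scen_prob_pos[of k] unfolding explicit_ok_iff n_def by (intro sum_mono mult_left_mono) auto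
  also have "\<dots> = (\<Sum>i=1..tasks P. \<Sum>\<omega>\<in>scenarios P C k. ?p * y (Xi i \<omega>))
      + (\<Sum>i=1..tasks P. \<Sum>\<omega>\<in>scenarios P C k. \<Sum>q=1..k. ?p * (y (Mu i \<omega>) * plug_correct C z1 i (gs ! (q - 1)) q \<omega>))"
    by (simp add: R distrib_left sum.distrib sum_distrib_left sum_distrib_right mult_ac)
  also have "(\<Sum>i=1..tasks P. \<Sum>\<omega>\<in>scenarios P C k. \<Sum>q=1..k. ?p * (y (Mu i \<omega>) * plug_correct C z1 i (gs ! (q - 1)) q \<omega>)) =
      (\<Sum>q=1..k. \<Sum>\<omega>\<in>scenarios P C k. \<Sum>i=1..tasks P. ?p * (y (Mu i \<omega>) * plug_correct C z1 i (gs ! (q - 1)) q \<omega>))"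
    by (rule sum_swap3)
  also have "\<dots> = (\<Sum>q=1..k. score P C z1 k q (\<lambda>i \<omega>. y (Mu i \<omega>)) (gs ! (q - 1)) + price P * cost P (gs ! (q - 1)))"
    by (simp add: score_def sum_distrib_left)
  also have "\<dots> \<le> (\<Sum>q=1..k. (y (Th q) + \<tau>) + price P * cost P (gs ! (q - 1)))"
  proof (intro sum_mono add_right_mono sc)
    fix q assume "q \<in> {1..k}"
    then have "gs ! (q - 1) \<in> set gs" using gs by (intro nth_mem) auto
    then show "gs ! (q - 1) \<in> workflows P" using gs by auto
  qed
  also have "\<dots> = (\<Sum>q=1..k. y (Th q)) + real k * \<tau> + price P * (\<Sum>q=1..k. cost P (gs ! (q - 1)))"
    by (simp add: sum.distrib sum_distrib_left)
  also have "(\<Sum>q=1..k. cost P (gs ! (q - 1))) = (\<Sum>j<k. cost P (gs ! j))"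
    by (rule sum.reindex_bij_witness[of _ Suc "\<lambda>q. q - 1"]) auto
  also have "\<dots> = sum_list (map (cost P) gs)"
    using gs by (simp add: sum_list_sum_nth atLeast0LessThan)
  finally show ?thesis
    unfolding list_value_def dot_objective by (simp add: gs n_def)
qed

text \<open>When the multipliers are the same in all scenarios, the scores depend only on the
  marginals \<open>est1\<close> and are equal in all columns. A single \<open>\<theta>\<close>
  therefore serves every column, and the dual bound becomes the premise of the greedy
  selection.\<close>

lemma dual_rounding:
  assumes S: "finite S" "S \<noteq> {}" "S \<subseteq> workflows P"
    and V: "\<And>y. feasible P C z1 k S y \<Longrightarrow> V \<le> obj k y"
  shows "\<exists>gs. set gs \<subseteq> S \<and> length gs = k \<and> V \<le> list_value P (est1 C z1) gs + curvature P k / exp 1"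
proof -
  define n where "n = tasks P"
  have n: "n \<ge> 1" using tasks by (simp add: n_def)
  have dual: "V \<le> (\<Sum>i=1..n. Max ((\<lambda>r. curve P k r / real n - real r * \<mu> i) ` {..k}))
      + real k * Max ((\<lambda>g. (\<Sum>i=1..n. \<mu> i * est1 C z1 i g) - price P * cost P g) ` S)"
    if \<mu>: "\<And>i. i \<in> {1..n} \<Longrightarrow> \<mu> i \<in> {0..curve.inc 0 / real n}" for \<mu>
  proof -
    define \<xi> where "\<xi> i = Max ((\<lambda>r. curve P k r / real n - real r * \<mu> i) ` {..k})" for i
    define \<theta> where "\<theta> = Max ((\<lambda>g. (\<Sum>i=1..n. \<mu> i * est1 C z1 i g) - price P * cost P g) ` S)"
    define y where "y v = (case v of Mu i \<omega> \<Rightarrow> \<mu> i | Xi i \<omega> \<Rightarrow> \<xi> i | Th q \<Rightarrow> \<theta>)" for v :: dvar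
    have y: "y (Mu i \<omega>) = \<mu> i" "y (Xi i \<omega>) = \<xi> i" "y (Th q) = \<theta>" for i \<omega> q
      by (simp_all add: y_def)
    have \<xi>: "curve P k r / real n \<le> \<xi> i + real r * \<mu> i" if "r \<le> k" for i r
    proof -
      have "curve P k r / real n - real r * \<mu> i \<le> \<xi> i" unfolding \<xi>_def using that by (intro Max_ge) auto
      then show ?thesis by simp
    qed
    have \<xi>0: "0 \<le> \<xi> i" for i using \<xi>[of 0 i] by (simp add: curve.zero)
    have \<xi>1: "\<xi> i \<le> 1 / real n" if "i \<in> {1..n}" for i
    proof -
      have "curve P k r / real n - real r * \<mu> i \<le> 1 / real n" if "r \<le> k" for r
      proof -
        have "0 \<le> real r * \<mu> i" using \<mu>[OF \<open>i \<in> {1..n}\<close>] by simp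
        moreover have "curve P k r / real n \<le> 1 / real n"
          using curve.psi_range[OF that] by (intro divide_right_mono) auto
        ultimately show ?thesis by linarith
      qed
      then show ?thesis unfolding \<xi>_def by (subst Max_le_iff) auto
    qed
    have sc: "score P C z1 k q (\<lambda>i \<omega>. y (Mu i \<omega>)) g = (\<Sum>i=1..n. \<mu> i * est1 C z1 i g) - price P * cost P g"
      if "q \<in> {1..k}" for q g
    proof -
      have "(\<Sum>\<omega>\<in>scenarios P C k. scen_prob P C k * (\<Sum>i=1..tasks P. \<mu> i * plug_correct C z1 i g q \<omega>)) =
          (\<Sum>i=1..tasks P. \<mu> i * (\<Sum>\<omega>\<in>scenarios P C k. scen_prob P C k * plug_correct C z1 i g q \<omega>))"
        by (simp only: sum_distrib_left mult.left_commute, rule sum.swap)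
      then show ?thesis
        using scen_marginal[OF sizes(1), where P = P and k = k] that by (simp add: score_def y n_def)
    qed
    have "score P C z1 k q (\<lambda>i \<omega>. y (Mu i \<omega>)) g \<le> y (Th q)" if "q \<in> {1..k}" "g \<in> S" for q g
    proof -
      have "(\<Sum>i=1..n. \<mu> i * est1 C z1 i g) - price P * cost P g \<le> \<theta>"
        unfolding \<theta>_def using S that by (intro Max_ge) auto
      then show ?thesis by (simp only: sc[OF that(1)] y(3))
    qed
    \<comment> \<open>The smallest admissible \<open>\<theta>\<close> already respects the box: the
      multipliers sum to at most \<open>d1\<close>, and every cost is at most
      \<open>cmax C\<close>.\<close>
    moreover have "- (price P * cmax C) \<le> \<theta> \<and> \<theta> \<le> d1"
    proof -
      have "\<theta> \<in> (\<lambda>g. (\<Sum>i=1..n. \<mu> i * est1 C z1 i g) - price P * cost P g) ` S"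
        unfolding \<theta>_def using S by (intro Max_in) auto
      then obtain g where g: "g \<in> S" "\<theta> = (\<Sum>i=1..n. \<mu> i * est1 C z1 i g) - price P * cost P g" by auto
      have c: "0 \<le> price P * cost P g" "price P * cost P g \<le> price P * cmax C"
        using cost[of g] g S price by (auto intro: mult_left_mono)
      have e: "est1 C z1 i g \<in> {0..1}" for i by (rule est1_range[OF sizes(1)])
      have "0 \<le> (\<Sum>i=1..n. \<mu> i * est1 C z1 i g)"
        using \<mu> e by (intro sum_nonneg mult_nonneg_nonneg) auto
      moreover have "(\<Sum>i=1..n. \<mu> i * est1 C z1 i g) \<le> (\<Sum>i=1..n. curve.inc 0 / real n * 1)"
        using \<mu> e curve.inc_nonneg[of 0] curve.k_pos by (intro sum_mono mult_mono) auto
      moreover have "(\<Sum>i=1..n. curve.inc 0 / real n * 1) = curve.inc 0" using n by simp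
      ultimately show ?thesis using c g(2) unfolding increment_eq(1)[OF k_range] by linarith
    qed
    ultimately have "feasible P C z1 k S y"
      using \<mu> \<xi> \<xi>0 \<xi>1 unfolding feasible_def explicit_ok_iff y increment_eq(1)[OF k_range]
      by (simp add: n_def)
    then have "V \<le> obj k y" by (rule V)
    also have "obj k y = (\<Sum>i=1..n. \<xi> i) + real k * \<theta>"
      unfolding dot_objective y sum_scen by (simp add: n_def)
    finally show ?thesis by (simp add: \<xi>_def \<theta>_def)
  qed
  have e: "est1 C z1 i g \<in> {0..1}" for i g by (rule est1_range[OF sizes(1)])
  obtain gs where gs: "set gs \<subseteq> S" "length gs = k"
    and V: "V \<le> avg n (est1 C z1) gs (curve P k) - sum_list (map (\<lambda>g. price P * cost P g) gs)
      + (1 - 1 / real k) ^ k * (1 - real k * curve.last_inc)"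
    using curve.greedy_selection[OF n S(1,2) e dual] by auto
  have "avg n (est1 C z1) gs (curve P k) - sum_list (map (\<lambda>g. price P * cost P g) gs) =
      list_value P (est1 C z1) gs"
    using gs by (simp add: list_value_def avg_def n_def sum_list_const_mult)
  moreover have "(1 - curve.last_inc / curve.inc 0) / exp 1 = curvature P k / exp 1"
    unfolding curvature_def increment_eq[OF k_range] ..
  ultimately show ?thesis using V gs curve.distortion_le by (intro exI[of _ gs]) auto
qed

text \<open>With \<open>e = d1 / n\<close>, moving each coordinate by \<open>e / 8\<close> keeps
  \<open>\<mu>\<close> between \<open>3 * e / 8\<close> and \<open>5 * e / 8\<close> and
  \<open>\<xi>\<close> between \<open>1 / n - e / 4\<close> and \<open>1 / n\<close>. Scores are
  then at most \<open>5 * d1 / 8\<close>, the smallest value left to \<open>\<theta>\<close> around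
  \<open>3 * d1 / 4\<close>.\<close>

lemma inner_cube:
  shows "\<exists>c. \<forall>y. (\<forall>v\<in>dvars P C k. \<bar>y v - c v\<bar> \<le> inner_radius P k) \<longrightarrow> feasible P C z1 k (workflows P) y"
proof -
  define n where "n = real (tasks P)"
  have n: "n \<ge> 1" using tasks by (simp add: n_def)
  define e where "e = d1 / n"
  have e: "0 < e" "e \<le> 1 / n" "e \<le> d1" using d1 n by (auto simp: e_def divide_right_mono divide_le_eq)
  have r: "inner_radius P k = e / 8" by (simp add: inner_radius_def e_def n_def)
  define c where "c v = (case v of Mu i \<omega> \<Rightarrow> e / 2 | Xi i \<omega> \<Rightarrow> 1 / n - e / 8 | Th q \<Rightarrow> 3 * d1 / 4)" for v :: dvar
  have "feasible P C z1 k (workflows P) y" if close: "\<forall>v\<in>dvars P C k. \<bar>y v - c v\<bar> \<le> inner_radius P k" for y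
  proof -
    have mu: "3 * e / 8 \<le> y (Mu i \<omega>)" "y (Mu i \<omega>) \<le> 5 * e / 8"
      and xi: "1 / n - e / 4 \<le> y (Xi i \<omega>)" "y (Xi i \<omega>) \<le> 1 / n"
      if "i \<in> {1..tasks P}" "\<omega> \<in> scenarios P C k" for i \<omega>
    proof -
      have "\<bar>y (Mu i \<omega>) - e / 2\<bar> \<le> e / 8" "\<bar>y (Xi i \<omega>) - (1 / n - e / 8)\<bar> \<le> e / 8"
        using bspec[OF close, of "Mu i \<omega>"] bspec[OF close, of "Xi i \<omega>"] that
        by (auto simp: c_def dvars_def r)
      then show "3 * e / 8 \<le> y (Mu i \<omega>)" "y (Mu i \<omega>) \<le> 5 * e / 8"
        "1 / n - e / 4 \<le> y (Xi i \<omega>)" "y (Xi i \<omega>) \<le> 1 / n"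
        unfolding abs_le_iff by linarith+
    qed
    have th: "5 * d1 / 8 \<le> y (Th q)" "y (Th q) \<le> d1" if "q \<in> {1..k}" for q
    proof -
      have "\<bar>y (Th q) - 3 * d1 / 4\<bar> \<le> e / 8"
        using bspec[OF close, of "Th q"] that by (auto simp: c_def dvars_def r)
      then show "5 * d1 / 8 \<le> y (Th q)" "y (Th q) \<le> d1" using e unfolding abs_le_iff by linarith+
    qed
    have lines: "curve P k t / n \<le> y (Xi i \<omega>) + real t * y (Mu i \<omega>)"
      if "i \<in> {1..tasks P}" "\<omega> \<in> scenarios P C k" "t \<le> k" for i \<omega> t
    proof (cases t)
      case 0
      then show ?thesis using xi[OF that(1,2)] e by (simp add: curve.zero)
    next
      case (Suc s)
      \<comment> \<open>A single multiple of \<open>\<mu>\<close> outweighs the deficit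
        \<open>e / 4\<close> of \<open>\<xi>\<close> below \<open>1 / n\<close>.\<close>
      have "1 * (3 * e / 8) \<le> real t * y (Mu i \<omega>)"
        using mu[OF that(1,2)] Suc e by (intro mult_mono) auto
      moreover have "curve P k t / n \<le> 1 / n"
        using curve.psi_range[OF that(3)] n by (intro divide_right_mono) auto
      ultimately show ?thesis using xi[OF that(1,2)] e by linarith
    qed
    have sc: "score P C z1 k q (\<lambda>i \<omega>. y (Mu i \<omega>)) g \<le> y (Th q)" if "q \<in> {1..k}" "g \<in> workflows P" for q g
    proof -
      let ?X = "\<Sum>\<omega>\<in>scenarios P C k. scen_prob P C k * (\<Sum>i=1..tasks P. y (Mu i \<omega>) * plug_correct C z1 i g q \<omega>)"
      have "?X \<le> (\<Sum>\<omega>\<in>scenarios P C k. scen_prob P C k * (5 * d1 / 8))"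
      proof (intro sum_mono mult_left_mono)
        fix \<omega> assume "\<omega> \<in> scenarios P C k"
        then have "(\<Sum>i=1..tasks P. y (Mu i \<omega>) * plug_correct C z1 i g q \<omega>) \<le> (\<Sum>i=1..tasks P. 5 * e / 8 * 1)"
          using mu e by (intro sum_mono mult_mono) (auto simp: plug_correct_def)
        also have "\<dots> = 5 * d1 / 8" using n by (simp add: e_def n_def)
        finally show "(\<Sum>i=1..tasks P. y (Mu i \<omega>) * plug_correct C z1 i g q \<omega>) \<le> 5 * d1 / 8" .
      qed (use scen_prob_pos[of k] in simp)
      also have "\<dots> = 5 * d1 / 8" by (rule sum_scen)
      finally have "?X \<le> 5 * d1 / 8" .
      moreover have "0 \<le> price P * cost P g" using price cost that by simp
      ultimately show ?thesis using th[OF that(1)] unfolding score_def by linarith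
    qed
    have pc: "- (price P * cmax C) \<le> 0" using price cmax_nonneg by simp
    have "explicit_ok P C k y"
      unfolding explicit_ok_iff n_def[symmetric] e_def[symmetric]
    proof (intro conjI ballI allI impI)
      fix i \<omega> assume i: "i \<in> {1..tasks P}" "\<omega> \<in> scenarios P C k"
      show "0 \<le> y (Mu i \<omega>)" "y (Mu i \<omega>) \<le> e" using mu[OF i] e by linarith+
      show "0 \<le> y (Xi i \<omega>)" "y (Xi i \<omega>) \<le> 1 / n" using xi[OF i] e by linarith+
      show "curve P k t / n \<le> y (Xi i \<omega>) + real t * y (Mu i \<omega>)" if "t \<le> k" for t
        by (rule lines[OF i that])
    next
      fix q assume "q \<in> {1..k}"
      then show "- (price P * cmax C) \<le> y (Th q)" "y (Th q) \<le> d1" using th[of q] pc d1 by linarith+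
    qed
    then show ?thesis unfolding feasible_def using sc by blast
  qed
  then show ?thesis by blast
qed

text \<open>The length of the interval in the first part is \<open>objective_range\<close>. The
  coordinate bound in the second part, times the square root of the dimension, is
  \<open>outer_radius\<close>.\<close>

lemma explicit_bounds:
  assumes "explicit_ok P C k y"
  shows "obj k y \<in> {- real k * (price P * cmax C)..1 + real k}"
    and "v \<in> dvars P C k \<Longrightarrow> \<bar>y v\<bar> \<le> max 1 (price P * cmax C)"
proof -
  define n where "n = real (tasks P)"
  have n: "n \<ge> 1" using tasks by (simp add: n_def)
  have pc: "0 \<le> price P * cmax C" using price cmax_nonneg by simp
  have mu: "0 \<le> y (Mu i \<omega>)" "y (Mu i \<omega>) \<le> d1 / n" and xi: "0 \<le> y (Xi i \<omega>)" "y (Xi i \<omega>) \<le> 1 / n"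
    if "i \<in> {1..tasks P}" "\<omega> \<in> scenarios P C k" for i \<omega>
    using assms that unfolding explicit_ok_iff n_def by blast+
  have th: "- (price P * cmax C) \<le> y (Th q)" "y (Th q) \<le> d1" if "q \<in> {1..k}" for q
    using assms that unfolding explicit_ok_iff by blast+
  have "0 \<le> (\<Sum>i=1..tasks P. \<Sum>\<omega>\<in>scenarios P C k. scen_prob P C k * y (Xi i \<omega>))"
    using xi scen_prob_pos[of k] by (intro sum_nonneg mult_nonneg_nonneg) auto
  moreover have "(\<Sum>i=1..tasks P. \<Sum>\<omega>\<in>scenarios P C k. scen_prob P C k * y (Xi i \<omega>)) \<le> 1"
  proof -
    have "(\<Sum>i=1..tasks P. \<Sum>\<omega>\<in>scenarios P C k. scen_prob P C k * y (Xi i \<omega>)) \<le>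
        (\<Sum>i=1..tasks P. \<Sum>\<omega>\<in>scenarios P C k. scen_prob P C k * (1 / n))"
      using xi scen_prob_pos[of k] by (intro sum_mono mult_left_mono) auto
    also have "\<dots> = 1" unfolding sum_scen using n by (simp add: n_def)
    finally show ?thesis .
  qed
  moreover have "(\<Sum>q=1..k. - (price P * cmax C)) \<le> (\<Sum>q=1..k. y (Th q))"
    using th by (intro sum_mono) auto
  moreover have "(\<Sum>q=1..k. y (Th q)) \<le> (\<Sum>q=1..k. 1)"
    using th d1 by (intro sum_mono) (auto intro: order.trans)
  ultimately show "obj k y \<in> {- real k * (price P * cmax C)..1 + real k}"
    unfolding dot_objective by simp
  have small: "d1 / n \<le> 1" "1 / n \<le> 1" using d1 n by (auto simp: divide_le_eq)
  show "\<bar>y v\<bar> \<le> max 1 (price P * cmax C)" if "v \<in> dvars P C k"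
    using that unfolding dvars_def
  proof (elim UnE CollectE exE conjE imageE)
    fix i \<omega> assume "v = Mu i \<omega>" "i \<in> {1..tasks P}" "\<omega> \<in> scenarios P C k"
    then show ?thesis using mu[of i \<omega>] small by (auto simp: le_max_iff_disj)
  next
    fix i \<omega> assume "v = Xi i \<omega>" "i \<in> {1..tasks P}" "\<omega> \<in> scenarios P C k"
    then show ?thesis using xi[of i \<omega>] small by (auto simp: le_max_iff_disj)
  next
    fix q assume "v = Th q" "q \<in> {1..k}"
    then show ?thesis using th[of q] d1 pc by (auto simp: max_def abs_le_iff)
  qed
qed

lemma objective_range:
  assumes "explicit_ok P C k y" "explicit_ok P C k z"
  shows "obj k y - obj k z \<le> objective_range P C k"
  using explicit_bounds(1)[OF assms(1)] explicit_bounds(1)[OF assms(2)]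
  by (simp add: objective_range_def algebra_simps)

lemma bil_initial: "bil (dvars P C k) (snd (initial_ellipsoid P C k)) a a =
    (\<Sum>v\<in>dvars P C k. (a v)\<^sup>2) * (outer_radius P C k)\<^sup>2"
proof -
  have "(\<Sum>w\<in>dvars P C k. of_bool (v = w) * (outer_radius P C k)\<^sup>2 * a w) = (outer_radius P C k)\<^sup>2 * a v"
    if "v \<in> dvars P C k" for v
    using that finite_dvars[of P C k] by (simp add: of_bool_def if_distrib if_distribR cong: if_cong)
  then have "bil (dvars P C k) (snd (initial_ellipsoid P C k)) a a =
      (\<Sum>v\<in>dvars P C k. a v * ((outer_radius P C k)\<^sup>2 * a v))"
    by (simp add: bil_def initial_ellipsoid_def)
  also have "\<dots> = (\<Sum>v\<in>dvars P C k. (a v)\<^sup>2 * (outer_radius P C k)\<^sup>2)"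
    by (rule sum.cong) (simp_all add: power2_eq_square)
  finally show ?thesis by (simp only: sum_distrib_right)
qed

lemma in_initial_ellipsoid:
  assumes "explicit_ok P C k y"
  shows "in_ellipsoid (dvars P C k) (initial_ellipsoid P C k) y"
  unfolding in_ellipsoid_def
proof
  fix a
  let ?I = "dvars P C k"
  define m where "m = max 1 (price P * cmax C)"
  have "(\<Sum>v\<in>?I. (y v)\<^sup>2) \<le> (\<Sum>v\<in>?I. m\<^sup>2)"
    using explicit_bounds(2)[OF assms] by (intro sum_mono abs_le_square_iff[THEN iffD1]) (auto simp: m_def)
  also have "\<dots> = (outer_radius P C k)\<^sup>2" by (simp add: outer_radius_def power_mult_distrib m_def)
  finally have y: "(\<Sum>v\<in>?I. (y v)\<^sup>2) \<le> (outer_radius P C k)\<^sup>2" .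
  have "(dot ?I a y)\<^sup>2 \<le> (\<Sum>v\<in>?I. (a v)\<^sup>2) * (\<Sum>v\<in>?I. (y v)\<^sup>2)"
    unfolding dot_def by (rule Cauchy_Schwarz_ineq_sum)
  also have "\<dots> \<le> (\<Sum>v\<in>?I. (a v)\<^sup>2) * (outer_radius P C k)\<^sup>2"
    by (intro mult_left_mono y sum_nonneg) auto
  also have "\<dots> = bil ?I (snd (initial_ellipsoid P C k)) a a"
    by (rule bil_initial[symmetric])
  finally show "(dot ?I a y - dot ?I a (fst (initial_ellipsoid P C k)))\<^sup>2 \<le> bil ?I (snd (initial_ellipsoid P C k)) a a"
    by (simp add: initial_ellipsoid_def dot_def)
qed

lemma pos_def_initial: "pos_def (dvars P C k) (snd (initial_ellipsoid P C k))"
  unfolding pos_def_def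
proof (intro conjI ballI allI impI)
  fix a :: point
  assume "\<exists>v\<in>dvars P C k. a v \<noteq> 0"
  then have pos: "0 < (\<Sum>v\<in>dvars P C k. (a v)\<^sup>2)" using finite_dvars[of P C k] by (auto intro: sum_pos2)
  have R: "0 < outer_radius P C k" using card_dvars[of k] k_range by (auto simp: outer_radius_def intro!: mult_pos_pos)
  have "bil (dvars P C k) (snd (initial_ellipsoid P C k)) a a = (\<Sum>v\<in>dvars P C k. (a v)\<^sup>2) * (outer_radius P C k)\<^sup>2"
    by (rule bil_initial)
  then show "0 < bil (dvars P C k) (snd (initial_ellipsoid P C k)) a a" using pos R by simp
qed (auto simp: initial_ellipsoid_def)

end

end

section \<open>The ellipsoid run\<close>

lemma arg_max_on_finite:
  fixes f :: "'a \<Rightarrow> real"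
  assumes "finite A" "A \<noteq> {}"
  shows "arg_max_on f A \<in> A" "x \<in> A \<Longrightarrow> f x \<le> f (arg_max_on f A)"
proof -
  have "Max (f ` A) \<in> f ` A" using assms by (intro Max_in) auto
  then obtain a where a: "a \<in> A" "f a = Max (f ` A)" by auto
  have "is_arg_max f (\<lambda>x. x \<in> A) a"
    unfolding is_arg_max_def using a assms(1) by (auto simp: not_less)
  then have "is_arg_max f (\<lambda>x. x \<in> A) (arg_max_on f A)"
    unfolding arg_max_on_def arg_max_def by (rule someI)
  then show "arg_max_on f A \<in> A" "x \<in> A \<Longrightarrow> f x \<le> f (arg_max_on f A)"
    by (auto simp: is_arg_max_def not_less)
qed

text \<open>States only grow, by appending to the log. Hence the answers of any step belong to the
  final pool, and a log position keeps its query.\<close>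

definition gen_le :: "'g gen_state \<Rightarrow> 'g gen_state \<Rightarrow> bool" where
  "gen_le S S' \<longleftrightarrow> pool S \<subseteq> pool S' \<and> (\<exists>qs. qlog S' = qlog S @ qs)"

lemma gen_le_refl: "gen_le S S"
  by (simp add: gen_le_def)

lemma gen_le_trans: "gen_le S S' \<Longrightarrow> gen_le S' S'' \<Longrightarrow> gen_le S S''"
  by (auto simp: gen_le_def)

lemma ell_step_violated:
  assumes "\<not> explicit_ok P C k (fst E)"
  shows "\<exists>(a, b)\<in>explicit_constraints P C k. b < dot (dvars P C k) a (fst E) \<and>
    ell_step P C z1 y k (S, E) = (S, central_cut (dvars P C k) a E)"
proof -
  define viol where "viol = {c \<in> explicit_constraints P C k. violated (dvars P C k) (fst E) c}"
  have ne: "viol \<noteq> {}" using assms by (auto simp: viol_def explicit_ok_def)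
  then have mem: "(SOME c. c \<in> viol) \<in> viol" by (simp add: some_in_eq)
  have "ell_step P C z1 y k (S, E) = (S, central_cut (dvars P C k) (fst (SOME c. c \<in> viol)) E)"
    using ne unfolding ell_step_def viol_def Let_def by simp
  moreover obtain a b where "(SOME c. c \<in> viol) = (a, b)" by fastforce
  ultimately show ?thesis
    using mem unfolding viol_def by (intro bexI[of _ "(a, b)"]) (auto simp: violated_iff)
qed

lemma ell_step_ok:
  fixes P C z1 y k S E
  defines "\<mu> \<equiv> \<lambda>i \<omega>. fst E (Mu i \<omega>)"
  defines "ans \<equiv> \<lambda>q. batch_answers C y (length (qlog S) + q - 1)"
  defines "best \<equiv> \<lambda>q. arg_max_on (score P C z1 k q \<mu>) (ans q)"
  defines "Q \<equiv> {q \<in> {1..k}. score P C z1 k q \<mu> (best q) > fst E (Th q)}"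
  assumes "explicit_ok P C k (fst E)"
  shows "ell_step P C z1 y k (S, E) =
    (S\<lparr>pool := pool S \<union> (\<Union>q\<in>{1..k}. ans q), qlog := qlog S @ map (\<lambda>q. (k, q, \<mu>)) [1..<Suc k]\<rparr>,
     central_cut (dvars P C k) (if Q = {} then objective_normal P C k
       else workflow_normal P C z1 k (Min Q) (best (Min Q))) E)"
proof -
  have none: "{c \<in> explicit_constraints P C k. violated (dvars P C k) (fst E) c} = {}"
    using assms(5) by (auto simp: explicit_ok_def)
  show ?thesis
    unfolding ell_step_def Q_def best_def ans_def \<mu>_def Let_def prod.case none
    by (simp only: simp_thms if_False)
qed

lemma ell_step_le: "gen_le S (fst (ell_step P C z1 y k (S, E)))"
proof (cases "explicit_ok P C k (fst E)")
  case True
  then show ?thesis by (subst ell_step_ok) (auto simp: gen_le_def)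
next
  case False
  then show ?thesis using ell_step_violated[OF False, of z1 y S] by (auto simp: gen_le_refl)
qed

lemma ell_step_pool:
  assumes "\<And>j. y j \<in> W" "pool S \<subseteq> W"
  shows "pool (fst (ell_step P C z1 y k (S, E))) \<subseteq> W"
proof (cases "explicit_ok P C k (fst E)")
  case True
  then show ?thesis using assms by (subst ell_step_ok) (auto simp: batch_answers_def)
next
  case False
  then show ?thesis using ell_step_violated[OF False, of z1 y S] assms(2) by fastforce
qed

lemma ell_iter_le: "s \<le> t \<Longrightarrow> gen_le (fst ((ell_step P C z1 y k ^^ s) X)) (fst ((ell_step P C z1 y k ^^ t) X))"
proof (induction t rule: dec_induct)
  case (step t)
  then show ?case
    using ell_step_le[of "fst ((ell_step P C z1 y k ^^ t) X)" P C z1 y k "snd ((ell_step P C z1 y k ^^ t) X)"]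
    by (simp add: gen_le_trans)
qed (rule gen_le_refl)

lemma ell_iter_pool:
  assumes "\<And>j. y j \<in> W" "pool (fst X) \<subseteq> W"
  shows "pool (fst ((ell_step P C z1 y k ^^ t) X)) \<subseteq> W"
proof (induction t)
  case (Suc t)
  then show ?case
    using ell_step_pool[OF assms(1) Suc, where E = "snd ((ell_step P C z1 y k ^^ t) X)"] by simp
qed (use assms in simp)

lemma ell_run_le: "gen_le S (ell_run P C z1 y k S)"
  unfolding ell_run_def
  using ell_iter_le[of 0 _ P C z1 y k "(S, initial_ellipsoid P C k)"] by simp

lemma fold_ell_run_le: "gen_le S (fold (ell_run P C z1 y) ks S)"
  by (induction ks arbitrary: S) (auto intro: gen_le_refl gen_le_trans ell_run_le)

lemma fold_ell_run_pool:
  assumes "\<And>j. y j \<in> W" "pool S \<subseteq> W"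
  shows "pool (fold (ell_run P C z1 y) ks S) \<subseteq> W"
  using assms(2)
proof (induction ks arbitrary: S)
  case (Cons k ks)
  have "pool (ell_run P C z1 y k S) \<subseteq> W"
    unfolding ell_run_def by (rule ell_iter_pool) (use assms Cons.prems in auto)
  then show ?case using Cons.IH by simp
qed simp

lemma generation_run:
  assumes "finite (grid C)" "k \<in> grid C"
  shows "\<exists>S. gen_le (ell_run P C z1 y k S) (generation P C z1 y)"
proof -
  have "k \<in> set (sorted_list_of_set (grid C))" using assms by simp
  then obtain us vs where "sorted_list_of_set (grid C) = us @ k # vs" by (meson split_list)
  then show ?thesis
    unfolding generation_def using fold_ell_run_le by (auto intro!: exI)
qed

context workflow_setting
begin

definition oracle_ok :: "(nat \<times> 'g \<times> nat \<Rightarrow> bool) \<Rightarrow> (nat \<Rightarrow> 'g) \<Rightarrow> bool" where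
  "oracle_ok z1 y \<longleftrightarrow> (\<forall>b<length (qlog (generation P C z1 y)).
    \<exists>j\<in>{b * batch_size C..<b * batch_size C + batch_size C}. call_good P C z1 y j)"

lemma frozen_pool_props:
  assumes "\<And>j. y j \<in> workflows P"
  shows "frozen_pool P C z1 y \<subseteq> workflows P" "finite (frozen_pool P C z1 y)" "init_pool C \<subseteq> frozen_pool P C z1 y"
proof -
  show *: "frozen_pool P C z1 y \<subseteq> workflows P"
    unfolding frozen_pool_def generation_def by (rule fold_ell_run_pool) (use assms init_pool in auto)
  show "finite (frozen_pool P C z1 y)" using * workflows by (rule finite_subset)
  show "init_pool C \<subseteq> frozen_pool P C z1 y"
    using fold_ell_run_le[of "\<lparr>pool = init_pool C, qlog = []\<rparr>" P C z1 y "sorted_list_of_set (grid C)"]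
    by (simp add: frozen_pool_def generation_def gen_le_def)
qed

context
  fixes k :: nat and z1 :: "nat \<times> 'g \<times> nat \<Rightarrow> bool" and y :: "nat \<Rightarrow> 'g" and gs :: "'g list"
  assumes k: "k \<in> grid C" and y: "\<And>j. y j \<in> workflows P" and orc: "oracle_ok z1 y"
    and gs: "set gs \<subseteq> workflows P" "length gs = k"
begin

abbreviation "I \<equiv> dvars P C k"

abbreviation "target \<equiv> list_value P (est1 C z1) gs"

abbreviation "near_optimal x \<equiv>
  feasible P C z1 k (frozen_pool P C z1 y) x \<and> obj k x < target - eps_ell C / 2"

lemma k_pos: "k \<ge> 1"
  using k grid by auto

lemma batch_finite: "finite (batch_answers C y b)" "batch_answers C y b \<noteq> {}"
  using sizes by (auto simp: batch_answers_def)

lemma ell_step_cut: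
  assumes le: "gen_le (fst (ell_step P C z1 y k (S, E))) (generation P C z1 y)"
  shows "\<exists>a. snd (ell_step P C z1 y k (S, E)) = central_cut I a E \<and> (\<exists>v\<in>I. a v \<noteq> 0) \<and>
    (\<forall>x. near_optimal x \<longrightarrow> dot I a x \<le> dot I a (fst E))"
proof (cases "explicit_ok P C k (fst E)")
  case False
  from ell_step_violated[OF False, of z1 y S] obtain a b where ab: "(a, b) \<in> explicit_constraints P C k"
    "b < dot I a (fst E)" "snd (ell_step P C z1 y k (S, E)) = central_cut I a E" by auto
  have "dot I a x \<le> b" if "near_optimal x" for x
    using that ab(1) unfolding feasible_iff by auto
  then show ?thesis using ab explicit_normal_nonzero[OF ab(1)] by force
next
  case True
  define \<mu> where "\<mu> = (\<lambda>i \<omega>. fst E (Mu i \<omega>))"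
  define ans where "ans = (\<lambda>q. batch_answers C y (length (qlog S) + q - 1))"
  define best where "best = (\<lambda>q. arg_max_on (score P C z1 k q \<mu>) (ans q))"
  define Q where "Q = {q \<in> {1..k}. score P C z1 k q \<mu> (best q) > fst E (Th q)}"
  have step: "ell_step P C z1 y k (S, E) =
    (S\<lparr>pool := pool S \<union> (\<Union>q\<in>{1..k}. ans q), qlog := qlog S @ map (\<lambda>q. (k, q, \<mu>)) [1..<Suc k]\<rparr>,
     central_cut I (if Q = {} then objective_normal P C k
       else workflow_normal P C z1 k (Min Q) (best (Min Q))) E)"
    unfolding ans_def best_def Q_def \<mu>_def by (rule ell_step_ok[OF True])
  have best: "best q \<in> ans q" "g \<in> ans q \<Longrightarrow> score P C z1 k q \<mu> g \<le> score P C z1 k q \<mu> (best q)" for q g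
    using arg_max_on_finite[OF batch_finite] unfolding best_def ans_def by blast+
  have pool: "ans q \<subseteq> frozen_pool P C z1 y" if "q \<in> {1..k}" for q
  proof -
    have "(\<Union>q\<in>{1..k}. ans q) \<subseteq> frozen_pool P C z1 y"
      using le unfolding step gen_le_def frozen_pool_def by simp
    with that show ?thesis by blast
  qed
  show ?thesis
  proof (cases "Q = {}")
    case False
    have "finite Q" by (simp add: Q_def)
    with False have "Min Q \<in> Q" by (rule Min_in[rotated])
    then have q: "Min Q \<in> {1..k}" "fst E (Th (Min Q)) < score P C z1 k (Min Q) \<mu> (best (Min Q))"
      by (auto simp: Q_def)
    let ?a = "workflow_normal P C z1 k (Min Q) (best (Min Q))"
    have "price P * cost P (best (Min Q)) < dot I ?a (fst E)"
      using q unfolding dot_workflow[OF q(1)] \<mu>_def by simp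
    moreover have "dot I ?a x \<le> price P * cost P (best (Min Q))" if "near_optimal x" for x
      using that q(1) best(1) pool unfolding feasible_iff by blast
    ultimately show ?thesis
      using False workflow_normal_nonzero[OF q(1)] unfolding step by (intro exI[of _ ?a]) fastforce
  next
    case True
    let ?\<tau> = "pricing_tol C k"
    have sc: "score P C z1 k q \<mu> g \<le> fst E (Th q) + ?\<tau>" if q: "q \<in> {1..k}" and g: "g \<in> workflows P" for q g
    proof -
      \<comment> \<open>Columns are numbered from 1 and log entries from 0, so this is the batch of
        column \<open>q\<close>, and it stays at this position of the final log.\<close>
      define b where "b = length (qlog S) + q - 1"
      obtain qs where qs: "qlog (generation P C z1 y) = (qlog S @ map (\<lambda>q. (k, q, \<mu>)) [1..<Suc k]) @ qs"
        using le unfolding step gen_le_def by auto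
      have b: "b < length (qlog (generation P C z1 y))" using q unfolding qs b_def by auto
      have nth: "qlog (generation P C z1 y) ! b = (k, q, \<mu>)"
      proof -
        obtain p where p: "q = Suc p" "p < k" using q by (cases q) auto
        then show ?thesis unfolding qs b_def by (simp add: nth_append del: upt_Suc)
      qed
      obtain j where j: "j \<in> {b * batch_size C..<b * batch_size C + batch_size C}" "call_good P C z1 y j"
        using orc b unfolding oracle_ok_def by blast
      have "j div batch_size C = b" using j(1) by (intro div_nat_eqI) (auto simp: algebra_simps)
      then have "Max (score P C z1 k q \<mu> ` workflows P) - ?\<tau> \<le> score P C z1 k q \<mu> (y j)"
        using j(2) nth by (simp add: call_good_def)
      moreover have "score P C z1 k q \<mu> g \<le> Max (score P C z1 k q \<mu> ` workflows P)"
        using g workflows by (intro Max_ge) auto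
      moreover have "y j \<in> ans q" using j(1) unfolding ans_def batch_answers_def b_def by blast
      moreover have "score P C z1 k q \<mu> (best q) \<le> fst E (Th q)" using True q by (auto simp: Q_def not_less)
      ultimately show ?thesis using best(2)[of "y j" q] by linarith
    qed
    have "target \<le> obj k (fst E) + real k * ?\<tau>"
      by (rule weak_duality[OF k \<open>explicit_ok P C k (fst E)\<close> _ gs]) (use sc in \<open>simp add: \<mu>_def\<close>)
    also have "real k * ?\<tau> = eps_ell C / 2" using k_pos by (simp add: pricing_tol_def)
    finally show ?thesis
      using True objective_normal_nonzero[OF k_pos] unfolding step
      by (intro exI[of _ "objective_normal P C k"]) auto
  qed
qed

text \<open>The determinant starts at \<open>R ^ (2 * N)\<close> and every step makes exactly one
  cut, whichever kind it is.\<close>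

lemma ell_iter_inv:
  assumes "gen_le (fst ((ell_step P C z1 y k ^^ t) (S, initial_ellipsoid P C k))) (generation P C z1 y)"
  defines "E \<equiv> snd ((ell_step P C z1 y k ^^ t) (S, initial_ellipsoid P C k))"
  shows "pos_def I (snd E) \<and> qdet I (snd E) \<le> exp (- 1 / (real (card I) + 1)) ^ t * ((outer_radius P C k)\<^sup>2) ^ card I
    \<and> (\<forall>x. near_optimal x \<longrightarrow> in_ellipsoid I E x)"
  using assms(1) unfolding E_def
proof (induction t)
  case 0
  have "qdet I (snd (initial_ellipsoid P C k)) = ((outer_radius P C k)\<^sup>2) ^ card I"
    unfolding initial_ellipsoid_def snd_conv by (rule qdet_diag[OF finite_dvars])
  then show ?case using pos_def_initial[OF k] in_initial_ellipsoid[OF k] by (auto simp: feasible_def)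
next
  case (Suc t)
  let ?X = "(ell_step P C z1 y k ^^ t) (S, initial_ellipsoid P C k)"
  have X: "?X = (fst ?X, fst (snd ?X), snd (snd ?X))" by simp
  have le: "gen_le (fst (ell_step P C z1 y k (fst ?X, snd ?X))) (generation P C z1 y)"
    using Suc.prems by simp
  have "gen_le (fst ?X) (generation P C z1 y)" using gen_le_trans[OF ell_step_le le] .
  then have IH: "pos_def I (snd (snd ?X))"
    "qdet I (snd (snd ?X)) \<le> exp (- 1 / (real (card I) + 1)) ^ t * ((outer_radius P C k)\<^sup>2) ^ card I"
    "\<And>x. near_optimal x \<Longrightarrow> in_ellipsoid I (snd ?X) x" using Suc.IH by auto
  from ell_step_cut[OF le] obtain a where a: "snd (ell_step P C z1 y k ?X) = central_cut I a (snd ?X)"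
    "\<exists>v\<in>I. a v \<noteq> 0" "\<And>x. near_optimal x \<Longrightarrow> dot I a x \<le> dot I a (fst (snd ?X))" by auto
  define z B where "z = fst (snd ?X)" and "B = snd (snd ?X)"
  have zB: "snd ?X = (z, B)" by (simp add: z_def B_def)
  note IH = IH[unfolded zB snd_conv] and a = a[unfolded zB fst_conv]
  have N: "2 \<le> card I" by (rule card_dvars[OF k_pos])
  have "bil I B a a \<noteq> 0" using IH(1) a(2) by (fastforce simp: pos_def_def)
  then have "qdet I (snd (central_cut I a (z, B))) =
      ((real (card I))\<^sup>2 / ((real (card I))\<^sup>2 - 1)) ^ card I * (1 - 2 / (real (card I) + 1)) * qdet I B"
    by (rule qdet_central_cut[OF finite_dvars])
  also have "\<dots> \<le> exp (- 1 / (real (card I) + 1)) * (exp (- 1 / (real (card I) + 1)) ^ t * ((outer_radius P C k)\<^sup>2) ^ card I)"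
  proof (rule mult_mono[OF cut_factor_le[OF N] IH(2)])
    \<comment> \<open>The lower bound on the determinant with constant 0 yields its nonnegativity,
      since the dimension is positive.\<close>
    have "0 ^ card I \<le> qdet I B"
      by (rule qdet_ge_power[OF finite_dvars IH(1)]) (simp_all add: bil_nonneg[OF IH(1)])
    then show "0 \<le> qdet I B" using N by (simp add: power_0_left split: if_splits)
  qed simp
  finally have "qdet I (snd (central_cut I a (z, B))) \<le> exp (- 1 / (real (card I) + 1)) ^ Suc t * ((outer_radius P C k)\<^sup>2) ^ card I"
    by simp
  then show ?case
    using pos_def_central_cut[OF IH(1) a(2) N] in_central_cut[OF IH(1) a(2) N IH(3) a(3)] a(1) by simp
qed

lemma objective_range_pos: "0 < objective_range P C k"
proof -
  have "0 \<le> real k * (1 + price P * cmax C)" using price cmax_nonneg by simp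
  then show ?thesis unfolding objective_range_def by linarith
qed

lemma outer_radius_pos: "0 < outer_radius P C k"
  using card_dvars[OF k_pos] by (auto simp: outer_radius_def intro!: mult_pos_pos)

lemma ell_run_optimal:
  assumes le: "gen_le (ell_run P C z1 y k S) (generation P C z1 y)"
    and x0: "feasible P C z1 k (frozen_pool P C z1 y) x0"
  shows "target - eps_ell C \<le> obj k x0"
proof (rule ccontr)
  assume "\<not> ?thesis"
  then have obj0: "obj k x0 < target - eps_ell C" by simp
  define T where "T = ell_iterations P C k (eps_ell C / 2)"
  define N where "N = card I"
  define R where "R = outer_radius P C k"
  \<comment> \<open>The scale of the copy around \<open>x0\<close>: moving a fraction
    \<open>t\<close> of the way to any feasible point raises the objective by at most
    \<open>eps_ell C / 2\<close>.\<close>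
  define t where "t = min 1 (eps_ell C / 2 / objective_range P C k)"
  define r where "r = t * inner_radius P k"
  define E where "E = snd ((ell_step P C z1 y k ^^ T) (S, initial_ellipsoid P C k))"
  have t: "0 < t" "t \<le> 1" using eps_ell objective_range_pos by (auto simp: t_def)
  have r: "0 < r" using t d1[OF k] tasks by (simp add: r_def inner_radius_def)
  have inv: "pos_def I (snd E)" "qdet I (snd E) \<le> exp (- 1 / (real N + 1)) ^ T * (R\<^sup>2) ^ N"
    "\<And>x. near_optimal x \<Longrightarrow> in_ellipsoid I E x"
    using ell_iter_inv[of T S] le by (auto simp: ell_run_def T_def N_def R_def E_def)
  obtain c where c: "\<And>x. (\<forall>v\<in>I. \<bar>x v - c v\<bar> \<le> inner_radius P k) \<Longrightarrow> feasible P C z1 k (workflows P) x"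
    using inner_cube[OF k, of z1] by blast
  have ball: "in_ellipsoid I (fst E, snd E) x"
    if close: "\<And>v. v \<in> I \<Longrightarrow> \<bar>x v - ((1 - t) * x0 v + t * c v)\<bar> \<le> r" for x
  proof -
    \<comment> \<open>The preimage of \<open>x\<close> under the contraction towards
      \<open>x0\<close>; it lies in the inner cube, hence is feasible for every workflow.\<close>
    define u where "u v = (x v - (1 - t) * x0 v) / t" for v
    have x: "x = (\<lambda>v. (1 - t) * x0 v + t * u v)" using t by (simp add: u_def fun_eq_iff)
    have "\<bar>u v - c v\<bar> \<le> inner_radius P k" if "v \<in> I" for v
    proof -
      have "x v - ((1 - t) * x0 v + t * c v) = t * (u v - c v)" unfolding x by (simp add: algebra_simps)
      then have "t * \<bar>u v - c v\<bar> \<le> t * inner_radius P k"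
        using close[OF that] t by (simp add: abs_mult r_def)
      then show ?thesis using t by simp
    qed
    then have "feasible P C z1 k (workflows P) u" by (intro c) auto
    then have u: "feasible P C z1 k (frozen_pool P C z1 y) u"
      using frozen_pool_props(1)[where y = y and ?z1.0 = z1, OF y] by (auto simp: feasible_def)
    have "obj k x = obj k x0 + t * (obj k u - obj k x0)"
      unfolding x dot_lin2 by (simp add: algebra_simps)
    also have "t * (obj k u - obj k x0) \<le> t * objective_range P C k"
      using objective_range[OF k] u x0 t by (intro mult_left_mono) (auto simp: feasible_def)
    also have "t * objective_range P C k \<le> eps_ell C / 2 / objective_range P C k * objective_range P C k"
      using objective_range_pos by (intro mult_right_mono) (auto simp: t_def)
    also have "\<dots> = eps_ell C / 2" using objective_range_pos by simp
    finally have "obj k x < target - eps_ell C / 2" using obj0 by simp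
    moreover have "feasible P C z1 k (frozen_pool P C z1 y) x"
      unfolding x using feasible_convex[OF x0 u] t by simp
    ultimately show ?thesis using inv(3) by simp
  qed
  have "r\<^sup>2 * (\<Sum>v\<in>I. (a v)\<^sup>2) \<le> bil I (snd E) a a" for a
    by (rule ball_in_ellipsoid[OF finite_dvars r ball inv(1)])
  then have "(r\<^sup>2) ^ N \<le> qdet I (snd E)"
    unfolding N_def by (intro qdet_ge_power[OF finite_dvars inv(1)]) auto
  with inv(2) have le: "(r\<^sup>2) ^ N \<le> exp (- 1 / (real N + 1)) ^ T * (R\<^sup>2) ^ N" by simp
  have R: "0 < R" unfolding R_def by (rule outer_radius_pos)
  have exp1: "exp (2 * real N * ln s) = (s\<^sup>2) ^ N" if "0 < s" for s :: real
  proof -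
    have "(s\<^sup>2) ^ N = exp (ln s) ^ (2 * N)" using that by (simp add: power_mult)
    then show ?thesis by (simp add: exp_of_nat_mult[symmetric])
  qed
  \<comment> \<open>Taking logarithms bounds the number of cuts by
    \<open>2 * N * (N + 1) * ln (R / r)\<close>. The ceiling plus one in
    \<open>ell_iterations\<close> exceeds this strictly.\<close>
  have "exp (2 * real N * ln r) \<le> exp (real T * (- 1 / (real N + 1))) * exp (2 * real N * ln R)"
    using le unfolding exp1[OF r] exp1[OF R] exp_of_nat_mult .
  then have "2 * real N * ln r \<le> real T * (- 1 / (real N + 1)) + 2 * real N * ln R"
    by (simp flip: exp_add)
  then have "real T / (real N + 1) \<le> 2 * real N * ln (R / r)"
    using r R by (simp add: ln_div algebra_simps)
  then have "real T \<le> 2 * real N * ln (R / r) * (real N + 1)"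
    by (simp add: pos_divide_le_eq)
  moreover have "2 * real N * (real N + 1) * ln (R / r) < real T"
  proof -
    have "T = nat \<lceil>2 * real N * (real N + 1) * ln (R / r)\<rceil> + 1"
      unfolding T_def ell_iterations_def N_def R_def r_def t_def Let_def ..
    then show ?thesis by linarith
  qed
  ultimately show False by (simp add: mult_ac)
qed

lemma frozen_pool_portfolio:
  "\<exists>gs'. set gs' \<subseteq> frozen_pool P C z1 y \<and> length gs' = k \<and>
    target - eps_ell C - eps_rnd P C \<le> list_value P (est1 C z1) gs'"
proof -
  obtain S where "gen_le (ell_run P C z1 y k S) (generation P C z1 y)"
    using generation_run[OF finite_grid k] by blast
  then have "\<exists>gs'. set gs' \<subseteq> frozen_pool P C z1 y \<and> length gs' = k \<and>
      target - eps_ell C \<le> list_value P (est1 C z1) gs' + curvature P k / exp 1"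
    using frozen_pool_props[where y = y and ?z1.0 = z1, OF y] baseline_props(3)
    by (intro dual_rounding[OF k] ell_run_optimal) auto
  moreover have "curvature P k / exp 1 \<le> eps_rnd P C"
    unfolding eps_rnd_def using finite_grid k by (intro Max_ge) auto
  ultimately show ?thesis by force
qed

end

end

section \<open>The returned portfolio\<close>

text \<open>A maximum dominates every convex combination; the weights \<open>V / (V + e)\<close> on
  \<open>a - e\<close> and \<open>e / (V + e)\<close> on \<open>V\<close> make the error terms
  cancel.\<close>

lemma weighted_max_bound:
  fixes v V a e :: real
  assumes "max V (a - e) \<le> v" "0 < V" "0 \<le> e"
  shows "V / (V + e) * a \<le> v"
proof -
  have pos: "0 < V + e" using assms by simp
  have "V * (a - e) \<le> V * v" "e * V \<le> e * v" using assms by (auto intro!: mult_left_mono)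
  then have "V * a \<le> v * (V + e)" by (simp add: algebra_simps)
  then show ?thesis using pos by (simp add: pos_divide_le_eq)
qed

text \<open>Stars and bars: along an enumeration of \<open>S\<close> a vector becomes a list of
  length \<open>card S\<close> with sum \<open>k\<close>.\<close>

lemma card_sized_counts:
  assumes S: "finite S" "S \<subseteq> workflows P" "finite (workflows P)"
  shows "card {m \<in> counts_on S. size_of P m = k} \<le> (card S + k - 1) choose k"
proof -
  obtain ws where ws: "set ws = S" "distinct ws" using finite_distinct_list[OF S(1)] by auto
  have len: "length ws = card S" using ws distinct_card by fastforce
  have size: "size_of P m = sum_list (map m ws)" if "m \<in> counts_on S" for m
  proof -
    have "size_of P m = sum m S"
      unfolding size_of_def using S that by (intro sum.mono_neutral_right) (auto simp: counts_on_def)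
    then show ?thesis using ws by (metis sum_list_distinct_conv_sum_set)
  qed
  have "card {m \<in> counts_on S. size_of P m = k} \<le> card {l :: nat list. length l = card S \<and> sum_list l = k}"
  proof (rule card_inj_on_le)
    show "inj_on (\<lambda>m. map m ws) {m \<in> counts_on S. size_of P m = k}"
    proof (rule inj_onI)
      fix m m' assume m: "m \<in> {m \<in> counts_on S. size_of P m = k}" "m' \<in> {m \<in> counts_on S. size_of P m = k}"
        and "map m ws = map m' ws"
      then have "m g = m' g" if "g \<in> S" for g using that ws by auto
      then show "m = m'" using m by (auto simp: counts_on_def fun_eq_iff) metis
    qed
    show "(\<lambda>m. map m ws) ` {m \<in> counts_on S. size_of P m = k} \<subseteq> {l. length l = card S \<and> sum_list l = k}"
      using size len by auto
    have "{l :: nat list. length l = card S \<and> sum_list l = k} \<subseteq> {l. set l \<subseteq> {..k} \<and> length l = card S}"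
      using member_le_sum_list by fastforce
    then show "finite {l :: nat list. length l = card S \<and> sum_list l = k}"
      by (rule finite_subset) (rule finite_lists_length_eq, simp)
  qed
  then show ?thesis by (simp add: card_length_sum_list add.commute)
qed

section \<open>The deterministic guarantee\<close>

context workflow_setting
begin

lemma candidates_props:
  assumes S: "S \<subseteq> workflows P"
  shows "finite (candidates P C S)" "card (candidates P C S) \<le> num_candidates C S"
    and "m \<in> candidates P C S \<Longrightarrow> m \<in> counts_on S"
    and "m \<in> candidates P C S \<Longrightarrow> m g \<le> Kmax P"
proof -
  have finS: "finite S" using S workflows by (rule finite_subset)
  have "candidates P C S \<subseteq> {m \<in> counts_on S. size_of P m \<le> Kmax P}"
    using grid by (fastforce simp: candidates_def counts_on_def size_of_def)
  then show fin: "finite (candidates P C S)"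
    using finite_sized_counts[OF finS S] by (rule finite_subset)
  have eq: "candidates P C S = {\<lambda>_. 0} \<union> (\<Union>k\<in>grid C. {m \<in> counts_on S. size_of P m = k})"
    by (auto simp: candidates_def)
  have "card (candidates P C S) \<le> card {\<lambda>_ :: 'g. 0 :: nat} + card (\<Union>k\<in>grid C. {m \<in> counts_on S. size_of P m = k})"
    unfolding eq by (rule card_Un_le)
  also have "card (\<Union>k\<in>grid C. {m \<in> counts_on S. size_of P m = k}) \<le> (\<Sum>k\<in>grid C. card {m \<in> counts_on S. size_of P m = k})"
    by (rule card_UN_le[OF finite_grid])
  also have "\<dots> \<le> (\<Sum>k\<in>grid C. (card S + k - 1) choose k)"
    by (intro sum_mono card_sized_counts finS S workflows)
  finally show "card (candidates P C S) \<le> num_candidates C S" by (simp add: num_candidates_def)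
  show mem: "m \<in> counts_on S" if "m \<in> candidates P C S"
    using that by (auto simp: candidates_def counts_on_def)
  show "m g \<le> Kmax P" if "m \<in> candidates P C S"
  proof (cases "g \<in> workflows P")
    case True
    have "size_of P m \<le> Kmax P" using that grid by (auto simp: candidates_def size_of_def)
    moreover have "m g \<le> size_of P m" unfolding size_of_def using True workflows by (intro member_le_sum) auto
    ultimately show ?thesis by simp
  next
    case False
    then show ?thesis using mem[OF that] S by (auto simp: counts_on_def)
  qed
qed

lemma num_candidates_pos: "1 \<le> num_candidates C S"
  by (simp add: num_candidates_def)

lemma eps_samp_arg: "0 \<le> ln (2 * real (num_candidates C S) / delta2 C)"
proof -
  have "1 \<le> 2 * real (num_candidates C S) / delta2 C"
    using num_candidates_pos[of S] delta2 by (simp add: le_divide_eq)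
  then show ?thesis by simp
qed

lemma eps_a_arg: "0 \<le> ln (2 * real (tasks P) * real (card (workflows P)) / delta1 C)"
proof -
  have "1 \<le> card (workflows P)" using workflows workflows_nonempty by (simp add: Suc_le_eq card_gt_0_iff)
  then have "1 * 1 \<le> real (tasks P) * real (card (workflows P))" using tasks by (intro mult_mono) auto
  then have "1 \<le> 2 * real (tasks P) * real (card (workflows P)) / delta1 C"
    using delta1 by (simp add: le_divide_eq)
  then show ?thesis by simp
qed

lemma eps_nonneg: "0 \<le> eps_samp P C S" "0 \<le> eps_est P C" "0 \<le> eps_rnd P C"
proof -
  show "0 \<le> eps_samp P C S" unfolding eps_samp_def using eps_samp_arg[of S] by simp
  have "0 \<le> eps_a P C" unfolding eps_a_def using eps_a_arg by simp
  then show "0 \<le> eps_est P C" by (simp add: eps_est_def)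
  obtain k where k: "k \<in> grid C" using grid_nonempty by blast
  then have kK: "k \<in> {1..Kmax P}" using grid by blast
  interpret curve: recovery_curve "curve P k" k by (rule recovery_curve[OF kK])
  have "0 \<le> curvature P k"
    unfolding curvature_def increment_eq[OF kK] using curve.curvature_ge by linarith
  then have "0 \<le> curvature P k / exp 1" by simp
  also have "\<dots> \<le> eps_rnd P C" unfolding eps_rnd_def using finite_grid k by (intro Max_ge) auto
  finally show "0 \<le> eps_rnd P C" .
qed

definition stage1_ok :: "(nat \<times> 'g \<times> nat \<Rightarrow> bool) \<Rightarrow> bool" where
  "stage1_ok z1 \<longleftrightarrow> (\<forall>i\<in>{1..tasks P}. \<forall>g\<in>workflows P. \<bar>est1 C z1 i g - acc P i g\<bar> \<le> eps_a P C)"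

definition stage2_ok :: "'g set \<Rightarrow> (nat \<times> nat \<times> 'g \<times> nat \<Rightarrow> bool) \<Rightarrow> bool" where
  "stage2_ok S z2 \<longleftrightarrow> (\<forall>m\<in>candidates P C S. \<bar>final_estimate P C S z2 m - stoch_value P m\<bar> \<le> eps_samp P C S)"

text \<open>An accepted maximizer meets both bounds by uniform closeness. A rejection shows that no
  candidate has a large value, so the baseline is then good enough for both.\<close>

lemma final_choice_value:
  assumes S: "init_pool C \<subseteq> S" "S \<subseteq> workflows P" and gs: "set gs \<subseteq> S" "length gs \<in> grid C"
    and X: "X \<le> list_value P (acc P) gs" and ok: "stage2_ok S z2"
  shows "max (lower_bound C) (X - 2 * eps_samp P C S) \<le> stoch_value P (final_choice P C S z2)"
proof -
  define m where "m = arg_max_on (final_estimate P C S z2) (candidates P C S)"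
  have ne: "candidates P C S \<noteq> {}" by (simp add: candidates_def)
  note m = arg_max_on_finite[where f = "final_estimate P C S z2", OF candidates_props(1)[OF S(2)] ne, folded m_def]
  have gsW: "set gs \<subseteq> workflows P" using gs S by blast
  have "gs \<noteq> []" using gs grid by auto
  have mem: "count_list gs \<in> candidates P C S"
    using gs gsW workflows count_list_in_counts_on[OF gs(1)] by (auto simp: candidates_def size_of_count_list)
  have close: "\<bar>final_estimate P C S z2 m' - stoch_value P m'\<bar> \<le> eps_samp P C S" if "m' \<in> candidates P C S" for m'
    using ok that by (simp add: stage2_ok_def)
  have "X \<le> stoch_value P (count_list gs)"
    using X stoch_value_count_list'[OF gsW \<open>gs \<noteq> []\<close>] by simp
  then have est: "X - eps_samp P C S \<le> final_estimate P C S z2 m"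
    using close[OF mem] m(2)[OF mem] by linarith
  show ?thesis
  proof (cases "lower_bound C \<le> final_estimate P C S z2 m - eps_samp P C S")
    case True
    then have "final_choice P C S z2 = m" by (simp add: final_choice_def m_def[symmetric] Let_def)
    have "lower_bound C \<le> stoch_value P m" "X - 2 * eps_samp P C S \<le> stoch_value P m"
      using True est close[OF m(1)] by linarith+
    then show ?thesis using \<open>final_choice P C S z2 = m\<close> by simp
  next
    case False
    then have "final_choice P C S z2 = baseline C" by (simp add: final_choice_def m_def[symmetric] Let_def)
    \<comment> \<open>Rejection means that the best estimate is below
      \<open>lower_bound C + eps_samp P C S\<close>, hence \<open>X - 2 * eps_samp P C S\<close> is
      below \<open>lower_bound C\<close>.\<close>
    then show ?thesis using False est baseline(2) by simp
  qed
qed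

theorem guarantee:
  assumes y: "\<And>j. y j \<in> workflows P" and ok: "stage1_ok z1" "oracle_ok z1 y"
    "stage2_ok (frozen_pool P C z1 y) z2"
  defines "S \<equiv> frozen_pool P C z1 y" and "m \<equiv> returned P C z1 y z2"
  shows "max (lower_bound C)
      (1 / \<rho> * stoch_opt P - eps_ell C - eps_rnd P C - 2 * eps_est P C - 2 * eps_samp P C S) \<le> stoch_value P m"
    and "1 / \<rho> * (lower_bound C /
      (lower_bound C + eps_ell C + eps_rnd P C + 2 * eps_est P C + 2 * eps_samp P C S)) * stoch_opt P
      \<le> stoch_value P m"
proof -
  note S = frozen_pool_props[where y = y and ?z1.0 = z1, OF y, folded S_def]
  obtain k gs where k: "k \<in> grid C" and gs: "set gs \<subseteq> workflows P" "length gs = k"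
    and opt: "1 / \<rho> * stoch_opt P \<le> list_value P (acc P) gs" by (rule covering_portfolio)
  obtain gs' where gs': "set gs' \<subseteq> S" "length gs' = k"
    and val: "list_value P (est1 C z1) gs - eps_ell C - eps_rnd P C \<le> list_value P (est1 C z1) gs'"
    using frozen_pool_portfolio[OF k y ok(2) gs] by (auto simp: S_def)
  have kK: "k \<in> {1..Kmax P}" using k grid by blast
  \<comment> \<open>Applied twice, to the covering portfolio and to the one found in the pool; hence
    the factor 2 of \<open>eps_est\<close>.\<close>
  have est: "\<bar>list_value P (est1 C z1) hs - list_value P (acc P) hs\<bar> \<le> eps_est P C"
    if "set hs \<subseteq> workflows P" "length hs = k" for hs
    unfolding eps_est_def
  proof (rule list_value_perturb)
    show "est1 C z1 i g \<in> {0..1} \<and> \<bar>est1 C z1 i g - acc P i g\<bar> \<le> eps_a P C"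
      if "i \<in> {1..tasks P}" "g \<in> workflows P" for i g
      using ok(1) that est1_range[OF sizes(1)] by (simp add: stage1_ok_def)
  qed (use that kK in auto)
  have "set gs' \<subseteq> workflows P" using gs' S by blast
  then have "1 / \<rho> * stoch_opt P - eps_ell C - eps_rnd P C - 2 * eps_est P C \<le> list_value P (acc P) gs'"
    using est[OF gs] est[of gs'] gs' opt val by simp
  then have main: "max (lower_bound C)
      (1 / \<rho> * stoch_opt P - eps_ell C - eps_rnd P C - 2 * eps_est P C - 2 * eps_samp P C S) \<le> stoch_value P m"
    unfolding m_def returned_def S_def[symmetric]
    using S gs' k ok(3) by (intro final_choice_value) (auto simp: S_def)
  then show "max (lower_bound C)
      (1 / \<rho> * stoch_opt P - eps_ell C - eps_rnd P C - 2 * eps_est P C - 2 * eps_samp P C S) \<le> stoch_value P m" .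
  define e where "e = eps_ell C + eps_rnd P C + 2 * eps_est P C + 2 * eps_samp P C S"
  have "lower_bound C / (lower_bound C + e) * (1 / \<rho> * stoch_opt P) \<le> stoch_value P m"
  proof (rule weighted_max_bound)
    show "max (lower_bound C) (1 / \<rho> * stoch_opt P - e) \<le> stoch_value P m"
      using main by (simp add: e_def algebra_simps)
    show "0 \<le> e" using eps_nonneg(1)[of S] eps_nonneg(2,3) eps_ell by (simp add: e_def)
  qed (rule baseline(3))
  then show "1 / \<rho> * (lower_bound C /
      (lower_bound C + eps_ell C + eps_rnd P C + 2 * eps_est P C + 2 * eps_samp P C S)) * stoch_opt P
      \<le> stoch_value P m"
    by (simp add: e_def add.assoc mult_ac)
qed

end

section \<open>Events determined by finitely many others\<close>

text \<open>All random quantities below are determined by finitely many discrete observations, which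
  makes them measurable although the panels are indexed by the whole type.\<close>

definition same_side :: "'w set set \<Rightarrow> 'w \<Rightarrow> 'w \<Rightarrow> bool" where
  "same_side \<A> w v \<longleftrightarrow> (\<forall>A\<in>\<A>. w \<in> A \<longleftrightarrow> v \<in> A)"

text \<open>The value depends only on which members of the family contain the point, and a finite
  family has finitely many such traces.\<close>

lemma determined_finite_image:
  assumes "finite \<A>" and f: "\<And>w v. w \<in> X \<Longrightarrow> v \<in> X \<Longrightarrow> same_side \<A> w v \<Longrightarrow> f w = f v"
  shows "finite (f ` X)"
proof -
  define t where "t w = {A \<in> \<A>. w \<in> A}" for w
  have "f w = f (SOME v. v \<in> X \<and> t v = t w)" if "w \<in> X" for w
  proof -
    have "\<exists>v. v \<in> X \<and> t v = t w" using that by blast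
    then have v: "(SOME v. v \<in> X \<and> t v = t w) \<in> X \<and> t (SOME v. v \<in> X \<and> t v = t w) = t w"
      by (rule someI_ex)
    have "same_side \<A> w (SOME v. v \<in> X \<and> t v = t w)"
      using v unfolding same_side_def t_def by blast
    with that v show ?thesis by (intro f) auto
  qed
  then have "f ` X \<subseteq> (\<lambda>T. f (SOME v. v \<in> X \<and> t v = T)) ` Pow \<A>"
    by (auto simp: t_def)
  then show ?thesis by (rule finite_subset) (simp add: assms(1))
qed

text \<open>The set is a finite union of atoms of the algebra generated by the family.\<close>

lemma determined_sets:
  assumes \<A>: "finite \<A>" "\<A> \<subseteq> sets N"
    and Q: "\<And>w v. w \<in> space N \<Longrightarrow> v \<in> space N \<Longrightarrow> same_side \<A> w v \<Longrightarrow> Q w = Q v"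
  shows "{w \<in> space N. Q w} \<in> sets N"
proof -
  define atom where "atom w = {v \<in> space N. same_side \<A> w v}" for w
  have "atom w \<in> sets N" for w
  proof -
    have "atom w = {v \<in> space N. \<forall>A\<in>\<A>. v \<in> (if w \<in> A then A else space N - A)}"
      by (auto simp: atom_def same_side_def split: if_splits)
    also have "\<dots> \<in> sets N"
    proof (rule sets.sets_Collect_finite_All[OF _ \<A>(1)])
      fix A assume "A \<in> \<A>"
      then have "(if w \<in> A then A else space N - A) \<in> sets N" using \<A>(2) by auto
      moreover from this have "{v \<in> space N. v \<in> (if w \<in> A then A else space N - A)} = (if w \<in> A then A else space N - A)"
        using sets.sets_into_space by blast
      ultimately show "{v \<in> space N. v \<in> (if w \<in> A then A else space N - A)} \<in> sets N" by simp
    qed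
    finally show ?thesis .
  qed
  moreover have "finite (atom ` {w \<in> space N. Q w})"
  proof (rule determined_finite_image[OF \<A>(1)])
    show "atom w = atom v" if "same_side \<A> w v" for w v
      using that by (auto simp: atom_def same_side_def)
  qed
  ultimately have "\<Union> (atom ` {w \<in> space N. Q w}) \<in> sets N"
    by (intro sets.finite_Union) auto
  moreover have "\<Union> (atom ` {w \<in> space N. Q w}) = {w \<in> space N. Q w}"
    using Q by (auto simp: atom_def same_side_def)
  ultimately show ?thesis by simp
qed

lemma (in prob_space) hoeffding_mean:
  fixes X :: "'b \<Rightarrow> 'a \<Rightarrow> real"
  assumes I: "finite I" "I \<noteq> {}" and ind: "indep_vars (\<lambda>_. borel) X I"
    and range: "\<And>i w. i \<in> I \<Longrightarrow> X i w \<in> {0..1}" and \<epsilon>: "0 \<le> \<epsilon>"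
  shows "prob {w \<in> space M. \<epsilon> < \<bar>(\<Sum>i\<in>I. X i w) / real (card I) - (\<Sum>i\<in>I. expectation (X i)) / real (card I)\<bar>}
    \<le> 2 * exp (- 2 * real (card I) * \<epsilon>\<^sup>2)"
proof -
  define n where "n = real (card I)"
  have n: "n > 0" using I by (simp add: n_def card_gt_0_iff)
  interpret H: Hoeffding_ineq M I X "\<lambda>_. 0" "\<lambda>_. 1" "\<Sum>i\<in>I. expectation (X i)"
    by unfold_locales (use I ind range in auto)
  have [measurable]: "X i \<in> borel_measurable M" if "i \<in> I" for i
    using ind that by (auto simp: indep_vars_def)
  have "prob {w \<in> space M. \<epsilon> < \<bar>(\<Sum>i\<in>I. X i w) / n - (\<Sum>i\<in>I. expectation (X i)) / n\<bar>}
      \<le> prob {w \<in> space M. \<bar>(\<Sum>i\<in>I. X i w) - (\<Sum>i\<in>I. expectation (X i))\<bar> \<ge> \<epsilon> * n}"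
  proof (rule finite_measure_mono)
    show "{w \<in> space M. \<epsilon> < \<bar>(\<Sum>i\<in>I. X i w) / n - (\<Sum>i\<in>I. expectation (X i)) / n\<bar>}
        \<subseteq> {w \<in> space M. \<bar>(\<Sum>i\<in>I. X i w) - (\<Sum>i\<in>I. expectation (X i))\<bar> \<ge> \<epsilon> * n}"
      using n by (auto simp: diff_divide_distrib[symmetric] pos_less_divide_eq)
    show "{w \<in> space M. \<bar>(\<Sum>i\<in>I. X i w) - (\<Sum>i\<in>I. expectation (X i))\<bar> \<ge> \<epsilon> * n} \<in> events"
      by measurable
  qed
  also have "\<dots> \<le> 2 * exp (- 2 * (\<epsilon> * n)\<^sup>2 / (\<Sum>i\<in>I. (1 - 0)\<^sup>2))"
    by (rule H.Hoeffding_ineq_abs_ge) (use \<epsilon> n I in \<open>auto simp: n_def\<close>)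
  also have "- 2 * (\<epsilon> * n)\<^sup>2 / (\<Sum>i\<in>I. (1 - 0)\<^sup>2) = - 2 * n * \<epsilon>\<^sup>2"
    using n by (simp add: n_def power2_eq_square)
  finally show ?thesis by (simp add: n_def)
qed

section \<open>Locality of the generation phase\<close>

lemma arg_max_on_cong: "(\<And>x. x \<in> A \<Longrightarrow> f x = g x) \<Longrightarrow> arg_max_on f A = arg_max_on g A"
  unfolding arg_max_on_def arg_max_def is_arg_max_def by (metis (no_types, lifting))

lemma central_cut_cong:
  assumes "\<And>v. v \<in> I \<Longrightarrow> a v = a' v"
  shows "central_cut I a E = central_cut I a' E"
  using assms by (cases E) (simp add: central_cut_def Let_def)

definition agree1 :: "'g problem \<Rightarrow> 'g config \<Rightarrow> (nat \<times> 'g \<times> nat \<Rightarrow> bool) \<Rightarrow> (nat \<times> 'g \<times> nat \<Rightarrow> bool) \<Rightarrow> bool" where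
  "agree1 P C z z' \<longleftrightarrow> (\<forall>x\<in>stage1_index P C. z x = z' x)"

lemma est1_cong:
  assumes "agree1 P C z z'" "i \<in> {1..tasks P}" "g \<in> workflows P"
  shows "est1 C z i g = est1 C z' i g"
  using assms by (simp add: est1_def agree1_def stage1_index_def)

lemma score_cong:
  assumes "agree1 P C z z'" "g \<in> workflows P"
  shows "score P C z k q \<mu> g = score P C z' k q \<mu> g"
  unfolding score_def plug_correct_def
  by (intro arg_cong2[where f = "(-)"] sum.cong refl arg_cong2[where f = "(*)"])
    (simp add: est1_cong[OF assms(1) _ assms(2)])

lemma workflow_normal_cong:
  assumes "agree1 P C z z'" "g \<in> workflows P" "v \<in> dvars P C k"
  shows "workflow_normal P C z k q g v = workflow_normal P C z' k q g v"
  using assms(3) est1_cong[OF assms(1) _ assms(2)]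
  by (auto simp: workflow_normal_def dvars_def plug_correct_def)

text \<open>A step reads panels of proposed workflows only, and answers only of the batches it logs.
  \<open>B\<close> bounds the log after the step, so all \<open>k\<close> new batches lie within the
  answers on which \<open>y\<close> and \<open>y'\<close> agree.\<close>

lemma ell_step_cong:
  assumes z: "agree1 P C z z'" and y: "\<And>j. y j \<in> workflows P"
    and m: "batch_size C \<ge> 1"
    and B: "length (qlog (fst (ell_step P C z y k (S, E)))) \<le> B"
    and y': "\<And>j. j < B * batch_size C \<Longrightarrow> y' j = y j"
  shows "ell_step P C z' y' k (S, E) = ell_step P C z y k (S, E)"
proof (cases "explicit_ok P C k (fst E)")
  case False
  then have "{c \<in> explicit_constraints P C k. violated (dvars P C k) (fst E) c} \<noteq> {}"
    by (auto simp: explicit_ok_def)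
  then show ?thesis unfolding ell_step_def Let_def by simp
next
  case True
  define \<mu> where "\<mu> = (\<lambda>i \<omega>. fst E (Mu i \<omega>))"
  define ans where "ans = (\<lambda>q. batch_answers C y (length (qlog S) + q - 1))"
  define best where "best z = (\<lambda>q. arg_max_on (score P C z k q \<mu>) (ans q))" for z
  define Q where "Q z = {q \<in> {1..k}. score P C z k q \<mu> (best z q) > fst E (Th q)}" for z
  have step: "ell_step P C z y k (S, E) =
    (S\<lparr>pool := pool S \<union> (\<Union>q\<in>{1..k}. ans q), qlog := qlog S @ map (\<lambda>q. (k, q, \<mu>)) [1..<Suc k]\<rparr>,
     central_cut (dvars P C k) (if Q z = {} then objective_normal P C k
       else workflow_normal P C z k (Min (Q z)) (best z (Min (Q z)))) E)" for z
    unfolding ans_def best_def Q_def \<mu>_def by (rule ell_step_ok[OF True])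
  have len: "length (qlog S) + k \<le> B" using B by (simp add: step del: upt_Suc)
  have ans': "batch_answers C y' (length (qlog S) + q - 1) = ans q" if q: "q \<in> {1..k}" for q
  proof -
    have "Suc (length (qlog S) + q - 1) * batch_size C \<le> B * batch_size C"
      using len q by (intro mult_right_mono) auto
    then show ?thesis unfolding ans_def batch_answers_def by (intro image_cong refl y') auto
  qed
  have ansW: "ans q \<subseteq> workflows P" for q using y by (auto simp: ans_def batch_answers_def)
  have sc: "score P C z' k q \<mu> g = score P C z k q \<mu> g" if "g \<in> ans q'" for q q' g
    using score_cong[OF z subsetD[OF ansW that]] by (rule sym)
  have best: "best z' q = best z q" for q
    unfolding best_def by (rule arg_max_on_cong) (rule sc)
  have mem: "best z q \<in> ans q" for q
    unfolding best_def ans_def using m by (intro arg_max_on_finite) (auto simp: batch_answers_def)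
  have Q: "Q z' = Q z" unfolding Q_def best by (simp only: sc[OF mem])
  have wn: "workflow_normal P C z' k q (best z q') v = workflow_normal P C z k q (best z q') v"
    if "v \<in> dvars P C k" for q q' v
    using workflow_normal_cong[OF z subsetD[OF ansW mem] that] by (rule sym)
  have "ell_step P C z' y' k (S, E) =
    (S\<lparr>pool := pool S \<union> (\<Union>q\<in>{1..k}. ans q), qlog := qlog S @ map (\<lambda>q. (k, q, \<mu>)) [1..<Suc k]\<rparr>,
     central_cut (dvars P C k) (if Q z' = {} then objective_normal P C k
       else workflow_normal P C z' k (Min (Q z')) (best z' (Min (Q z')))) E)"
  proof -
    define best' where "best' q = arg_max_on (score P C z' k q \<mu>) (batch_answers C y' (length (qlog S) + q - 1))" for q
    have best': "best' q = best z' q" if "q \<in> {1..k}" for q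
      unfolding best'_def best_def ans'[OF that] ..
    have Q': "{q \<in> {1..k}. score P C z' k q \<mu> (best' q) > fst E (Th q)} = Q z'"
      unfolding Q_def using best' by auto
    have U: "(\<Union>q\<in>{1..k}. batch_answers C y' (length (qlog S) + q - 1)) = (\<Union>q\<in>{1..k}. ans q)"
      using ans' by simp
    \<comment> \<open>The answers are known to agree only for columns in \<open>{1..k}\<close>, and
      the minimum is such a column only for nonempty \<open>Q z'\<close>.\<close>
    have M: "best' (Min (Q z')) = best z' (Min (Q z'))" if "Q z' \<noteq> {}"
    proof -
      have "finite (Q z')" by (simp add: Q_def)
      then have "Min (Q z') \<in> Q z'" using that by (rule Min_in)
      then show ?thesis by (intro best') (simp add: Q_def)
    qed
    have "ell_step P C z' y' k (S, E) =
      (S\<lparr>pool := pool S \<union> (\<Union>q\<in>{1..k}. batch_answers C y' (length (qlog S) + q - 1)), qlog := qlog S @ map (\<lambda>q. (k, q, \<mu>)) [1..<Suc k]\<rparr>,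
       central_cut (dvars P C k) (if {q \<in> {1..k}. score P C z' k q \<mu> (best' q) > fst E (Th q)} = {} then objective_normal P C k
         else workflow_normal P C z' k (Min {q \<in> {1..k}. score P C z' k q \<mu> (best' q) > fst E (Th q)})
          (best' (Min {q \<in> {1..k}. score P C z' k q \<mu> (best' q) > fst E (Th q)}))) E)"
      unfolding best'_def \<mu>_def by (rule ell_step_ok[OF True])
    then show ?thesis unfolding Q' U using M by simp
  qed
  also have "\<dots> = ell_step P C z y k (S, E)"
    unfolding step Q best by (intro arg_cong2[where f = Pair] refl central_cut_cong) (simp add: wn)
  finally show ?thesis .
qed

lemma gen_le_length: "gen_le S S' \<Longrightarrow> length (qlog S) \<le> length (qlog S')"
  by (auto simp: gen_le_def)

context
  fixes P :: "'g problem" and C :: "'g config" and z z' y y' B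
  assumes z: "agree1 P C z z'" and y: "\<And>j. y j \<in> workflows P" and m: "batch_size C \<ge> 1"
    and y': "\<And>j. j < B * batch_size C \<Longrightarrow> y' j = y j"
begin

lemma ell_iter_cong:
  assumes "length (qlog (fst ((ell_step P C z y k ^^ t) X))) \<le> B"
  shows "(ell_step P C z' y' k ^^ t) X = (ell_step P C z y k ^^ t) X"
  using assms
proof (induction t)
  case (Suc t)
  let ?X = "(ell_step P C z y k ^^ t) X"
  have le: "length (qlog (fst (ell_step P C z y k (fst ?X, snd ?X)))) \<le> B" using Suc.prems by simp
  then have "length (qlog (fst ?X)) \<le> B"
    using gen_le_length[OF ell_step_le[of "fst ?X" P C z y k "snd ?X"]] by linarith
  then have "(ell_step P C z' y' k ^^ t) X = ?X" by (rule Suc.IH)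
  then show ?case using ell_step_cong[OF z y m le y'] by simp
qed simp

lemma fold_ell_run_cong:
  assumes "length (qlog (fold (ell_run P C z y) ks S)) \<le> B"
  shows "fold (ell_run P C z' y') ks S = fold (ell_run P C z y) ks S"
  using assms
proof (induction ks arbitrary: S)
  case (Cons k ks)
  have "length (qlog (ell_run P C z y k S)) \<le> length (qlog (fold (ell_run P C z y) ks (ell_run P C z y k S)))"
    by (rule gen_le_length[OF fold_ell_run_le])
  also have "\<dots> \<le> B" using Cons.prems by simp
  finally have "ell_run P C z' y' k S = ell_run P C z y k S"
    unfolding ell_run_def by (subst ell_iter_cong) auto
  then show ?case using Cons by simp
qed simp

lemma generation_cong:
  "length (qlog (generation P C z y)) \<le> B \<Longrightarrow> generation P C z' y' = generation P C z y"
  unfolding generation_def by (rule fold_ell_run_cong)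

lemma call_good_cong:
  assumes B: "length (qlog (generation P C z y)) \<le> B" and j: "j < B * batch_size C"
  shows "call_good P C z' y' j = call_good P C z y j"
proof -
  have "score P C z' k q \<mu> ` workflows P = score P C z k q \<mu> ` workflows P" for k q \<mu>
    using score_cong[OF z] by (intro image_cong) auto
  then show ?thesis
    unfolding call_good_def generation_cong[OF B] y'[OF j] by (simp add: score_cong[OF z y])
qed

lemma query_history_cong:
  assumes B: "length (qlog (generation P C z y)) \<le> B" and j: "j < B * batch_size C"
  shows "query_history P C z' y' j = query_history P C z y j"
  unfolding query_history_def generation_cong[OF B]
  using call_good_cong[OF B] y' j by (auto intro!: map_cong)

end

section \<open>The random events\<close>

locale workflow_run = workflow_setting P C h \<rho> + prob_space M
  for P :: "'g problem" and C :: "'g config" and h :: "real \<Rightarrow> real" and \<rho> :: real and M :: "'w measure" +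
  fixes p_orc :: real and N_price :: nat
    and Z1 :: "nat \<times> 'g \<times> nat \<Rightarrow> 'w \<Rightarrow> bool"
    and Y :: "nat \<Rightarrow> 'w \<Rightarrow> 'g"
    and Z2 :: "nat \<times> nat \<times> 'g \<times> nat \<Rightarrow> 'w \<Rightarrow> bool"
  assumes stage1_indep: "indep_vars (\<lambda>_. count_space UNIV) Z1 (stage1_index P C)"
    and stage1_distr: "\<And>i g l. (i, g, l) \<in> stage1_index P C \<Longrightarrow>
      distr M (count_space UNIV) (Z1 (i, g, l)) = measure_pmf (bernoulli_pmf (acc P i g))"
    and stage2_indep: "indep_vars (\<lambda>_. count_space UNIV) Z2 (stage2_index P C)"
    and stage2_distr: "\<And>l i g q. (l, i, g, q) \<in> stage2_index P C \<Longrightarrow>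
      distr M (count_space UNIV) (Z2 (l, i, g, q)) = measure_pmf (bernoulli_pmf (acc P i g))"
    and answers: "\<And>j. Y j \<in> measurable M (count_space (workflows P))"
    and stages_indep: "indep_set
      (sets (vimage_algebra (space M)
        (\<lambda>w. (\<lambda>x\<in>stage1_index P C. Z1 x w, \<lambda>j. Y j w))
        (PiM (stage1_index P C) (\<lambda>_. count_space UNIV) \<Otimes>\<^sub>M PiM UNIV (\<lambda>_. count_space (workflows P)))))
      (sets (vimage_algebra (space M)
        (\<lambda>w. \<lambda>x\<in>stage2_index P C. Z2 x w)
        (PiM (stage2_index P C) (\<lambda>_. count_space UNIV))))"
    and pricing_calls: "\<And>j w. w \<in> space M \<Longrightarrow> call_made P C (\<lambda>x. Z1 x w) (\<lambda>j. Y j w) j \<Longrightarrow>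
      prob {v \<in> space M. query_history P C (\<lambda>x. Z1 x v) (\<lambda>j. Y j v) j =
                              query_history P C (\<lambda>x. Z1 x w) (\<lambda>j. Y j w) j} > 0 \<Longrightarrow>
      cond_prob M
        (\<lambda>v. call_good P C (\<lambda>x. Z1 x v) (\<lambda>j. Y j v) j)
        (\<lambda>v. query_history P C (\<lambda>x. Z1 x v) (\<lambda>j. Y j v) j =
             query_history P C (\<lambda>x. Z1 x w) (\<lambda>j. Y j w) j) \<ge> p_orc"
    and N_price: "\<And>w. w \<in> space M \<Longrightarrow>
      length (qlog (generation P C (\<lambda>x. Z1 x w) (\<lambda>j. Y j w))) \<le> N_price"
begin

definition z1 :: "'w \<Rightarrow> nat \<times> 'g \<times> nat \<Rightarrow> bool" where "z1 w = (\<lambda>x. Z1 x w)"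
definition ys :: "'w \<Rightarrow> nat \<Rightarrow> 'g" where "ys w = (\<lambda>j. Y j w)"
definition z2 :: "'w \<Rightarrow> nat \<times> nat \<times> 'g \<times> nat \<Rightarrow> bool" where "z2 w = (\<lambda>x. Z2 x w)"

definition n_calls :: nat where "n_calls = N_price * batch_size C"

text \<open>Finitely many events that decide everything in the generation phase: calls numbered from
  \<open>n_calls\<close> on are never made.\<close>

definition obs1 :: "'w set set" where
  "obs1 = (\<lambda>x. {w \<in> space M. Z1 x w}) ` stage1_index P C
    \<union> (\<lambda>(j, g). {w \<in> space M. Y j w = g}) ` ({..<n_calls} \<times> workflows P)"

definition obs2 :: "'w set set" where
  "obs2 = (\<lambda>x. {w \<in> space M. Z2 x w}) ` stage2_index P C"

lemma finite_index: "finite (stage1_index P C)" "finite (stage2_index P C)"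
  using workflows by (simp_all add: stage1_index_def stage2_index_def)

lemma finite_obs: "finite obs1" "finite obs2"
  using workflows finite_index by (simp_all add: obs1_def obs2_def)

lemma Y_workflows: "w \<in> space M \<Longrightarrow> Y j w \<in> workflows P"
  using measurable_space[OF answers] by simp

lemma ys_workflows: "w \<in> space M \<Longrightarrow> ys w j \<in> workflows P"
  by (simp add: ys_def Y_workflows)

definition algebra1 :: "'w measure" where
  "algebra1 = vimage_algebra (space M) (\<lambda>w. (\<lambda>x\<in>stage1_index P C. Z1 x w, \<lambda>j. Y j w))
    (PiM (stage1_index P C) (\<lambda>_. count_space UNIV) \<Otimes>\<^sub>M PiM UNIV (\<lambda>_. count_space (workflows P)))"

definition algebra2 :: "'w measure" where
  "algebra2 = vimage_algebra (space M) (\<lambda>w. \<lambda>x\<in>stage2_index P C. Z2 x w)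
    (PiM (stage2_index P C) (\<lambda>_. count_space UNIV))"

lemma space_algebra [simp]: "space algebra1 = space M" "space algebra2 = space M"
  by (simp_all add: algebra1_def algebra2_def)

lemma indep_algebras: "indep_set (sets algebra1) (sets algebra2)"
  using stages_indep by (simp add: algebra1_def algebra2_def)

lemma obs1_sets: "obs1 \<subseteq> sets algebra1"
proof -
  let ?N1 = "PiM (stage1_index P C) (\<lambda>_. count_space UNIV :: bool measure)"
  let ?N2 = "PiM UNIV (\<lambda>_ :: nat. count_space (workflows P))"
  have meas: "(\<lambda>w. (\<lambda>x\<in>stage1_index P C. Z1 x w, \<lambda>j. Y j w)) \<in> measurable algebra1 (?N1 \<Otimes>\<^sub>M ?N2)"
    unfolding algebra1_def
    by (rule measurable_vimage_algebra1) (auto simp: space_pair_measure space_PiM Y_workflows)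
  have m1: "(\<lambda>w. \<lambda>x\<in>stage1_index P C. Z1 x w) \<in> measurable algebra1 ?N1"
    and m2: "(\<lambda>w. \<lambda>j. Y j w) \<in> measurable algebra1 ?N2"
    using measurable_fst'[OF meas] measurable_snd'[OF meas] by simp_all
  have "{w \<in> space M. Z1 x w} \<in> sets algebra1" if "x \<in> stage1_index P C" for x
  proof -
    have "(\<lambda>w. (\<lambda>x\<in>stage1_index P C. Z1 x w) x) \<in> measurable algebra1 (count_space UNIV)"
      using m1 that by (rule measurable_compose[OF _ measurable_component_singleton])
    then have "(\<lambda>w. Z1 x w) \<in> measurable algebra1 (count_space UNIV)" using that by simp
    from measurable_sets[OF this, of "{True}"] show ?thesis by (simp add: vimage_def Int_def conj_commute)
  qed
  moreover have "{w \<in> space M. Y j w = g} \<in> sets algebra1" if "g \<in> workflows P" for j g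
  proof -
    have "(\<lambda>w. Y j w) \<in> measurable algebra1 (count_space (workflows P))"
      using m2 by (rule measurable_compose[OF _ measurable_component_singleton]) simp
    from measurable_sets[OF this, of "{g}"] show ?thesis using that by (simp add: vimage_def Int_def conj_commute)
  qed
  ultimately show ?thesis by (auto simp: obs1_def)
qed

lemma obs2_sets: "obs2 \<subseteq> sets algebra2"
proof -
  let ?N = "PiM (stage2_index P C) (\<lambda>_. count_space UNIV :: bool measure)"
  have meas: "(\<lambda>w. \<lambda>x\<in>stage2_index P C. Z2 x w) \<in> measurable algebra2 ?N"
    unfolding algebra2_def by (rule measurable_vimage_algebra1) (auto simp: space_PiM)
  have "{w \<in> space M. Z2 x w} \<in> sets algebra2" if "x \<in> stage2_index P C" for x
  proof -
    have "(\<lambda>w. (\<lambda>x\<in>stage2_index P C. Z2 x w) x) \<in> measurable algebra2 (count_space UNIV)"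
      using meas that by (rule measurable_compose[OF _ measurable_component_singleton])
    then have "(\<lambda>w. Z2 x w) \<in> measurable algebra2 (count_space UNIV)" using that by simp
    from measurable_sets[OF this, of "{True}"] show ?thesis by (simp add: vimage_def Int_def conj_commute)
  qed
  then show ?thesis by (auto simp: obs2_def)
qed

lemma algebra_events: "sets algebra1 \<subseteq> events" "sets algebra2 \<subseteq> events"
  using indep_setD_ev1[OF indep_algebras] indep_setD_ev2[OF indep_algebras] by auto

lemma same_side_obs1:
  assumes "w \<in> space M" "v \<in> space M" "same_side obs1 w v"
  shows "agree1 P C (z1 w) (z1 v)" "\<And>j. j < n_calls \<Longrightarrow> ys v j = ys w j"
proof -
  have "Z1 x w = Z1 x v" if "x \<in> stage1_index P C" for x
  proof -
    have "{w \<in> space M. Z1 x w} \<in> obs1" using that by (auto simp: obs1_def)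
    then have "w \<in> {w \<in> space M. Z1 x w} \<longleftrightarrow> v \<in> {w \<in> space M. Z1 x w}"
      by (rule bspec[OF assms(3)[unfolded same_side_def]])
    then show ?thesis using assms by simp
  qed
  then show "agree1 P C (z1 w) (z1 v)" by (simp add: agree1_def z1_def)
  show "ys v j = ys w j" if "j < n_calls" for j
  proof -
    have "(\<lambda>(j, g). {w \<in> space M. Y j w = g}) (j, Y j w) \<in> obs1"
      unfolding obs1_def using that Y_workflows[OF assms(1)] by (intro UnI2 imageI) auto
    then have "{v \<in> space M. Y j v = Y j w} \<in> obs1" by (simp only: prod.case)
    then have "w \<in> {v \<in> space M. Y j v = Y j w} \<longleftrightarrow> v \<in> {v \<in> space M. Y j v = Y j w}"
      by (rule bspec[OF assms(3)[unfolded same_side_def]])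
    then show ?thesis using assms by (simp add: ys_def)
  qed
qed

lemma qlog_length: "w \<in> space M \<Longrightarrow> length (qlog (generation P C (z1 w) (ys w))) \<le> N_price"
  using N_price by (simp add: z1_def ys_def)

lemma generation_determined:
  assumes "w \<in> space M" "v \<in> space M" "same_side obs1 w v"
  shows "generation P C (z1 w) (ys w) = generation P C (z1 v) (ys v)"
    and "j < n_calls \<Longrightarrow> call_good P C (z1 w) (ys w) j = call_good P C (z1 v) (ys v) j"
    and "j < n_calls \<Longrightarrow> query_history P C (z1 w) (ys w) j = query_history P C (z1 v) (ys v) j"
    and "stage1_ok (z1 w) = stage1_ok (z1 v)"
    and "oracle_ok (z1 w) (ys w) = oracle_ok (z1 v) (ys v)"
proof -
  note s = same_side_obs1[OF assms]
  note y = ys_workflows[OF assms(1)]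
  note len = qlog_length[OF assms(1)]
  show g: "generation P C (z1 w) (ys w) = generation P C (z1 v) (ys v)"
    using generation_cong[OF s(1) y sizes(3) s(2)[unfolded n_calls_def] len] by simp
  show c: "call_good P C (z1 w) (ys w) j = call_good P C (z1 v) (ys v) j" if "j < n_calls" for j
    using call_good_cong[OF s(1) y sizes(3) s(2)[unfolded n_calls_def] len] that by (simp add: n_calls_def)
  show "query_history P C (z1 w) (ys w) j = query_history P C (z1 v) (ys v) j" if "j < n_calls"
    using query_history_cong[OF s(1) y sizes(3) s(2)[unfolded n_calls_def] len] that by (simp add: n_calls_def)
  show "stage1_ok (z1 w) = stage1_ok (z1 v)"
    unfolding stage1_ok_def by (simp add: est1_cong[OF s(1)])
  \<comment> \<open>The calls of a logged batch lie in the range observed by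
    \<open>obs1\<close>.\<close>
  have "j < n_calls"
    if "b < length (qlog (generation P C (z1 v) (ys v)))" "j \<in> {b * batch_size C..<b * batch_size C + batch_size C}" for b j
  proof -
    have "Suc b * batch_size C \<le> N_price * batch_size C"
      using that(1) len unfolding g by (intro mult_right_mono) auto
    then show ?thesis using that(2) by (simp add: n_calls_def)
  qed
  then show "oracle_ok (z1 w) (ys w) = oracle_ok (z1 v) (ys v)"
    unfolding oracle_ok_def g using c by (metis (no_types, lifting))
qed

lemma determined_event:
  assumes "\<And>w v. w \<in> space M \<Longrightarrow> v \<in> space M \<Longrightarrow> same_side obs1 w v \<Longrightarrow> Q w = Q v"
  shows "{w \<in> space M. Q w} \<in> sets algebra1" "{w \<in> space M. Q w} \<in> events"
proof -
  have "{w \<in> space algebra1. Q w} \<in> sets algebra1"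
  proof (rule determined_sets[OF finite_obs(1) obs1_sets])
    fix w v assume "w \<in> space algebra1" "v \<in> space algebra1" "same_side obs1 w v"
    then show "Q w = Q v" unfolding space_algebra by (rule assms)
  qed
  then show "{w \<in> space M. Q w} \<in> sets algebra1" by (simp only: space_algebra)
  then show "{w \<in> space M. Q w} \<in> events" using algebra_events by blast
qed

lemma expectation_Z1:
  assumes "x \<in> stage1_index P C"
  shows "expectation (\<lambda>w. of_bool (Z1 x w)) = acc P (fst x) (fst (snd x))"
proof -
  obtain i g l where x: "x = (i, g, l)" by (cases x)
  have "Z1 x \<in> measurable M (count_space UNIV)" using stage1_indep assms by (auto simp: indep_vars_def)
  then have "expectation (\<lambda>w. of_bool (Z1 x w)) = integral\<^sup>L (distr M (count_space UNIV) (Z1 x)) (of_bool :: bool \<Rightarrow> real)"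
    by (subst integral_distr) auto
  also have "\<dots> = acc P i g"
    using stage1_distr[of i g l] assms acc[of i g] by (simp add: x stage1_index_def)
  finally show ?thesis by (simp add: x)
qed

lemma expectation_Z2:
  assumes "(l, i, g, q) \<in> stage2_index P C"
  shows "expectation (\<lambda>w. of_bool (Z2 (l, i, g, q) w)) = acc P i g"
proof -
  have "Z2 (l, i, g, q) \<in> measurable M (count_space UNIV)" using stage2_indep assms by (auto simp: indep_vars_def)
  then have "expectation (\<lambda>w. of_bool (Z2 (l, i, g, q) w)) =
      integral\<^sup>L (distr M (count_space UNIV) (Z2 (l, i, g, q))) (of_bool :: bool \<Rightarrow> real)"
    by (subst integral_distr) auto
  also have "\<dots> = acc P i g"
    using stage2_distr[of l i g q] assms acc[of i g] by (simp add: stage2_index_def)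
  finally show ?thesis .
qed

section \<open>Failure probabilities\<close>

text \<open>\<open>eps_a\<close> is chosen so that Hoeffding's bound for one panel is
  \<open>delta1\<close> divided by the number of panels; a union bound over tasks and workflows adds
  these up.\<close>

lemma stage1_failure: "prob {w \<in> space M. \<not> stage1_ok (z1 w)} \<le> delta1 C"
proof -
  define bad where "bad i g = {w \<in> space M. eps_a P C < \<bar>est1 C (z1 w) i g - acc P i g\<bar>}" for i g
  define c where "c = real (tasks P) * real (card (workflows P))"
  have c: "c > 0" using tasks workflows workflows_nonempty by (simp add: c_def card_gt_0_iff)
  have one: "prob (bad i g) \<le> delta1 C / c" and ev: "bad i g \<in> events"
    if ig: "i \<in> {1..tasks P}" "g \<in> workflows P" for i g
  proof -
    show "bad i g \<in> events" unfolding bad_def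
      by (rule determined_event(2)) (simp add: est1_cong[OF same_side_obs1(1) ig])
    define J where "J = Pair i ` Pair g ` {1..panel1 C}"
    have J: "J \<subseteq> stage1_index P C" using ig by (auto simp: J_def stage1_index_def)
    have card: "card J = panel1 C" unfolding J_def by (simp add: card_image inj_on_def)
    have sum: "(\<Sum>x\<in>J. f x) = (\<Sum>l=1..panel1 C. f (i, g, l))" for f :: "_ \<Rightarrow> real"
      unfolding J_def by (subst sum.reindex, simp add: inj_on_def, subst sum.reindex) (simp_all add: inj_on_def)
    have ind: "indep_vars (\<lambda>_. borel) (\<lambda>x w. of_bool (Z1 x w) :: real) J"
      by (rule indep_vars_compose2[OF indep_vars_subset[OF stage1_indep J]]) simp
    have ea: "0 \<le> eps_a P C" unfolding eps_a_def using eps_a_arg by simp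
    have "prob {w \<in> space M. eps_a P C < \<bar>(\<Sum>x\<in>J. of_bool (Z1 x w)) / real (card J)
        - (\<Sum>x\<in>J. expectation (\<lambda>w. of_bool (Z1 x w))) / real (card J)\<bar>}
      \<le> 2 * exp (- 2 * real (card J) * (eps_a P C)\<^sup>2)"
      by (rule hoeffding_mean[OF _ _ ind _ ea]) (use sizes in \<open>auto simp: J_def\<close>)
    also have "(\<Sum>x\<in>J. expectation (\<lambda>w. of_bool (Z1 x w))) = (\<Sum>x\<in>J. acc P i g)"
      by (rule sum.cong) (use J expectation_Z1 in \<open>auto simp: J_def subset_iff\<close>)
    finally have "prob (bad i g) \<le> 2 * exp (- 2 * real (panel1 C) * (eps_a P C)\<^sup>2)"
      using sizes by (simp only: sum card) (simp add: bad_def est1_def z1_def)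
    also have "- 2 * real (panel1 C) * (eps_a P C)\<^sup>2 = - ln (2 * c / delta1 C)"
      unfolding eps_a_def using eps_a_arg sizes by (simp add: c_def mult.assoc)
    also have "2 * exp (- ln (2 * c / delta1 C)) = delta1 C / c"
      using c delta1 by (simp add: exp_minus)
    finally show "prob (bad i g) \<le> delta1 C / c" .
  qed
  have sub: "{w \<in> space M. \<not> stage1_ok (z1 w)} \<subseteq> (\<Union>x\<in>{1..tasks P} \<times> workflows P. bad (fst x) (snd x))"
  proof
    fix w assume "w \<in> {w \<in> space M. \<not> stage1_ok (z1 w)}"
    then obtain i g where "i \<in> {1..tasks P}" "g \<in> workflows P" "w \<in> bad i g"
      by (auto simp: stage1_ok_def bad_def not_le)
    then show "w \<in> (\<Union>x\<in>{1..tasks P} \<times> workflows P. bad (fst x) (snd x))"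
      by (intro UN_I[of "(i, g)"]) simp_all
  qed
  have "prob {w \<in> space M. \<not> stage1_ok (z1 w)} \<le> prob (\<Union>x\<in>{1..tasks P} \<times> workflows P. bad (fst x) (snd x))"
    by (rule finite_measure_mono[OF sub]) (use workflows ev in \<open>auto intro!: sets.finite_UN\<close>)
  also have "\<dots> \<le> (\<Sum>x\<in>{1..tasks P} \<times> workflows P. prob (bad (fst x) (snd x)))"
    using workflows ev by (intro finite_measure_subadditive_finite) auto
  also have "\<dots> \<le> (\<Sum>x\<in>{1..tasks P} \<times> workflows P. delta1 C / c)"
    using one by (intro sum_mono) auto
  also have "\<dots> = c * (delta1 C / c)" by (simp add: c_def card_cartesian_product)
  also have "\<dots> = delta1 C" using c by simp
  finally show ?thesis .
qed

lemma stage2_determined: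
  assumes S: "S \<subseteq> workflows P" and w: "w \<in> space M" "v \<in> space M" "same_side obs2 w v"
  shows "m \<in> candidates P C S \<Longrightarrow> final_estimate P C S (z2 w) m = final_estimate P C S (z2 v) m"
proof -
  have Z2: "Z2 x w = Z2 x v" if "x \<in> stage2_index P C" for x
  proof -
    have "{w \<in> space M. Z2 x w} \<in> obs2" using that by (auto simp: obs2_def)
    then have "w \<in> {w \<in> space M. Z2 x w} \<longleftrightarrow> v \<in> {w \<in> space M. Z2 x w}"
      by (rule bspec[OF w(3)[unfolded same_side_def]])
    then show ?thesis using w by simp
  qed
  assume m: "m \<in> candidates P C S"
  have "z2 w (l, i, g, q) = z2 v (l, i, g, q)"
    if "l \<in> {1..panel2 C}" "i \<in> {1..tasks P}" "g \<in> S" "q \<in> {1..m g}" for l i g q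
    using that S candidates_props(4)[OF S m, of g] by (auto simp: z2_def stage2_index_def intro!: Z2)
  then show ?thesis unfolding final_estimate_def by (simp cong: if_cong)
qed

text \<open>For fixed \<open>S\<close> each estimate is an average of
  \<open>tasks P * panel2 C\<close> independent recoveries in \<open>[0, 1]\<close>, not identically
  distributed. Different candidates share draws, so they are combined by a union bound. Membership
  in \<open>algebra2\<close> is recorded for the later independence argument.\<close>

lemma stage2_failure:
  assumes S: "S \<subseteq> workflows P"
  shows "prob {w \<in> space M. \<not> stage2_ok S (z2 w)} \<le> delta2 C"
    and "{w \<in> space M. \<not> stage2_ok S (z2 w)} \<in> sets algebra2"
proof -
  define e where "e = eps_samp P C S"
  define bad where "bad m = {w \<in> space M. e < \<bar>final_estimate P C S (z2 w) m - stoch_value P m\<bar>}" for m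
  define Nc where "Nc = real (num_candidates C S)"
  have Nc: "1 \<le> Nc" using num_candidates_pos[of S] by (simp add: Nc_def)
  have finS: "finite S" using S workflows by (rule finite_subset)
  have ev2: "bad m \<in> sets algebra2" if m: "m \<in> candidates P C S" for m
  proof -
    have "{w \<in> space algebra2. e < \<bar>final_estimate P C S (z2 w) m - stoch_value P m\<bar>} \<in> sets algebra2"
    proof (rule determined_sets[OF finite_obs(2) obs2_sets])
      fix w v assume "w \<in> space algebra2" "v \<in> space algebra2" "same_side obs2 w v"
      then have "final_estimate P C S (z2 w) m = final_estimate P C S (z2 v) m"
        unfolding space_algebra by (rule stage2_determined[OF S _ _ _ m])
      then show "(e < \<bar>final_estimate P C S (z2 w) m - stoch_value P m\<bar>) =
          (e < \<bar>final_estimate P C S (z2 v) m - stoch_value P m\<bar>)" by (simp only:)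
    qed
    then show ?thesis by (simp only: space_algebra bad_def)
  qed
  have eq: "{w \<in> space M. \<not> stage2_ok S (z2 w)} = (\<Union>m\<in>candidates P C S. bad m)"
    by (auto simp: stage2_ok_def bad_def e_def not_le)
  show "{w \<in> space M. \<not> stage2_ok S (z2 w)} \<in> sets algebra2"
    unfolding eq using ev2 candidates_props(1)[OF S] by (intro sets.finite_UN) auto
  have one: "prob (bad m) \<le> delta2 C / Nc" if m: "m \<in> candidates P C S" for m
  proof (cases "m = (\<lambda>_. 0)")
    case True
    have "0 \<le> e" unfolding e_def by (rule eps_nonneg)
    then have "bad m = {}" using True by (simp add: bad_def final_estimate_def stoch_value_def)
    then show ?thesis using delta2 Nc by simp
  next
    case False
    obtain gs where gs: "set gs \<subseteq> S" "m = count_list gs"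
      using counts_on_count_list[OF finS candidates_props(3)[OF S m]] by blast
    have gsW: "set gs \<subseteq> workflows P" using gs S by blast
    define k where "k = length gs"
    have size: "size_of P m = k" using gs gsW workflows by (simp add: size_of_count_list k_def)
    have gs0: "gs \<noteq> []" using False gs by auto
    have kK: "k \<in> {1..Kmax P}"
    proof -
      have "k \<in> grid C" using m False size by (auto simp: candidates_def)
      then show ?thesis using grid by blast
    qed
    interpret curve: recovery_curve "curve P k" k by (rule recovery_curve[OF kK])
    \<comment> \<open>The indicators read by sample \<open>l\<close> on task \<open>i\<close>. These
      blocks are disjoint, which makes the recoveries \<open>X\<close> independent.\<close>
    define K where "K = (\<lambda>(l, i). (\<lambda>(g, q). (l, i, g, q)) ` (SIGMA g:S. {1..m g}) :: (nat \<times> nat \<times> 'g \<times> nat) set)"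
    define I where "I = {1..panel2 C} \<times> {1..tasks P}"
    define R where "R x w = (\<Sum>g\<in>S. \<Sum>q=1..m g. of_bool (Z2 (fst x, snd x, g, q) w) :: nat)" for x w
    define X where "X x w = curve P k (R x w)" for x w
    have KI: "K x \<subseteq> stage2_index P C" if "x \<in> I" for x
      using that S candidates_props(4)[OF S m] order.trans
      by (force simp: K_def I_def stage2_index_def)
    have Rk: "R x w \<le> k" for x w
    proof -
      have "R x w \<le> (\<Sum>g\<in>S. \<Sum>q=1..m g. 1)" unfolding R_def by (intro sum_mono) simp
      also have "\<dots> = k" using gs finS by (simp add: k_def sum_count_set)
      finally show ?thesis .
    qed
    have ind: "indep_vars (\<lambda>_. borel) X I"
    proof -
      have "indep_vars (\<lambda>x. PiM (K x) (\<lambda>_. count_space UNIV)) (\<lambda>x w. restrict (\<lambda>y. Z2 y w) (K x)) I"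
        by (rule indep_vars_restrict[OF stage2_indep KI]) (auto simp: disjoint_family_on_def K_def)
      then have "indep_vars (\<lambda>_. borel) (\<lambda>x w. (\<lambda>f. curve P k (nat \<lfloor>\<Sum>g\<in>S. \<Sum>q=1..m g. of_bool (f (fst x, snd x, g, q)) :: real\<rfloor>))
          (restrict (\<lambda>y. Z2 y w) (K x))) I"
      proof (rule indep_vars_compose2)
        fix x assume "x \<in> I"
        have "(\<lambda>f. f (fst x, snd x, g, q)) \<in> measurable (PiM (K x) (\<lambda>_. count_space UNIV)) (count_space (UNIV :: bool set))"
          if "g \<in> S" "q \<in> {1..m g}" for g q
          using that by (intro measurable_component_singleton) (auto simp: K_def case_prod_unfold)
        then have "(\<lambda>f. of_bool (f (fst x, snd x, g, q)) :: real) \<in> borel_measurable (PiM (K x) (\<lambda>_. count_space UNIV))"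
          if "g \<in> S" "q \<in> {1..m g}" for g q
          using that by (intro measurable_compose[OF _ borel_measurable_count_space])
        then have "(\<lambda>f. \<Sum>g\<in>S. \<Sum>q=1..m g. of_bool (f (fst x, snd x, g, q)) :: real) \<in> borel_measurable (PiM (K x) (\<lambda>_. count_space UNIV))"
          by (intro borel_measurable_sum) auto
        then show "(\<lambda>f. curve P k (nat \<lfloor>\<Sum>g\<in>S. \<Sum>q=1..m g. of_bool (f (fst x, snd x, g, q)) :: real\<rfloor>))
            \<in> borel_measurable (PiM (K x) (\<lambda>_. count_space UNIV))"
          by measurable
      qed
      moreover have "(\<lambda>f. curve P k (nat \<lfloor>\<Sum>g\<in>S. \<Sum>q=1..m g. of_bool (f (fst x, snd x, g, q)) :: real\<rfloor>))
          (restrict (\<lambda>y. Z2 y w) (K x)) = X x w" for x w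
      proof -
        have "(\<Sum>g\<in>S. \<Sum>q=1..m g. of_bool (restrict (\<lambda>y. Z2 y w) (K x) (fst x, snd x, g, q)) :: real) = real (R x w)"
          unfolding R_def of_nat_sum
          by (intro sum.cong refl) (auto simp: K_def case_prod_unfold image_iff)
        then show ?thesis by (simp only: X_def floor_of_nat nat_int)
      qed
      ultimately show ?thesis by simp
    qed
    have E: "expectation (X x) = pb (map (acc P (snd x)) gs) (curve P k)" if "x \<in> I" for x
      unfolding X_def R_def gs(2)
    proof (rule expectation_counts[OF stage2_indep finS gs(1)])
      fix g q assume g: "g \<in> S" "q \<in> {1..count_list gs g}"
      then have mem: "(fst x, snd x, g, q) \<in> stage2_index P C"
        using KI[OF that] by (auto simp: K_def case_prod_unfold gs(2))
      then show "(fst x, snd x, g, q) \<in> stage2_index P C \<and>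
          expectation (\<lambda>w. of_bool (Z2 (fst x, snd x, g, q) w)) = acc P (snd x) g"
        using expectation_Z2 by simp
    qed (auto simp: inj_on_def)
    have card: "real (card I) = real (tasks P) * real (panel2 C)" by (simp add: I_def)
    have pos: "0 < real (tasks P)" "0 < real (panel2 C)" using tasks sizes by auto
    have mean: "(\<Sum>x\<in>I. X x w) / real (card I) - price P * cost_of P m = final_estimate P C S (z2 w) m" for w
    proof -
      have "(\<Sum>x\<in>I. X x w) = (\<Sum>l=1..panel2 C. \<Sum>i=1..tasks P. X (l, i) w)"
        unfolding I_def by (simp add: sum.cartesian_product)
      then show ?thesis using False size
        by (simp add: final_estimate_def X_def R_def z2_def card sum_divide_distrib[symmetric] mult.commute)
    qed
    have mean2: "(\<Sum>x\<in>I. expectation (X x)) / real (card I) - price P * cost_of P m = stoch_value P m"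
    proof -
      have "(\<Sum>x\<in>I. expectation (X x)) = (\<Sum>(l, i)\<in>I. pb (map (acc P i) gs) (curve P k))"
        using E by (intro sum.cong) auto
      also have "\<dots> = real (panel2 C) * (\<Sum>i=1..tasks P. pb (map (acc P i) gs) (curve P k))"
        unfolding I_def by (simp add: sum.cartesian_product[symmetric])
      finally show ?thesis
        using pos unfolding gs(2) stoch_value_count_list'[OF gsW gs0]
        by (simp add: list_value_def card k_def cost_of_count_list[OF workflows gsW])
    qed
    have "bad m = {w \<in> space M. e < \<bar>(\<Sum>x\<in>I. X x w) / real (card I) - (\<Sum>x\<in>I. expectation (X x)) / real (card I)\<bar>}"
      unfolding bad_def mean[symmetric] mean2[symmetric] by simp
    also have "prob \<dots> \<le> 2 * exp (- 2 * real (card I) * e\<^sup>2)"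
    proof (rule hoeffding_mean[OF _ _ ind])
      show "X x w \<in> {0..1}" for x w unfolding X_def by (rule curve.psi_range[OF Rk])
      show "0 \<le> e" unfolding e_def by (rule eps_nonneg)
    qed (use tasks sizes in \<open>auto simp: I_def\<close>)
    \<comment> \<open>\<open>eps_samp\<close> is chosen to make the bound for one candidate equal to
      \<open>delta2 C / Nc\<close>.\<close>
    also have "- 2 * real (card I) * e\<^sup>2 = - ln (2 * Nc / delta2 C)"
      unfolding e_def eps_samp_def using eps_samp_arg[of S] pos by (simp add: card Nc_def)
    also have "2 * exp (- ln (2 * Nc / delta2 C)) = delta2 C / Nc"
      using Nc delta2 by (simp add: exp_minus)
    finally show ?thesis .
  qed
  have "prob {w \<in> space M. \<not> stage2_ok S (z2 w)} \<le> (\<Sum>m\<in>candidates P C S. prob (bad m))"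
    unfolding eq using ev2 algebra_events candidates_props(1)[OF S]
    by (intro finite_measure_subadditive_finite) auto
  also have "\<dots> \<le> (\<Sum>m\<in>candidates P C S. delta2 C / Nc)" by (intro sum_mono one)
  also have "\<dots> = real (card (candidates P C S)) * (delta2 C / Nc)" by simp
  also have "\<dots> \<le> Nc * (delta2 C / Nc)"
    using candidates_props(2)[OF S] delta2 Nc by (intro mult_right_mono) (auto simp: Nc_def)
  also have "\<dots> = delta2 C" using Nc by simp
  finally show "prob {w \<in> space M. \<not> stage2_ok S (z2 w)} \<le> delta2 C" .
qed

definition fpool :: "'w \<Rightarrow> 'g set" where
  "fpool w = frozen_pool P C (z1 w) (ys w)"

lemma fpool_sub: "w \<in> space M \<Longrightarrow> fpool w \<subseteq> workflows P"
  unfolding fpool_def by (rule frozen_pool_props(1)) (rule ys_workflows)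

lemma fpool_determined:
  "w \<in> space M \<Longrightarrow> v \<in> space M \<Longrightarrow> same_side obs1 w v \<Longrightarrow> fpool w = fpool v"
  unfolding fpool_def frozen_pool_def by (simp only: generation_determined(1))

lemma finite_fpools: "finite (fpool ` space M)"
  by (rule determined_finite_image[OF finite_obs(1) fpool_determined])

text \<open>The pool and its tolerance \<open>eps_samp\<close> are random, so the bound for fixed
  \<open>S\<close> is applied on each event \<open>fpool w = S\<close>. That event is in
  \<open>algebra1\<close> and thus independent of the Stage-2 failure for \<open>S\<close>; the
  disjoint events have total probability at most 1.\<close>

lemma frozen_failure:
  "prob {w \<in> space M. \<not> stage2_ok (fpool w) (z2 w)} \<le> delta2 C"
  "{w \<in> space M. \<not> stage2_ok (fpool w) (z2 w)} \<in> events"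
proof -
  define A where "A S = {w \<in> space M. fpool w = S}" for S
  define B where "B S = {w \<in> space M. \<not> stage2_ok S (z2 w)}" for S
  have A: "A S \<in> sets algebra1" for S
    unfolding A_def
  proof (rule determined_event(1))
    show "(fpool w = S) = (fpool v = S)" if "w \<in> space M" "v \<in> space M" "same_side obs1 w v" for w v
      unfolding fpool_determined[OF that] ..
  qed
  have sub: "S \<subseteq> workflows P" if "S \<in> fpool ` space M" for S using that fpool_sub by auto
  have B: "B S \<in> sets algebra2" "prob (B S) \<le> delta2 C" if "S \<in> fpool ` space M" for S
    unfolding B_def using stage2_failure[OF sub[OF that]] by auto
  have ev: "A S \<in> events" "B S \<in> events" if "S \<in> fpool ` space M" for S
    using A B that algebra_events by auto
  have eq: "{w \<in> space M. \<not> stage2_ok (fpool w) (z2 w)} = (\<Union>S\<in>fpool ` space M. A S \<inter> B S)"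
    by (auto simp: A_def B_def)
  show "{w \<in> space M. \<not> stage2_ok (fpool w) (z2 w)} \<in> events"
    unfolding eq using ev finite_fpools by (intro sets.finite_UN) auto
  have "prob {w \<in> space M. \<not> stage2_ok (fpool w) (z2 w)} \<le> (\<Sum>S\<in>fpool ` space M. prob (A S \<inter> B S))"
    unfolding eq using ev finite_fpools by (intro finite_measure_subadditive_finite) auto
  also have "\<dots> = (\<Sum>S\<in>fpool ` space M. prob (A S) * prob (B S))"
    using indep_setD[OF indep_algebras A B(1)] by (intro sum.cong) auto
  also have "\<dots> \<le> (\<Sum>S\<in>fpool ` space M. prob (A S) * delta2 C)"
    using B(2) by (intro sum_mono mult_left_mono) auto
  also have "\<dots> = prob (\<Union>S\<in>fpool ` space M. A S) * delta2 C"
  proof -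
    have "disjoint_family_on A (fpool ` space M)" by (auto simp: disjoint_family_on_def A_def)
    then have "prob (\<Union>S\<in>fpool ` space M. A S) = (\<Sum>S\<in>fpool ` space M. prob (A S))"
      using ev(1) by (intro finite_measure_finite_Union[OF finite_fpools]) auto
    then show ?thesis by (simp only: sum_distrib_right)
  qed
  also have "\<dots> \<le> 1 * delta2 C" using delta2 by (intro mult_right_mono) auto
  finally show "prob {w \<in> space M. \<not> stage2_ok (fpool w) (z2 w)} \<le> delta2 C" by simp
qed

text \<open>Earlier failures in the batch are part of the query history, which takes finitely many values.
  Given each of them, the next call fails with probability at most \<open>1 - p_orc \<le> exp (- p_orc)\<close>.\<close>

lemma batch_failure:
  assumes b: "b < N_price" and t: "t \<le> batch_size C"
  shows "prob {w \<in> space M. b < length (qlog (generation P C (z1 w) (ys w))) \<and>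
      (\<forall>j\<in>{b * batch_size C..<b * batch_size C + t}. \<not> call_good P C (z1 w) (ys w) j)} \<le> exp (- p_orc) ^ t"
  using t
proof (induction t)
  case (Suc t)
  define m where "m = batch_size C"
  define j where "j = b * m + t"
  define H where "H w = query_history P C (z1 w) (ys w) j" for w
  define good where "good w \<longleftrightarrow> call_good P C (z1 w) (ys w) j" for w
  define E where "E = {w \<in> space M. b < length (qlog (generation P C (z1 w) (ys w))) \<and>
      (\<forall>j\<in>{b * m..<b * m + t}. \<not> call_good P C (z1 w) (ys w) j)}"
  have jb: "j div m = b" using Suc.prems unfolding j_def m_def by (intro div_nat_eqI) auto
  have "Suc b * m \<le> N_price * m" using b by (intro mult_right_mono) auto
  then have j: "j < n_calls" using Suc.prems by (simp add: j_def m_def n_calls_def)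
  have Hdet: "H w = H v" if "w \<in> space M" "v \<in> space M" "same_side obs1 w v" for w v
    unfolding H_def using generation_determined(3)[OF that j] .
  have gdet: "good w = good v" if "w \<in> space M" "v \<in> space M" "same_side obs1 w v" for w v
    unfolding good_def using generation_determined(2)[OF that j] .
  have ev: "{w \<in> space M. H w = x} \<in> events" "{w \<in> space M. good w \<and> H w = x} \<in> events"
    "{w \<in> space M. \<not> good w \<and> H w = x} \<in> events" for x
    by (rule determined_event(2), use Hdet gdet in metis)+
  have fin: "finite (H ` E)"
    using determined_finite_image[OF finite_obs(1) Hdet] by (rule finite_subset[rotated]) (auto simp: E_def)
  \<comment> \<open>\<open>E\<close> is a union of level sets of the history: the truncated log has
    length \<open>Suc b\<close> exactly when batch \<open>b\<close> was issued, and the recorded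
    qualities decide which earlier calls failed.\<close>
  have sat: "v \<in> E" if w: "w \<in> E" and v: "v \<in> space M" "H v = H w" for w v
  proof -
    have "length (take (Suc b) (qlog (generation P C (z1 v) (ys v)))) =
        length (take (Suc b) (qlog (generation P C (z1 w) (ys w))))"
      using v(2) unfolding H_def query_history_def jb[unfolded m_def] by simp
    moreover have "\<forall>i<j. call_good P C (z1 v) (ys v) i = call_good P C (z1 w) (ys w) i"
      using v(2) unfolding H_def query_history_def by (simp add: map_eq_conv)
    ultimately show ?thesis using w v(1) by (auto simp: E_def j_def)
  qed
  have atom: "prob {w \<in> space M. \<not> good w \<and> H w = x} \<le> exp (- p_orc) * prob {w \<in> space M. H w = x}"
    if "x \<in> H ` E" for x
  proof (cases "prob {w \<in> space M. H w = x} = 0")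
    case True
    \<comment> \<open>Conditional probabilities given a null history are unconstrained, but such a
      history contributes nothing.\<close>
    have "prob {w \<in> space M. \<not> good w \<and> H w = x} \<le> prob {w \<in> space M. H w = x}"
      by (rule finite_measure_mono) (use ev in auto)
    then show ?thesis using True by simp
  next
    case False
    then have pos: "0 < prob {w \<in> space M. H w = x}" by (simp add: zero_less_measure_iff)
    from that obtain w where w: "w \<in> E" "x = H w" by auto
    have "call_made P C (z1 w) (ys w) j" using w jb by (simp add: call_made_def E_def m_def)
    then have "p_orc \<le> cond_prob M good (\<lambda>v. H v = x)"
      using pricing_calls[of w j] w pos unfolding H_def good_def z1_def ys_def E_def by simp
    then have "p_orc * prob {w \<in> space M. H w = x} \<le> prob {w \<in> space M. good w \<and> H w = x}"
      using pos by (simp add: cond_prob_def pos_le_divide_eq)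
    moreover have "prob {w \<in> space M. H w = x} =
        prob {w \<in> space M. good w \<and> H w = x} + prob {w \<in> space M. \<not> good w \<and> H w = x}"
      by (subst finite_measure_Union[symmetric]) (use ev in \<open>auto intro!: arg_cong[where f = prob]\<close>)
    ultimately have "prob {w \<in> space M. \<not> good w \<and> H w = x} \<le> (1 - p_orc) * prob {w \<in> space M. H w = x}"
      by (simp add: algebra_simps)
    also have "\<dots> \<le> exp (- p_orc) * prob {w \<in> space M. H w = x}"
      using exp_ge_add_one_self[of "- p_orc"] by (intro mult_right_mono) auto
    finally show ?thesis .
  qed
  \<comment> \<open>Failure of one more call is split according to the history before that call,
    which turns the conditional bound into a factor \<open>exp (- p_orc)\<close>.\<close>
  have "{w \<in> space M. b < length (qlog (generation P C (z1 w) (ys w))) \<and>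
      (\<forall>j\<in>{b * batch_size C..<b * batch_size C + Suc t}. \<not> call_good P C (z1 w) (ys w) j)}
      = (\<Union>x\<in>H ` E. {w \<in> space M. \<not> good w \<and> H w = x})" (is "?E' = _")
  proof (intro equalityI subsetI)
    fix w assume "w \<in> ?E'"
    then have "w \<in> E" "\<not> good w" by (auto simp: E_def good_def j_def m_def)
    then show "w \<in> (\<Union>x\<in>H ` E. {w \<in> space M. \<not> good w \<and> H w = x})" by (auto simp: E_def)
  next
    fix w assume "w \<in> (\<Union>x\<in>H ` E. {w \<in> space M. \<not> good w \<and> H w = x})"
    then have w: "w \<in> space M" "\<not> good w" "w \<in> E" using sat by auto
    have "\<not> call_good P C (z1 w) (ys w) i" if "i \<in> {b * m..<b * m + Suc t}" for i
      using that w by (cases "i = j") (auto simp: E_def good_def j_def)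
    then show "w \<in> ?E'" using w(3) by (auto simp: E_def m_def)
  qed
  moreover have "(\<lambda>x. {w \<in> space M. \<not> good w \<and> H w = x}) ` H ` E \<subseteq> events" using ev(3) by blast
  ultimately have "prob ?E' \<le> (\<Sum>x\<in>H ` E. prob {w \<in> space M. \<not> good w \<and> H w = x})"
    using finite_measure_subadditive_finite[OF fin] by simp
  also have "\<dots> \<le> (\<Sum>x\<in>H ` E. exp (- p_orc) * prob {w \<in> space M. H w = x})"
    by (intro sum_mono atom)
  also have "\<dots> = exp (- p_orc) * (\<Sum>x\<in>H ` E. prob {w \<in> space M. H w = x})"
    by (simp only: sum_distrib_left)
  also have "(\<Sum>x\<in>H ` E. prob {w \<in> space M. H w = x}) = prob (\<Union>x\<in>H ` E. {w \<in> space M. H w = x})"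
    by (rule finite_measure_finite_Union[symmetric, OF fin]) (use ev in \<open>auto simp: disjoint_family_on_def\<close>)
  also have "(\<Union>x\<in>H ` E. {w \<in> space M. H w = x}) = E"
  proof (intro equalityI subsetI)
    fix w assume "w \<in> (\<Union>x\<in>H ` E. {w \<in> space M. H w = x})"
    then show "w \<in> E" using sat by auto
  next
    fix w assume w: "w \<in> E"
    then have "w \<in> space M" by (simp add: E_def)
    with w show "w \<in> (\<Union>x\<in>H ` E. {w \<in> space M. H w = x})" by auto
  qed
  also have "exp (- p_orc) * prob E \<le> exp (- p_orc) * exp (- p_orc) ^ t"
    using Suc.IH Suc.prems unfolding E_def m_def by (intro mult_left_mono) auto
  finally show ?case by simp
qed simp

lemma oracle_failure:
  "prob {w \<in> space M. \<not> oracle_ok (z1 w) (ys w)} \<le> real N_price * exp (- p_orc * real (batch_size C))"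
  "{w \<in> space M. \<not> oracle_ok (z1 w) (ys w)} \<in> events"
proof -
  show "{w \<in> space M. \<not> oracle_ok (z1 w) (ys w)} \<in> events"
    by (rule determined_event(2)) (simp only: generation_determined(5))
  define E where "E b = {w \<in> space M. b < length (qlog (generation P C (z1 w) (ys w))) \<and>
      (\<forall>j\<in>{b * batch_size C..<b * batch_size C + batch_size C}. \<not> call_good P C (z1 w) (ys w) j)}" for b
  have ev: "E b \<in> events" if b: "b < N_price" for b
    unfolding E_def
  proof (rule determined_event(2))
    fix w v assume wv: "w \<in> space M" "v \<in> space M" "same_side obs1 w v"
    have "Suc b * batch_size C \<le> n_calls" using b unfolding n_calls_def by (intro mult_right_mono) auto
    then have "call_good P C (z1 w) (ys w) j = call_good P C (z1 v) (ys v) j"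
      if "j \<in> {b * batch_size C..<b * batch_size C + batch_size C}" for j
      using that by (intro generation_determined(2)[OF wv]) auto
    then show "(b < length (qlog (generation P C (z1 w) (ys w))) \<and>
        (\<forall>j\<in>{b * batch_size C..<b * batch_size C + batch_size C}. \<not> call_good P C (z1 w) (ys w) j)) =
      (b < length (qlog (generation P C (z1 v) (ys v))) \<and>
        (\<forall>j\<in>{b * batch_size C..<b * batch_size C + batch_size C}. \<not> call_good P C (z1 v) (ys v) j))"
      unfolding generation_determined(1)[OF wv] by simp
  qed
  have sub: "{w \<in> space M. \<not> oracle_ok (z1 w) (ys w)} \<subseteq> (\<Union>b<N_price. E b)"
  proof
    fix w assume "w \<in> {w \<in> space M. \<not> oracle_ok (z1 w) (ys w)}"
    then obtain b where w: "w \<in> space M" and b: "b < length (qlog (generation P C (z1 w) (ys w)))"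
      "\<forall>j\<in>{b * batch_size C..<b * batch_size C + batch_size C}. \<not> call_good P C (z1 w) (ys w) j"
      unfolding oracle_ok_def by blast
    moreover have "b < N_price" using b qlog_length[OF w] by simp
    ultimately show "w \<in> (\<Union>b<N_price. E b)" unfolding E_def by blast
  qed
  have "prob {w \<in> space M. \<not> oracle_ok (z1 w) (ys w)} \<le> prob (\<Union>b<N_price. E b)"
    by (rule finite_measure_mono[OF sub]) (use ev in auto)
  also have "\<dots> \<le> (\<Sum>b<N_price. prob (E b))"
    using ev by (intro finite_measure_subadditive_finite) auto
  also have "\<dots> \<le> (\<Sum>b<N_price. exp (- p_orc) ^ batch_size C)"
    unfolding E_def by (intro sum_mono batch_failure) auto
  also have "\<dots> = real N_price * exp (- p_orc * real (batch_size C))"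
    by (simp add: exp_of_nat_mult[symmetric] mult.commute)
  finally show "prob {w \<in> space M. \<not> oracle_ok (z1 w) (ys w)} \<le> real N_price * exp (- p_orc * real (batch_size C))" .
qed

lemma returned_determined:
  assumes w: "w \<in> space M" "v \<in> space M" "same_side (obs1 \<union> obs2) w v"
  shows "fpool w = fpool v" "returned P C (z1 w) (ys w) (z2 w) = returned P C (z1 v) (ys v) (z2 v)"
proof -
  have s: "same_side obs1 w v" "same_side obs2 w v" using w(3) by (auto simp: same_side_def)
  show f: "fpool w = fpool v" by (rule fpool_determined[OF w(1,2) s(1)])
  note S = fpool_sub[OF w(2)]
  have est: "final_estimate P C (fpool v) (z2 w) m = final_estimate P C (fpool v) (z2 v) m"
    if "m \<in> candidates P C (fpool v)" for m
    by (rule stage2_determined[OF S w(1,2) s(2) that])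
  have am: "arg_max_on (final_estimate P C (fpool v) (z2 w)) (candidates P C (fpool v)) =
      arg_max_on (final_estimate P C (fpool v) (z2 v)) (candidates P C (fpool v))"
    by (rule arg_max_on_cong) (rule est)
  have "arg_max_on (final_estimate P C (fpool v) (z2 v)) (candidates P C (fpool v)) \<in> candidates P C (fpool v)"
    by (rule arg_max_on_finite(1)[OF candidates_props(1)[OF S]]) (simp add: candidates_def)
  then have "final_choice P C (fpool v) (z2 w) = final_choice P C (fpool v) (z2 v)"
    unfolding final_choice_def Let_def am by (simp only: est)
  then show "returned P C (z1 w) (ys w) (z2 w) = returned P C (z1 v) (ys v) (z2 v)"
    unfolding returned_def fpool_def[symmetric] f .
qed

lemma guarantee_prob:
  "1 - delta1 C - delta2 C - real N_price * exp (- p_orc * real (batch_size C)) \<le>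
    prob {w \<in> space M. let S = fpool w; m = returned P C (z1 w) (ys w) (z2 w)
      in stoch_value P m \<ge>
          max (lower_bound C)
            (1 / \<rho> * stoch_opt P - eps_ell C - eps_rnd P C - 2 * eps_est P C - 2 * eps_samp P C S)
       \<and> stoch_value P m \<ge>
          1 / \<rho> * (lower_bound C /
            (lower_bound C + eps_ell C + eps_rnd P C + 2 * eps_est P C + 2 * eps_samp P C S))
          * stoch_opt P}" (is "_ \<le> prob {w \<in> space M. ?T w}")
proof -
  define B1 where "B1 = {w \<in> space M. \<not> stage1_ok (z1 w)}"
  define B2 where "B2 = {w \<in> space M. \<not> stage2_ok (fpool w) (z2 w)}"
  define B3 where "B3 = {w \<in> space M. \<not> oracle_ok (z1 w) (ys w)}"
  \<comment> \<open>The returned vector and the pool are decided by the finitely many observations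
    of both stages, so the event is measurable.\<close>
  have T: "{w \<in> space M. ?T w} \<in> events"
  proof (rule determined_sets)
    show "finite (obs1 \<union> obs2)" using finite_obs by simp
    show "obs1 \<union> obs2 \<subseteq> events" using obs1_sets obs2_sets algebra_events by blast
    show "?T w = ?T v" if "w \<in> space M" "v \<in> space M" "same_side (obs1 \<union> obs2) w v" for w v
      unfolding returned_determined[OF that] ..
  qed
  have B: "B1 \<in> events" "B2 \<in> events" "B3 \<in> events"
    unfolding B2_def B3_def using frozen_failure oracle_failure
    by (auto simp: B1_def intro!: determined_event(2) simp: generation_determined(4))
  have "w \<in> {w \<in> space M. ?T w} \<union> (B1 \<union> (B2 \<union> B3))" if w: "w \<in> space M" for w
  proof (rule ccontr)
    assume "w \<notin> {w \<in> space M. ?T w} \<union> (B1 \<union> (B2 \<union> B3))"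
    then have ok: "\<not> ?T w" "stage1_ok (z1 w)" "oracle_ok (z1 w) (ys w)" "stage2_ok (frozen_pool P C (z1 w) (ys w)) (z2 w)"
      using w by (auto simp: B1_def B2_def B3_def fpool_def)
    then show False using guarantee[OF ys_workflows[OF w] ok(2-4)] by (simp only: Let_def fpool_def) blast
  qed
  then have "prob (space M) \<le> prob ({w \<in> space M. ?T w} \<union> (B1 \<union> (B2 \<union> B3)))"
    using T B by (intro finite_measure_mono) blast+
  also have "\<dots> \<le> prob {w \<in> space M. ?T w} + (prob B1 + (prob B2 + prob B3))"
    using T B by (intro order.trans[OF measure_Un_le] add_mono order.refl) auto
  finally show ?thesis
    using stage1_failure frozen_failure(1) oracle_failure(1)
    by (simp add: prob_space B1_def B2_def B3_def)
qed

end

theorem theorem5: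
  fixes P :: "'g problem" and C :: "'g config" and M :: "'w measure"
    and h :: "real \<Rightarrow> real" and \<rho> p_orc :: real and N_price :: nat
    and Z1 :: "nat \<times> 'g \<times> nat \<Rightarrow> 'w \<Rightarrow> bool"
    and Y :: "nat \<Rightarrow> 'w \<Rightarrow> 'g"
    and Z2 :: "nat \<times> nat \<times> 'g \<times> nat \<Rightarrow> 'w \<Rightarrow> bool"
  assumes prob_space: "prob_space M"
    and tasks: "tasks P \<ge> 1"
    and Kmax: "Kmax P \<ge> 1"
    and workflows: "finite (workflows P)"
    and acc: "\<And>i g. i \<in> {1..tasks P} \<Longrightarrow> g \<in> workflows P \<Longrightarrow> 0 \<le> acc P i g \<and> acc P i g \<le> 1"
    and cost: "\<And>g. g \<in> workflows P \<Longrightarrow> 0 \<le> cost P g \<and> cost P g \<le> cmax C"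
    and price: "price P \<ge> 0"
    and h_mono: "mono_on {0..1} h"
    and h_concave: "concave_on {0..1} h"
    and h_range: "h ` {0..1} \<subseteq> {0..1}"
    and h_ends: "h 0 = 0" "h 1 = 1"
    and curve: "\<And>k r. k \<in> {1..Kmax P} \<Longrightarrow> r \<le> k \<Longrightarrow> curve P k r = h (real r / real k)"
    and grid: "grid C \<subseteq> {1..Kmax P}"
    and coverage: "\<rho> \<ge> 1"
      "\<And>k. k \<in> {1..Kmax P} \<Longrightarrow> \<exists>b\<in>grid C. b \<le> k \<and> real k \<le> \<rho> * real b"
    and init_pool: "init_pool C \<subseteq> workflows P"
    and baseline: "baseline C \<in> candidates P C (init_pool C)"
      "stoch_value P (baseline C) \<ge> lower_bound C" "lower_bound C > 0"
    and sizes: "panel1 C \<ge> 1" "panel2 C \<ge> 1" "batch_size C \<ge> 1"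
    and delta1: "0 < delta1 C" "delta1 C < 1"
    and delta2: "0 < delta2 C" "delta2 C < 1"
    and eps_ell: "eps_ell C > 0"
    and stage1_indep:
      "prob_space.indep_vars M (\<lambda>_. count_space UNIV) Z1 (stage1_index P C)"
    and stage1_distr: "\<And>i g l. (i, g, l) \<in> stage1_index P C \<Longrightarrow>
      distr M (count_space UNIV) (Z1 (i, g, l)) = measure_pmf (bernoulli_pmf (acc P i g))"
    and stage2_indep:
      "prob_space.indep_vars M (\<lambda>_. count_space UNIV) Z2 (stage2_index P C)"
    and stage2_distr: "\<And>l i g q. (l, i, g, q) \<in> stage2_index P C \<Longrightarrow>
      distr M (count_space UNIV) (Z2 (l, i, g, q)) = measure_pmf (bernoulli_pmf (acc P i g))"
    and answers: "\<And>j. Y j \<in> measurable M (count_space (workflows P))"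
    and stages_indep: "prob_space.indep_set M
      (sets (vimage_algebra (space M)
        (\<lambda>w. (\<lambda>x\<in>stage1_index P C. Z1 x w, \<lambda>j. Y j w))
        (PiM (stage1_index P C) (\<lambda>_. count_space UNIV) \<Otimes>\<^sub>M PiM UNIV (\<lambda>_. count_space (workflows P)))))
      (sets (vimage_algebra (space M)
        (\<lambda>w. \<lambda>x\<in>stage2_index P C. Z2 x w)
        (PiM (stage2_index P C) (\<lambda>_. count_space UNIV))))"
    and p_orc: "p_orc > 0"
    and pricing_calls: "\<And>j w. w \<in> space M \<Longrightarrow> call_made P C (\<lambda>x. Z1 x w) (\<lambda>j. Y j w) j \<Longrightarrow>
      measure M {v \<in> space M. query_history P C (\<lambda>x. Z1 x v) (\<lambda>j. Y j v) j =
                              query_history P C (\<lambda>x. Z1 x w) (\<lambda>j. Y j w) j} > 0 \<Longrightarrow>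
      cond_prob M
        (\<lambda>v. call_good P C (\<lambda>x. Z1 x v) (\<lambda>j. Y j v) j)
        (\<lambda>v. query_history P C (\<lambda>x. Z1 x v) (\<lambda>j. Y j v) j =
             query_history P C (\<lambda>x. Z1 x w) (\<lambda>j. Y j w) j) \<ge> p_orc"
    and N_price: "\<And>w. w \<in> space M \<Longrightarrow>
      length (qlog (generation P C (\<lambda>x. Z1 x w) (\<lambda>j. Y j w))) \<le> N_price"
  shows "measure M {w \<in> space M.
           let S = frozen_pool P C (\<lambda>x. Z1 x w) (\<lambda>j. Y j w);
               m = returned P C (\<lambda>x. Z1 x w) (\<lambda>j. Y j w) (\<lambda>x. Z2 x w)
           in stoch_value P m \<ge>
                max (lower_bound C)
                  (1 / \<rho> * stoch_opt P - eps_ell C - eps_rnd P C - 2 * eps_est P C - 2 * eps_samp P C S)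
            \<and> stoch_value P m \<ge>
                1 / \<rho> * (lower_bound C /
                  (lower_bound C + eps_ell C + eps_rnd P C + 2 * eps_est P C + 2 * eps_samp P C S))
                * stoch_opt P}
         \<ge> 1 - delta1 C - delta2 C - real N_price * exp (- p_orc * real (batch_size C))"
proof -
  interpret workflow_run P C h \<rho> M p_orc N_price Z1 Y Z2
    by (intro workflow_run.intro workflow_setting.intro workflow_run_axioms.intro; fact assms)
  show ?thesis
    using guarantee_prob unfolding fpool_def z1_def ys_def z2_def .
qed

end
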